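(* Let $(M^{2m+1},H(M),J)$, $m\ge 1$, be a strictly pseudoconvex CR manifold, let $\ell\in\{-m,-m+2,\dots,m-2,m\}$, let $\theta$ be an adapted pseudo-Hermitian structure with a ${\rm spin}^{\mathbb C}$ structure of weight $\ell$, and let $\tilde\theta=e^{2f}\theta$ with $f\in C^\infty(M)$, equipped with the corresponding ${\rm spin}^{\mathbb C}$ structure of weight $\ell$. Denote by $\phi\mapsto\tilde\phi$ the natural unitary isomorphism $\Sigma(H(M))\cong\widetilde\Sigma(H(M))$ of the spinor bundles of $\theta$ and $\tilde\theta$. Then for every spinor $\phi\in\Gamma(\Sigma^{-\ell}(H(M)))$ (i.e. every section of the eigenbundle with $\Theta$-eigenvalue $\mu_q=-\ell$) the Kohn--Dirac operators satisfy $$D_{\tilde\theta}\big(e^{-(m+1)f}\tilde\phi\big)=e^{-(m+2)f}\,\widetilde{D_\theta\phi}.$$ That is, the restriction $\mathcal D_\ell$ of the Kohn--Dirac operator of weight $\ell$ to $\Gamma(\Sigma^{-\ell})$ is CR-covariant.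
   Context: CR and pseudo-Hermitian setting. $M$ is a connected orientable smooth manifold of dimension $2m+1$; $H(M)\subset TM$ is a corank-1 subbundle, $J$ a bundle endomorphism of $H(M)$ with $J^2=-1$. With $\{X,Y\}=-[X,Y]\bmod H(M)$, $(H(M),J)$ is strictly pseudoconvex if $\{JX,Y\}+\{X,JY\}=0$, $\{X,JX\}\ne0$ for $X\neq 0$, and the Nijenhuis tensor $[X,Y]-[JX,JY]+J([JX,Y]+[X,JY])$ vanishes on $H(M)$. $H(M)\otimes\mathbb C=T_{10}\oplus T_{01}$ are the $\pm i$-eigenbundles of $J$. An adapted pseudo-Hermitian structure is a 1-form $\theta$ with kernel $H(M)$ such that $g_\theta(X,Y)=\frac12 d\theta(X,JY)$ is positive definite on $H(M)$; its Reeb field $T$ satisfies $\theta(T)=1$, $\iota_Td\theta=0$. The Webster--Tanaka connection $\nabla^{W}$ is the connection on $TM$ for which $T$, $g_\theta$ and $J$ are parallel, with torsion ${\rm Tor}(X,Y)=d\theta(X,Y)T$ and ${\rm Tor}(T,X)=-\frac12([T,X]+J[T,JX])$ for $X,Y\in H(M)$. ${\rm Spin}^{\mathbb C}$ structures. $\mathcal K=\Lambda^{m+1,0}(M)$ is the canonical line bundle ($(p,0)$-forms are complex $p$-forms $\eta$ with $\iota_Z\eta=0$ for $Z\in T_{01}$). Fix a complex line bundle $\mathcal E(1)$ with $\mathcal E(1)^{m+2}=\mathcal K^{-1}$ and let $\mathcal E(p)=\mathcal E(1)^p$. A ${\rm spin}^{\mathbb C}$ structure for $\theta$ is a reduction $P\to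 {\rm SO}(H(M))$ of the $g_\theta$-orthonormal frame bundle of $H(M)$ to ${\rm Spin}^{\mathbb C}(2m)$; it has weight $\ell$ if its determinant line bundle is $L=\mathcal E(\ell)$. $\nabla^W$ induces connections on $\mathcal K$, $\mathcal E(p)$ and $L$; together with $\nabla^W$ on $H(M)$ this lifts to $P$ and gives the Webster--Tanaka spinor derivative $\nabla^\Sigma$ on the associated spinor bundle $\Sigma(H(M))$ (rank $2^m$). Clifford multiplication satisfies $X\cdot X\cdot\phi=-g_\theta(X,X)\phi$, $X\in H(M)$. The element $\Theta=\frac{i}{2}d\theta=i\sum_{\alpha=1}^m e_\alpha\cdot Je_\alpha$ (for any orthonormal frame $e_1,Je_1,\dots,e_m,Je_m$ of $H(M)$) of the complex Clifford bundle acts on $\Sigma(H(M))$ with eigenvalues $\mu_q=m-2q$, $q=0,\dots,m$; $\Sigma^{\mu_q}(H(M))$ denotes the eigenbundle. The Kohn--Dirac operator is $D_\theta\phi=\sum_{i=1}^{2m}s_i\cdot\nabla^\Sigma_{s_i}\phi$ for a local $g_\theta$-orthonormal frame $(s_i)$ of $H(M)$. Conformal change. For $\tilde\theta=e^{2f}\theta$, orthonormal frames $(s_i)$ for $g_\theta$ are identified with the orthonormal frames $(e^{-f}s_i)$ for $g_{\tilde\theta}$; the ${\rm U}(1)$-frame bundles of $L$ for $\theta$ and $\tilde\theta$ are naturally identified by positive rescaling; the ${\rm spin}^{\mathbb C}$ structure of $\tilde\theta$ is the unique one whose spinor frames are identified with those of $\theta$. This induces the unitary isomorphism $\phi\mapsto\tilde\phi$,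 under which $X\cdot\phi$ is sent to $e^{-f}X\,\tilde\cdot\,\tilde\phi$ for $X\in H(M)$; it preserves the $\Theta$-eigenbundles. *)

theory Defs
  imports "HOL-Analysis.Analysis" "HOL-Library.Function_Algebras"
begin

section \<open>Smooth manifolds, tangent vectors and vector fields\<close>

text \<open>Smoothness on open subsets of Euclidean space.\<close>

fun diff_k_on :: "nat \<Rightarrow> 'a::euclidean_space set \<Rightarrow> ('a \<Rightarrow> 'b::real_normed_vector) \<Rightarrow> bool" where
  "diff_k_on 0 S f = continuous_on S f"
| "diff_k_on (Suc k) S f =
     ((\<forall>x\<in>S. f differentiable (at x)) \<and>
      (\<forall>v. diff_k_on k S (\<lambda>x. frechet_derivative f (at x) v)))"

definition smooth_on :: "'a::euclidean_space set \<Rightarrow> ('a \<Rightarrow> 'b::real_normed_vector) \<Rightarrow> bool" where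
  "smooth_on S f \<longleftrightarrow> (\<forall>k. diff_k_on k S f)"

definition smooth_atlas :: "('p::topological_space set \<times> ('p \<Rightarrow> real^'n)) set \<Rightarrow> bool" where
  "smooth_atlas A \<longleftrightarrow>
     (\<Union>(U, x)\<in>A. U) = UNIV \<and>
     (\<forall>(U, x)\<in>A. open U \<and> open (x ` U) \<and> homeomorphism U (x ` U) x (inv_into U x)) \<and>
     (\<forall>(U, x)\<in>A. \<forall>(V, y)\<in>A. smooth_on (x ` (U \<inter> V)) (y \<circ> inv_into U x))"

definition orientable_atlas :: "('p::topological_space set \<times> ('p \<Rightarrow> real^'n)) set \<Rightarrow> bool" where
  "orientable_atlas A \<longleftrightarrow>
     (\<exists>B. smooth_atlas B \<and> smooth_atlas (A \<union> B) \<and>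
        (\<forall>(U, x)\<in>B. \<forall>(V, y)\<in>B. \<forall>z\<in>x ` (U \<inter> V).
           det (matrix (frechet_derivative (y \<circ> inv_into U x) (at z))) > 0))"

text \<open>
  A tangent vector at a point is a derivation on germs of real functions there; it is encoded as
  a functional on all functions which vanishes on those that are not smooth near the point.
  Locality follows from the Leibniz rule because a function that is locally constant near the
  point (an indicator function, say) counts as smooth there.
\<close>

type_synonym 'p tvec = "('p \<Rightarrow> real) \<Rightarrow> real"

record ('p, 'n) cr_struct =
  charts :: "('p set \<times> ('p \<Rightarrow> real^'n)) set"
  hdist :: "'p \<Rightarrow> 'p tvec set"  \<comment> \<open>the distribution \<open>H(M)\<close>\<close>
  cplx :: "'p \<Rightarrow> 'p tvec \<Rightarrow> 'p tvec"  \<comment> \<open>the endomorphism \<open>J\<close>, relevant on \<open>H(M)\<close> only\<close>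

definition smooth_fun ::
  "('p::topological_space, 'n::finite) cr_struct \<Rightarrow> 'p set \<Rightarrow> ('p \<Rightarrow> 'b::real_normed_vector) \<Rightarrow> bool" where
  "smooth_fun M U h \<longleftrightarrow>
     open U \<and> (\<forall>(V, x)\<in>charts M. smooth_on (x ` (U \<inter> V)) (h \<circ> inv_into V x))"

definition smooth_germ ::
  "('p::topological_space, 'n::finite) cr_struct \<Rightarrow> 'p \<Rightarrow> ('p \<Rightarrow> 'b::real_normed_vector) \<Rightarrow> bool" where
  "smooth_germ M x h \<longleftrightarrow> (\<exists>U. x \<in> U \<and> smooth_fun M U h)"

definition tscale :: "real \<Rightarrow> 'p tvec \<Rightarrow> 'p tvec" where
  "tscale c v = (\<lambda>h. c * v h)"

definition tangent :: "('p::topological_space, 'n::finite) cr_struct \<Rightarrow> 'p \<Rightarrow> 'p tvec set" where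
  "tangent M x = {v.
     (\<forall>g h. smooth_germ M x g \<and> smooth_germ M x h \<longrightarrow>
        v (\<lambda>y. g y + h y) = v g + v h \<and>
        v (\<lambda>y. g y * h y) = v g * h x + g x * v h) \<and>
     (\<forall>c h. smooth_germ M x h \<longrightarrow> v (\<lambda>y. c * h y) = c * v h) \<and>
     (\<forall>h. \<not> smooth_germ M x h \<longrightarrow> v h = 0)}"

text \<open>Derivatives of complex and of \<open>\<complex>\<^sup>N\<close>-valued functions along a tangent vector.\<close>

definition dir_deriv :: "'p tvec \<Rightarrow> ('p \<Rightarrow> complex) \<Rightarrow> complex" where
  "dir_deriv v h = Complex (v (\<lambda>y. Re (h y))) (v (\<lambda>y. Im (h y)))"

definition dir_deriv_vec :: "'p tvec \<Rightarrow> ('p \<Rightarrow> complex^'s) \<Rightarrow> complex^'s" where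
  "dir_deriv_vec v h = (\<chi> a. dir_deriv v (\<lambda>y. h y $ a))"

definition vec_field ::
  "('p::topological_space, 'n::finite) cr_struct \<Rightarrow> 'p set \<Rightarrow> ('p \<Rightarrow> 'p tvec) \<Rightarrow> bool" where
  "vec_field M U X \<longleftrightarrow>
     open U \<and> (\<forall>x\<in>U. X x \<in> tangent M x) \<and>
     (\<forall>V (h :: 'p \<Rightarrow> real). V \<subseteq> U \<and> smooth_fun M V h \<longrightarrow> smooth_fun M V (\<lambda>y. X y h))"

definition vec_germ ::
  "('p::topological_space, 'n::finite) cr_struct \<Rightarrow> 'p \<Rightarrow> ('p \<Rightarrow> 'p tvec) \<Rightarrow> bool" where
  "vec_germ M x X \<longleftrightarrow> (\<exists>U. x \<in> U \<and> vec_field M U X)"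

definition hor_germ ::
  "('p::topological_space, 'n::finite) cr_struct \<Rightarrow> 'p \<Rightarrow> ('p \<Rightarrow> 'p tvec) \<Rightarrow> bool" where
  "hor_germ M x X \<longleftrightarrow> (\<exists>U. x \<in> U \<and> vec_field M U X \<and> (\<forall>y\<in>U. X y \<in> hdist M y))"

definition lie ::
  "('p::topological_space, 'n::finite) cr_struct \<Rightarrow> ('p \<Rightarrow> 'p tvec) \<Rightarrow> ('p \<Rightarrow> 'p tvec) \<Rightarrow> 'p \<Rightarrow> 'p tvec" where
  "lie M X Y x = (\<lambda>h. if smooth_germ M x h
     then X x (\<lambda>y. Y y h) - Y x (\<lambda>y. X y h) else 0)"


section \<open>Strictly pseudoconvex CR manifolds\<close>

definition is_basis :: "nat \<Rightarrow> (nat \<Rightarrow> 'p tvec) \<Rightarrow> 'p tvec set \<Rightarrow> bool" where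
  "is_basis n b S \<longleftrightarrow>
     bij_betw (\<lambda>c. \<Sum>i<n. tscale (c i) (b i)) ({..<n} \<rightarrow>\<^sub>E (UNIV :: real set)) S"

definition corank_one :: "nat \<Rightarrow> ('p::topological_space, 'n::finite) cr_struct \<Rightarrow> bool" where
  "corank_one m M \<longleftrightarrow>
     (\<forall>x. \<exists>U b. x \<in> U \<and> (\<forall>i\<le>2*m. vec_field M U (\<lambda>y. b y i)) \<and>
        (\<forall>y\<in>U. is_basis (2*m) (b y) (hdist M y) \<and> is_basis (2*m + 1) (b y) (tangent M y)))"

definition apply_J ::
  "('p, 'n::finite) cr_struct \<Rightarrow> ('p \<Rightarrow> 'p tvec) \<Rightarrow> 'p \<Rightarrow> 'p tvec" where
  "apply_J M X = (\<lambda>y. cplx M y (X y))"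

definition almost_complex :: "('p::topological_space, 'n::finite) cr_struct \<Rightarrow> bool" where
  "almost_complex M \<longleftrightarrow>
     (\<forall>x. \<forall>v\<in>hdist M x.
        cplx M x v \<in> hdist M x \<and> cplx M x (cplx M x v) = - v \<and>
        (\<forall>c. cplx M x (tscale c v) = tscale c (cplx M x v)) \<and>
        (\<forall>w\<in>hdist M x. cplx M x (v + w) = cplx M x v + cplx M x w)) \<and>
     (\<forall>x X. hor_germ M x X \<longrightarrow> hor_germ M x (apply_J M X))"

text \<open>
  The three conditions are those for the bracket \<open>{X,Y} = -[X,Y] mod H(M)\<close>: compatibility with
  \<open>J\<close>, nondegeneracy, and vanishing of the Nijenhuis tensor.
\<close>

definition strictly_pseudoconvex :: "('p::topological_space, 'n::finite) cr_struct \<Rightarrow> bool" where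
  "strictly_pseudoconvex M \<longleftrightarrow>
     (\<forall>x X Y. hor_germ M x X \<and> hor_germ M x Y \<longrightarrow>
        - lie M (apply_J M X) Y x - lie M X (apply_J M Y) x \<in> hdist M x \<and>
        lie M X Y x - lie M (apply_J M X) (apply_J M Y) x
          + cplx M x (lie M (apply_J M X) Y x + lie M X (apply_J M Y) x) = 0) \<and>
     (\<forall>x X. hor_germ M x X \<and> X x \<noteq> 0 \<longrightarrow> - lie M X (apply_J M X) x \<notin> hdist M x)"

definition cr_manifold ::
  "nat \<Rightarrow> ('p::{t2_space, second_countable_topology}, 'n::finite) cr_struct \<Rightarrow> bool" where
  "cr_manifold m M \<longleftrightarrow>
     CARD('n) = 2*m + 1 \<and> connected (UNIV :: 'p set) \<and>
     smooth_atlas (charts M) \<and> orientable_atlas (charts M) \<and>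
     corank_one m M \<and> almost_complex M \<and> strictly_pseudoconvex M"


section \<open>Pseudo-Hermitian structures and the Webster--Tanaka connection\<close>

definition one_form ::
  "('p::topological_space, 'n::finite) cr_struct \<Rightarrow> ('p \<Rightarrow> 'p tvec \<Rightarrow> real) \<Rightarrow> bool" where
  "one_form M \<theta> \<longleftrightarrow>
     (\<forall>x. \<forall>v\<in>tangent M x.
        (\<forall>w\<in>tangent M x. \<theta> x (v + w) = \<theta> x v + \<theta> x w) \<and> (\<forall>c. \<theta> x (tscale c v) = c * \<theta> x v)) \<and>
     (\<forall>U X. vec_field M U X \<longrightarrow> smooth_fun M U (\<lambda>y. \<theta> y (X y)))"

text \<open>Tensors are evaluated at tangent vectors through an arbitrary extension to local fields.\<close>

definition extension ::
  "('p::topological_space, 'n::finite) cr_struct \<Rightarrow> 'p \<Rightarrow> 'p tvec \<Rightarrow> 'p \<Rightarrow> 'p tvec" where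
  "extension M x v = (SOME X. vec_germ M x X \<and> X x = v)"

text \<open>\<open>d\<theta>(X,Y) = X \<theta>(Y) - Y \<theta>(X) - \<theta>([X,Y])\<close>, without a factor \<open>1/2\<close>, as the torsion requires.\<close>

definition ext_deriv ::
  "('p::topological_space, 'n::finite) cr_struct \<Rightarrow> ('p \<Rightarrow> 'p tvec \<Rightarrow> real) \<Rightarrow>
   'p \<Rightarrow> 'p tvec \<Rightarrow> 'p tvec \<Rightarrow> real" where
  "ext_deriv M \<theta> x v w =
     (let X = extension M x v; Y = extension M x w
      in v (\<lambda>y. \<theta> y (Y y)) - w (\<lambda>y. \<theta> y (X y)) - \<theta> x (lie M X Y x))"

definition metric ::
  "('p::topological_space, 'n::finite) cr_struct \<Rightarrow> ('p \<Rightarrow> 'p tvec \<Rightarrow> real) \<Rightarrow>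
   'p \<Rightarrow> 'p tvec \<Rightarrow> 'p tvec \<Rightarrow> real" where
  "metric M \<theta> x v w = 1/2 * ext_deriv M \<theta> x v (cplx M x w)"

definition pseudo_hermitian ::
  "('p::topological_space, 'n::finite) cr_struct \<Rightarrow> ('p \<Rightarrow> 'p tvec \<Rightarrow> real) \<Rightarrow> bool" where
  "pseudo_hermitian M \<theta> \<longleftrightarrow>
     one_form M \<theta> \<and>
     (\<forall>x. \<forall>v\<in>tangent M x. \<theta> x v = 0 \<longleftrightarrow> v \<in> hdist M x) \<and>
     (\<forall>x. \<forall>v\<in>hdist M x. v \<noteq> 0 \<longrightarrow> metric M \<theta> x v v > 0)"

definition reeb ::
  "('p::topological_space, 'n::finite) cr_struct \<Rightarrow> ('p \<Rightarrow> 'p tvec \<Rightarrow> real) \<Rightarrow> 'p \<Rightarrow> 'p tvec" where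
  "reeb M \<theta> x =
     (THE v. v \<in> tangent M x \<and> \<theta> x v = 1 \<and> (\<forall>w\<in>tangent M x. ext_deriv M \<theta> x v w = 0))"

text \<open>\<open>nab x v Y\<close> is the derivative at \<open>x\<close> of the local field \<open>Y\<close> in the direction \<open>v\<close>.\<close>

definition connection ::
  "('p::topological_space, 'n::finite) cr_struct \<Rightarrow>
   ('p \<Rightarrow> 'p tvec \<Rightarrow> ('p \<Rightarrow> 'p tvec) \<Rightarrow> 'p tvec) \<Rightarrow> bool" where
  "connection M nab \<longleftrightarrow>
     (\<forall>x. \<forall>v\<in>tangent M x. \<forall>Y. vec_germ M x Y \<longrightarrow>
        nab x v Y \<in> tangent M x \<and>
        (\<forall>w\<in>tangent M x. nab x (v + w) Y = nab x v Y + nab x w Y) \<and>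
        (\<forall>c. nab x (tscale c v) Y = tscale c (nab x v Y)) \<and>
        (\<forall>Z. vec_germ M x Z \<longrightarrow> nab x v (\<lambda>y. Y y + Z y) = nab x v Y + nab x v Z) \<and>
        (\<forall>h. smooth_germ M x h \<longrightarrow>
           nab x v (\<lambda>y. tscale (h y) (Y y)) = tscale (v h) (Y x) + tscale (h x) (nab x v Y))) \<and>
     (\<forall>U X Y. vec_field M U X \<and> vec_field M U Y \<longrightarrow> vec_field M U (\<lambda>x. nab x (X x) Y))"

text \<open>
  Parallelism of \<open>J\<close> and of the metric, both of which live on \<open>H(M)\<close>, includes that the connection
  preserves \<open>H(M)\<close>.
\<close>

definition webster_tanaka ::
  "('p::topological_space, 'n::finite) cr_struct \<Rightarrow> ('p \<Rightarrow> 'p tvec \<Rightarrow> real) \<Rightarrow>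
   ('p \<Rightarrow> 'p tvec \<Rightarrow> ('p \<Rightarrow> 'p tvec) \<Rightarrow> 'p tvec) \<Rightarrow> bool" where
  "webster_tanaka M \<theta> nab \<longleftrightarrow>
     connection M nab \<and>
     (\<forall>x. \<forall>v\<in>tangent M x.
        nab x v (reeb M \<theta>) = 0 \<and>
        (\<forall>Y. hor_germ M x Y \<longrightarrow>
           nab x v Y \<in> hdist M x \<and>
           nab x v (apply_J M Y) = cplx M x (nab x v Y) \<and>
           (\<forall>Z. hor_germ M x Z \<longrightarrow>
              v (\<lambda>y. metric M \<theta> y (Y y) (Z y)) =
                metric M \<theta> x (nab x v Y) (Z x) + metric M \<theta> x (Y x) (nab x v Z)))) \<and>
     (\<forall>x X Y. hor_germ M x X \<and> hor_germ M x Y \<longrightarrow>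
        nab x (X x) Y - nab x (Y x) X - lie M X Y x =
          tscale (ext_deriv M \<theta> x (X x) (Y x)) (reeb M \<theta> x)) \<and>
     (\<forall>x X. hor_germ M x X \<longrightarrow>
        nab x (reeb M \<theta> x) X - nab x (X x) (reeb M \<theta>) - lie M (reeb M \<theta>) X x =
          tscale (-1/2) (lie M (reeb M \<theta>) X x + cplx M x (lie M (reeb M \<theta>) (apply_J M X) x)))"

definition orthonormal ::
  "nat \<Rightarrow> ('p::topological_space, 'n::finite) cr_struct \<Rightarrow> ('p \<Rightarrow> 'p tvec \<Rightarrow> real) \<Rightarrow>
   'p \<Rightarrow> (nat \<Rightarrow> 'p tvec) \<Rightarrow> bool" where
  "orthonormal k M \<theta> x b \<longleftrightarrow>
     (\<forall>i<k. b i \<in> hdist M x) \<and>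
     (\<forall>i<k. \<forall>j<k. metric M \<theta> x (b i) (b j) = (if i = j then 1 else 0))"

text \<open>\<open>e\<close> is a unitary frame if \<open>e\<^sub>1, J e\<^sub>1, \<dots>, e\<^sub>m, J e\<^sub>m\<close> is an orthonormal frame of \<open>H(M)\<close>.\<close>

definition unitary_frame ::
  "nat \<Rightarrow> ('p::topological_space, 'n::finite) cr_struct \<Rightarrow> ('p \<Rightarrow> 'p tvec \<Rightarrow> real) \<Rightarrow>
   'p \<Rightarrow> (nat \<Rightarrow> 'p tvec) \<Rightarrow> bool" where
  "unitary_frame m M \<theta> x e \<longleftrightarrow>
     orthonormal (2*m) M \<theta> x (\<lambda>i. if even i then e (i div 2) else cplx M x (e (i div 2)))"

text \<open>
  Frames in \<open>SO(H(M))\<close>: \<open>H(M)\<close> is oriented by \<open>J\<close>, equivalently by \<open>(d\<theta>)\<^sup>m\<close>, and the sum below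
  is a positive multiple of \<open>(d\<theta>)\<^sup>m(b\<^sub>1, \<dots>, b\<^sub>2\<^sub>m)\<close>.
\<close>

definition so_frame ::
  "nat \<Rightarrow> ('p::topological_space, 'n::finite) cr_struct \<Rightarrow> ('p \<Rightarrow> 'p tvec \<Rightarrow> real) \<Rightarrow>
   'p \<Rightarrow> (nat \<Rightarrow> 'p tvec) \<Rightarrow> bool" where
  "so_frame m M \<theta> x b \<longleftrightarrow>
     orthonormal (2*m) M \<theta> x b \<and>
     (\<Sum>\<pi> | \<pi> permutes {..<2*m}. of_int (sign \<pi>) *
        (\<Prod>k<m. ext_deriv M \<theta> x (b (\<pi> (2*k))) (b (\<pi> (2*k + 1))))) > 0"


section \<open>Fibre bundles with structure group\<close>

text \<open>
  A bundle is given by its projection and an atlas of local trivialisations \<open>(U, \<tau>)\<close>, where \<open>\<tau>\<close> is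
  the fibre component; transition functions are smooth maps into the structure group \<open>G\<close>.
\<close>

record ('x, 'p, 'f) fbundle =
  proj :: "'x \<Rightarrow> 'p"
  triv :: "('p set \<times> ('x \<Rightarrow> 'f)) set"

definition fibre_bundle ::
  "('p::topological_space, 'n::finite) cr_struct \<Rightarrow> ('x, 'p, 'f) fbundle \<Rightarrow> 'f set \<Rightarrow>
   'g::real_normed_vector set \<Rightarrow> ('g \<Rightarrow> 'f \<Rightarrow> 'f) \<Rightarrow> bool" where
  "fibre_bundle M B F G act \<longleftrightarrow>
     (\<Union>(U, \<tau>)\<in>triv B. U) = UNIV \<and>
     (\<forall>(U, \<tau>)\<in>triv B. open U \<and> (\<forall>x\<in>U. bij_betw \<tau> {\<xi>. proj B \<xi> = x} F)) \<and>
     (\<forall>(U, \<tau>)\<in>triv B. \<forall>(V, \<sigma>)\<in>triv B. \<exists>g.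
        smooth_fun M (U \<inter> V) g \<and> g ` (U \<inter> V) \<subseteq> G \<and>
        (\<forall>\<xi>. proj B \<xi> \<in> U \<inter> V \<longrightarrow> \<sigma> \<xi> = act (g (proj B \<xi>)) (\<tau> \<xi>)))"

text \<open>
  The fibrewise map which is \<open>h\<close> in every trivialisation; meaningful if \<open>h\<close> commutes with the
  action of the structure group. It gives the scalar multiplication of a line bundle and the right
  action on a principal bundle.
\<close>

definition fibre_map :: "('x, 'p, 'f) fbundle \<Rightarrow> ('f \<Rightarrow> 'f) \<Rightarrow> 'x \<Rightarrow> 'x" where
  "fibre_map B h \<xi> = (THE \<xi>'. proj B \<xi>' = proj B \<xi> \<and>
     (\<forall>(U, \<tau>)\<in>triv B. proj B \<xi> \<in> U \<longrightarrow> \<tau> \<xi>' = h (\<tau> \<xi>)))"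

definition local_section ::
  "('p::topological_space, 'n::finite) cr_struct \<Rightarrow> ('x, 'p, 'f::real_normed_vector) fbundle \<Rightarrow>
   'p \<Rightarrow> ('p \<Rightarrow> 'x) \<Rightarrow> bool" where
  "local_section M B x s \<longleftrightarrow>
     (\<exists>U. open U \<and> x \<in> U \<and> (\<forall>y\<in>U. proj B (s y) = y) \<and>
        (\<forall>(V, \<tau>)\<in>triv B. smooth_fun M (U \<inter> V) (\<tau> \<circ> s)))"

definition line_bundle ::
  "('p::topological_space, 'n::finite) cr_struct \<Rightarrow> ('e, 'p, complex) fbundle \<Rightarrow> bool" where
  "line_bundle M E \<longleftrightarrow> fibre_bundle M E UNIV (UNIV - {0}) (*)"

definition scale :: "('e, 'p, complex) fbundle \<Rightarrow> complex \<Rightarrow> 'e \<Rightarrow> 'e" where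
  "scale E c = fibre_map E (\<lambda>z. c * z)"

definition nonzero :: "('e, 'p, complex) fbundle \<Rightarrow> 'e \<Rightarrow> bool" where
  "nonzero E \<xi> \<longleftrightarrow> (\<forall>(U, \<tau>)\<in>triv E. proj E \<xi> \<in> U \<longrightarrow> \<tau> \<xi> \<noteq> 0)"

text \<open>
  The fibre at \<open>x\<close> of the power \<open>E\<^sup>p\<close>, for any integer \<open>p\<close>: elements are homogeneous functions of
  degree \<open>-p\<close> on the nonzero vectors of \<open>E\<^sub>x\<close>, where \<open>u\<close> stands for \<open>u(\<xi>) \<xi>\<^sup>p\<close>.
\<close>

definition power_fibre :: "('e, 'p, complex) fbundle \<Rightarrow> int \<Rightarrow> 'p \<Rightarrow> ('e \<Rightarrow> complex) set" where
  "power_fibre E p x = {u.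
     (\<forall>\<xi>. proj E \<xi> = x \<and> nonzero E \<xi> \<longrightarrow> (\<forall>c. c \<noteq> 0 \<longrightarrow> u (scale E c \<xi>) = c powi (-p) * u \<xi>)) \<and>
     (\<forall>\<xi>. \<not> (proj E \<xi> = x \<and> nonzero E \<xi>) \<longrightarrow> u \<xi> = 0)}"


section \<open>The canonical bundle and its roots\<close>

text \<open>
  The fibre at \<open>x\<close> of \<open>\<Lambda>\<^sup>m\<^sup>+\<^sup>1\<^sup>,\<^sup>0(M)\<close>. Forms take the arguments \<open>Y 0, \<dots>, Y m\<close> and are real multilinear
  with complex values; vectors in \<open>T\<^sub>0\<^sub>1\<close> are those of the form \<open>v + i J v\<close> with \<open>v\<close> in \<open>H(M)\<close>,
  so the last condition says that they are annihilated.
\<close>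

definition canonical_fibre ::
  "nat \<Rightarrow> ('p::topological_space, 'n::finite) cr_struct \<Rightarrow> 'p \<Rightarrow> ((nat \<Rightarrow> 'p tvec) \<Rightarrow> complex) set" where
  "canonical_fibre m M x = {\<eta>.
     (\<forall>Y Z. (\<forall>i\<le>m. Y i = Z i) \<longrightarrow> \<eta> Y = \<eta> Z) \<and>
     (\<forall>Y. (\<exists>i\<le>m. Y i \<notin> tangent M x) \<longrightarrow> \<eta> Y = 0) \<and>
     (\<forall>Y. (\<forall>i\<le>m. Y i \<in> tangent M x) \<longrightarrow>
        (\<forall>i\<le>m. \<forall>v\<in>tangent M x.
           (\<forall>w\<in>tangent M x. \<eta> (Y(i := v + w)) = \<eta> (Y(i := v)) + \<eta> (Y(i := w))) \<and>
           (\<forall>c. \<eta> (Y(i := tscale c v)) = of_real c * \<eta> (Y(i := v)))) \<and>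
        (\<forall>i\<le>m. \<forall>j\<le>m. i \<noteq> j \<and> Y i = Y j \<longrightarrow> \<eta> Y = 0) \<and>
        (\<forall>v\<in>hdist M x. \<eta> (Y(0 := v)) + \<i> * \<eta> (Y(0 := cplx M x v)) = 0))}"

text \<open>
  \<open>E(1)\<^sup>m\<^sup>+\<^sup>2\<close> is the dual of the canonical bundle: the isomorphism is given by the map
  \<open>\<xi> \<mapsto> \<kappa>(\<xi>) = \<xi>\<^sup>-\<^sup>(\<^sup>m\<^sup>+\<^sup>2\<^sup>)\<close> from nonzero vectors of \<open>E(1)\<close> to the canonical bundle.
\<close>

definition canonical_root ::
  "nat \<Rightarrow> ('p::topological_space, 'n::finite) cr_struct \<Rightarrow> ('e, 'p, complex) fbundle \<Rightarrow>
   ('e \<Rightarrow> (nat \<Rightarrow> 'p tvec) \<Rightarrow> complex) \<Rightarrow> bool" where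
  "canonical_root m M E \<kappa> \<longleftrightarrow>
     (\<forall>\<xi>. nonzero E \<xi> \<longrightarrow>
        \<kappa> \<xi> \<in> canonical_fibre m M (proj E \<xi>) \<and> \<kappa> \<xi> \<noteq> 0 \<and>
        (\<forall>c. c \<noteq> 0 \<longrightarrow> \<kappa> (scale E c \<xi>) = (\<lambda>Y. \<kappa> \<xi> Y / c ^ (m + 2)))) \<and>
     (\<forall>x e Y. local_section M E x e \<and> nonzero E (e x) \<and> (\<forall>i\<le>m. vec_germ M x (Y i)) \<longrightarrow>
        smooth_germ M x (\<lambda>y. \<kappa> (e y) (\<lambda>i. Y i y)))"

text \<open>
  The Hermitian norms induced by \<open>\<theta>\<close>. On the canonical bundle \<open>|\<eta>| = |\<eta>(T, Z\<^sub>1, \<dots>, Z\<^sub>m)|\<close> with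
  \<open>Z\<^sub>\<alpha> = (e\<^sub>\<alpha> - i J e\<^sub>\<alpha>)/2\<close>, which is \<open>|\<eta>(T, e\<^sub>1, \<dots>, e\<^sub>m)|\<close> because \<open>\<eta>\<close> is of type \<open>(m+1,0)\<close>.
\<close>

definition canonical_norm ::
  "nat \<Rightarrow> ('p::topological_space, 'n::finite) cr_struct \<Rightarrow> ('p \<Rightarrow> 'p tvec \<Rightarrow> real) \<Rightarrow>
   'p \<Rightarrow> ((nat \<Rightarrow> 'p tvec) \<Rightarrow> complex) \<Rightarrow> real" where
  "canonical_norm m M \<theta> x \<eta> =
     (THE r. \<exists>e. unitary_frame m M \<theta> x e \<and> r = cmod (\<eta> (case_nat (reeb M \<theta> x) e)))"

definition root_norm ::
  "nat \<Rightarrow> ('p::topological_space, 'n::finite) cr_struct \<Rightarrow> ('p \<Rightarrow> 'p tvec \<Rightarrow> real) \<Rightarrow>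
   ('e, 'p, complex) fbundle \<Rightarrow> ('e \<Rightarrow> (nat \<Rightarrow> 'p tvec) \<Rightarrow> complex) \<Rightarrow> 'e \<Rightarrow> real" where
  "root_norm m M \<theta> E \<kappa> \<xi> = canonical_norm m M \<theta> (proj E \<xi>) (\<kappa> \<xi>) powr (- 1 / (real m + 2))"

definition unit_power ::
  "nat \<Rightarrow> ('p::topological_space, 'n::finite) cr_struct \<Rightarrow> ('p \<Rightarrow> 'p tvec \<Rightarrow> real) \<Rightarrow>
   ('e, 'p, complex) fbundle \<Rightarrow> ('e \<Rightarrow> (nat \<Rightarrow> 'p tvec) \<Rightarrow> complex) \<Rightarrow> int \<Rightarrow>
   'p \<Rightarrow> ('e \<Rightarrow> complex) \<Rightarrow> bool" where
  "unit_power m M \<theta> E \<kappa> p x u \<longleftrightarrow>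
     u \<in> power_fibre E p x \<and>
     (\<forall>\<xi>. proj E \<xi> = x \<and> nonzero E \<xi> \<longrightarrow> cmod (u \<xi>) * root_norm m M \<theta> E \<kappa> \<xi> powi p = 1)"

text \<open>
  Connection forms, with respect to nonvanishing local sections, of the induced connections:
  \<open>canonical_form\<close> is the \<open>\<omega>\<close> with \<open>\<nabla>\<eta> = \<omega> \<eta>\<close>; for a section \<open>e\<close> of \<open>E(1)\<close> the relation
  \<open>\<kappa>(e) = e\<^sup>-\<^sup>(\<^sup>m\<^sup>+\<^sup>2\<^sup>)\<close> determines \<open>root_form\<close>; and a section of \<open>E(p)\<close> is \<open>u(e) e\<^sup>p\<close>, whence
  \<open>power_form\<close>, which does not depend on the choice of \<open>e\<close>.
\<close>

definition canonical_deriv ::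
  "nat \<Rightarrow> ('p::topological_space, 'n::finite) cr_struct \<Rightarrow>
   ('p \<Rightarrow> 'p tvec \<Rightarrow> ('p \<Rightarrow> 'p tvec) \<Rightarrow> 'p tvec) \<Rightarrow>
   'p \<Rightarrow> 'p tvec \<Rightarrow> ('p \<Rightarrow> (nat \<Rightarrow> 'p tvec) \<Rightarrow> complex) \<Rightarrow> (nat \<Rightarrow> 'p tvec) \<Rightarrow> complex" where
  "canonical_deriv m M nab x v \<eta> Y =
     dir_deriv v (\<lambda>y. \<eta> y (\<lambda>i. extension M x (Y i) y)) -
     (\<Sum>i\<le>m. \<eta> x (Y(i := nab x v (extension M x (Y i)))))"

definition canonical_form ::
  "nat \<Rightarrow> ('p::topological_space, 'n::finite) cr_struct \<Rightarrow>
   ('p \<Rightarrow> 'p tvec \<Rightarrow> ('p \<Rightarrow> 'p tvec) \<Rightarrow> 'p tvec) \<Rightarrow>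
   'p \<Rightarrow> 'p tvec \<Rightarrow> ('p \<Rightarrow> (nat \<Rightarrow> 'p tvec) \<Rightarrow> complex) \<Rightarrow> complex" where
  "canonical_form m M nab x v \<eta> =
     (THE c. \<forall>Y. (\<forall>i\<le>m. Y i \<in> tangent M x) \<longrightarrow> canonical_deriv m M nab x v \<eta> Y = c * \<eta> x Y)"

definition root_form ::
  "nat \<Rightarrow> ('p::topological_space, 'n::finite) cr_struct \<Rightarrow>
   ('p \<Rightarrow> 'p tvec \<Rightarrow> ('p \<Rightarrow> 'p tvec) \<Rightarrow> 'p tvec) \<Rightarrow>
   ('e \<Rightarrow> (nat \<Rightarrow> 'p tvec) \<Rightarrow> complex) \<Rightarrow> 'p \<Rightarrow> 'p tvec \<Rightarrow> ('p \<Rightarrow> 'e) \<Rightarrow> complex" where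
  "root_form m M nab \<kappa> x v e =
     - canonical_form m M nab x v (\<lambda>y. \<kappa> (e y)) / (of_nat m + 2)"

definition power_form ::
  "nat \<Rightarrow> ('p::topological_space, 'n::finite) cr_struct \<Rightarrow>
   ('p \<Rightarrow> 'p tvec \<Rightarrow> ('p \<Rightarrow> 'p tvec) \<Rightarrow> 'p tvec) \<Rightarrow> ('e, 'p, complex) fbundle \<Rightarrow>
   ('e \<Rightarrow> (nat \<Rightarrow> 'p tvec) \<Rightarrow> complex) \<Rightarrow> int \<Rightarrow> 'p \<Rightarrow> 'p tvec \<Rightarrow> ('p \<Rightarrow> 'e \<Rightarrow> complex) \<Rightarrow> complex" where
  "power_form m M nab E \<kappa> p x v u =
     (let e = (SOME e. local_section M E x e \<and> nonzero E (e x))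
      in dir_deriv v (\<lambda>y. u y (e y)) / u x (e x) + of_int p * root_form m M nab \<kappa> x v e)"


section \<open>The groups Spin and Spin$^c$\<close>

text \<open>
  The spinor module is \<open>\<complex>\<^sup>N\<close> with \<open>N = 2\<^sup>m\<close>; the complex Clifford algebra of \<open>\<real>\<^sup>2\<^sup>m\<close> is then the full
  algebra of complex \<open>N \<times> N\<close> matrices, generated by the images \<open>\<gamma> i\<close> of the standard basis.
  Clifford multiplication is skew-Hermitian, so that the groups below are unitary.
\<close>

definition clifford_module :: "nat \<Rightarrow> (nat \<Rightarrow> complex^'s^'s) \<Rightarrow> bool" where
  "clifford_module m \<gamma> \<longleftrightarrow>
     CARD('s) = 2 ^ m \<and>
     (\<forall>i<2*m. \<forall>j<2*m. \<gamma> i ** \<gamma> j + \<gamma> j ** \<gamma> i = (if i = j then mat (-2) else 0)) \<and>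
     (\<forall>i<2*m. \<forall>a b. \<gamma> i $ a $ b = - cnj (\<gamma> i $ b $ a))"

definition clifford :: "nat \<Rightarrow> (nat \<Rightarrow> complex^'s^'s) \<Rightarrow> (nat \<Rightarrow> real) \<Rightarrow> complex^'s^'s" where
  "clifford m \<gamma> v = (\<Sum>i<2*m. v i *\<^sub>R \<gamma> i)"

inductive_set spin_group :: "nat \<Rightarrow> (nat \<Rightarrow> complex^'s^'s) \<Rightarrow> (complex^'s^'s) set"
  for m :: nat and \<gamma> :: "nat \<Rightarrow> complex^'s^'s" where
  one: "mat 1 \<in> spin_group m \<gamma>"
| mult: "\<lbrakk>(\<Sum>i<2*m. (v i)\<^sup>2) = 1; (\<Sum>i<2*m. (w i)\<^sup>2) = 1; g \<in> spin_group m \<gamma>\<rbrakk>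
     \<Longrightarrow> clifford m \<gamma> v ** clifford m \<gamma> w ** g \<in> spin_group m \<gamma>"

definition spinc_group :: "nat \<Rightarrow> (nat \<Rightarrow> complex^'s^'s) \<Rightarrow> (complex^'s^'s) set" where
  "spinc_group m \<gamma> = {mat c ** h | c h. cmod c = 1 \<and> h \<in> spin_group m \<gamma>}"

text \<open>The character \<open>[h, c] \<mapsto> c\<^sup>2\<close> of \<open>Spin \<times>\<^bsub>\<plusminus>1\<^esub> U(1)\<close> that defines the determinant bundle.\<close>

definition spinc_det :: "nat \<Rightarrow> (nat \<Rightarrow> complex^'s^'s) \<Rightarrow> complex^'s^'s \<Rightarrow> complex" where
  "spinc_det m \<gamma> g =
     (THE d. \<exists>c h. cmod c = 1 \<and> h \<in> spin_group m \<gamma> \<and> g = mat c ** h \<and> d = c\<^sup>2)"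

text \<open>\<open>a\<close> is the matrix of the rotation \<open>v \<mapsto> g v g\<^sup>-\<^sup>1\<close> covered by \<open>g\<close>.\<close>

definition covers ::
  "nat \<Rightarrow> (nat \<Rightarrow> complex^'s^'s) \<Rightarrow> complex^'s^'s \<Rightarrow> (nat \<Rightarrow> nat \<Rightarrow> real) \<Rightarrow> bool" where
  "covers m \<gamma> g a \<longleftrightarrow> (\<forall>j<2*m. g ** \<gamma> j = (\<Sum>i<2*m. a i j *\<^sub>R \<gamma> i) ** g)"

text \<open>
  The Lie algebra of \<open>Spin\<^sup>c\<close> is the sum of that of \<open>Spin\<close>, spanned by the \<open>\<gamma> i ** \<gamma> j\<close>, and of the
  scalars \<open>i\<real>\<close>. The differential of the covering onto \<open>SO \<times> U(1)\<close>, rotation and \<open>spinc_det\<close>,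
  maps \<open>S + c\<close> to \<open>([S, _], 2 c)\<close>; this is its inverse. Column \<open>j\<close> of \<open>\<omega>\<close> is the image of basis
  vector \<open>j\<close>.
\<close>

definition spinc_lift ::
  "nat \<Rightarrow> (nat \<Rightarrow> complex^'s^'s) \<Rightarrow> (nat \<Rightarrow> nat \<Rightarrow> real) \<Rightarrow> complex \<Rightarrow> complex^'s^'s" where
  "spinc_lift m \<gamma> \<omega> a =
     (THE Z. \<exists>S \<in> span {\<gamma> i ** \<gamma> j | i j. i < 2*m \<and> j < 2*m \<and> i \<noteq> j}.
        Z = S + mat (a / 2) \<and>
        (\<forall>j<2*m. S ** \<gamma> j - \<gamma> j ** S = (\<Sum>k<2*m. \<omega> k j *\<^sub>R \<gamma> k)))"


section \<open>Spin$^c$ structures, spinors and the Kohn--Dirac operator\<close>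

definition right_act :: "('q, 'p, complex^'s^'s) fbundle \<Rightarrow> 'q \<Rightarrow> complex^'s^'s \<Rightarrow> 'q" where
  "right_act P q g = fibre_map P (\<lambda>a. a ** g) q"

text \<open>
  A spin\<open>\<^sup>c\<close> structure of weight \<open>wt\<close>: a principal \<open>Spin\<^sup>c\<close>-bundle \<open>P\<close>, the reduction map \<open>fr\<close> to
  \<open>SO(H(M))\<close>, and the identification of the determinant bundle with \<open>E(wt)\<close>, given as the equivariant
  map \<open>dt\<close> from \<open>P\<close> to the \<open>U(1)\<close>-frame bundle (the unit vectors) of \<open>E(wt)\<close>.
\<close>

definition spinc_structure ::
  "nat \<Rightarrow> ('p::topological_space, 'n::finite) cr_struct \<Rightarrow> ('p \<Rightarrow> 'p tvec \<Rightarrow> real) \<Rightarrow>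
   ('e, 'p, complex) fbundle \<Rightarrow> ('e \<Rightarrow> (nat \<Rightarrow> 'p tvec) \<Rightarrow> complex) \<Rightarrow> int \<Rightarrow>
   (nat \<Rightarrow> complex^'s^'s) \<Rightarrow> ('q, 'p, complex^'s^'s) fbundle \<Rightarrow>
   ('q \<Rightarrow> nat \<Rightarrow> 'p tvec) \<Rightarrow> ('q \<Rightarrow> 'e \<Rightarrow> complex) \<Rightarrow> bool" where
  "spinc_structure m M \<theta> E \<kappa> wt \<gamma> P fr dt \<longleftrightarrow>
     fibre_bundle M P (spinc_group m \<gamma>) (spinc_group m \<gamma>) (**) \<and>
     (\<forall>q. so_frame m M \<theta> (proj P q) (fr q)) \<and>
     (\<forall>q. \<forall>g\<in>spinc_group m \<gamma>. \<forall>a. covers m \<gamma> g a \<longrightarrow>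
        (\<forall>j<2*m. fr (right_act P q g) j = (\<Sum>i<2*m. tscale (a i j) (fr q i)))) \<and>
     (\<forall>x s. local_section M P x s \<longrightarrow> (\<forall>j<2*m. vec_germ M x (\<lambda>y. fr (s y) j))) \<and>
     (\<forall>q. unit_power m M \<theta> E \<kappa> wt (proj P q) (dt q)) \<and>
     (\<forall>q. \<forall>g\<in>spinc_group m \<gamma>. \<forall>\<xi>. dt (right_act P q g) \<xi> = spinc_det m \<gamma> g * dt q \<xi>) \<and>
     (\<forall>x s e. local_section M P x s \<and> local_section M E x e \<and> nonzero E (e x) \<longrightarrow>
        smooth_germ M x (\<lambda>y. dt (s y) (e y)))"

text \<open>
  Smooth sections of the associated spinor bundle, as equivariant functions on \<open>P\<close>: the value at
  \<open>proj P q\<close> is the class \<open>[q, \<phi> q]\<close>.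
\<close>

definition spinor_field ::
  "nat \<Rightarrow> ('p::topological_space, 'n::finite) cr_struct \<Rightarrow> (nat \<Rightarrow> complex^'s^'s) \<Rightarrow>
   ('q, 'p, complex^'s^'s) fbundle \<Rightarrow> ('q \<Rightarrow> complex^'s) \<Rightarrow> bool" where
  "spinor_field m M \<gamma> P \<phi> \<longleftrightarrow>
     (\<forall>q. \<forall>g\<in>spinc_group m \<gamma>. g *v \<phi> (right_act P q g) = \<phi> q) \<and>
     (\<forall>x s. local_section M P x s \<longrightarrow> smooth_germ M x (\<lambda>y. \<phi> (s y)))"

text \<open>Clifford multiplication by a vector of \<open>H(M)\<close> on representatives \<open>[q, \<psi>]\<close>.\<close>

definition clifford_mult ::
  "nat \<Rightarrow> ('p::topological_space, 'n::finite) cr_struct \<Rightarrow> ('p \<Rightarrow> 'p tvec \<Rightarrow> real) \<Rightarrow>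
   (nat \<Rightarrow> complex^'s^'s) \<Rightarrow> ('q, 'p, complex^'s^'s) fbundle \<Rightarrow> ('q \<Rightarrow> nat \<Rightarrow> 'p tvec) \<Rightarrow>
   'q \<Rightarrow> 'p tvec \<Rightarrow> complex^'s^'s" where
  "clifford_mult m M \<theta> \<gamma> P fr q X = clifford m \<gamma> (\<lambda>i. metric M \<theta> (proj P q) X (fr q i))"

text \<open>
  \<open>\<Theta> = (i/2) d\<theta>\<close>, where a 2-form \<open>\<beta>\<close> acts as \<open>\<Sum>\<^sub>j\<^sub><\<^sub>k \<beta>(s\<^sub>j, s\<^sub>k) s\<^sub>j \<cdot> s\<^sub>k\<close> for an orthonormal frame
  \<open>s\<close>; for the frame \<open>e\<^sub>\<alpha>, J e\<^sub>\<alpha>\<close> this is \<open>i \<Sum>\<^sub>\<alpha> e\<^sub>\<alpha> \<cdot> J e\<^sub>\<alpha>\<close> because \<open>d\<theta>(e\<^sub>\<alpha>, J e\<^sub>\<alpha>) = 2\<close>.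
\<close>

definition Theta ::
  "nat \<Rightarrow> ('p::topological_space, 'n::finite) cr_struct \<Rightarrow> ('p \<Rightarrow> 'p tvec \<Rightarrow> real) \<Rightarrow>
   (nat \<Rightarrow> complex^'s^'s) \<Rightarrow> ('q, 'p, complex^'s^'s) fbundle \<Rightarrow> ('q \<Rightarrow> nat \<Rightarrow> 'p tvec) \<Rightarrow>
   'q \<Rightarrow> complex^'s^'s" where
  "Theta m M \<theta> \<gamma> P fr q =
     mat (\<i> / 2) **
     (\<Sum>k<2*m. \<Sum>j<k. ext_deriv M \<theta> (proj P q) (fr q j) (fr q k) *\<^sub>R
        (clifford_mult m M \<theta> \<gamma> P fr q (fr q j) ** clifford_mult m M \<theta> \<gamma> P fr q (fr q k)))"

text \<open>
  The spinor derivative, on the representative at \<open>q\<close>: for a local section \<open>s\<close> of \<open>P\<close> through \<open>q\<close>,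
  the connection forms of the frame \<open>fr \<circ> s\<close> of \<open>H(M)\<close> and of the unit section \<open>dt \<circ> s\<close> of the
  determinant bundle are lifted to \<open>P\<close>. The result does not depend on the choice of \<open>s\<close>.
\<close>

definition spinor_deriv ::
  "nat \<Rightarrow> ('p::topological_space, 'n::finite) cr_struct \<Rightarrow> ('p \<Rightarrow> 'p tvec \<Rightarrow> real) \<Rightarrow>
   ('p \<Rightarrow> 'p tvec \<Rightarrow> ('p \<Rightarrow> 'p tvec) \<Rightarrow> 'p tvec) \<Rightarrow>
   ('e, 'p, complex) fbundle \<Rightarrow> ('e \<Rightarrow> (nat \<Rightarrow> 'p tvec) \<Rightarrow> complex) \<Rightarrow> int \<Rightarrow>
   (nat \<Rightarrow> complex^'s^'s) \<Rightarrow> ('q, 'p, complex^'s^'s) fbundle \<Rightarrow>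
   ('q \<Rightarrow> nat \<Rightarrow> 'p tvec) \<Rightarrow> ('q \<Rightarrow> 'e \<Rightarrow> complex) \<Rightarrow>
   'q \<Rightarrow> 'p tvec \<Rightarrow> ('q \<Rightarrow> complex^'s) \<Rightarrow> complex^'s" where
  "spinor_deriv m M \<theta> nab E \<kappa> wt \<gamma> P fr dt q v \<phi> =
     (let x = proj P q;
          s = (SOME s. local_section M P x s \<and> s x = q);
          \<omega> = (\<lambda>k j. metric M \<theta> x (nab x v (\<lambda>y. fr (s y) j)) (fr q k));
          a = power_form m M nab E \<kappa> wt x v (\<lambda>y. dt (s y))
      in dir_deriv_vec v (\<lambda>y. \<phi> (s y)) + spinc_lift m \<gamma> \<omega> a *v \<phi> q)"

definition kohn_dirac ::
  "nat \<Rightarrow> ('p::topological_space, 'n::finite) cr_struct \<Rightarrow> ('p \<Rightarrow> 'p tvec \<Rightarrow> real) \<Rightarrow>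
   ('p \<Rightarrow> 'p tvec \<Rightarrow> ('p \<Rightarrow> 'p tvec) \<Rightarrow> 'p tvec) \<Rightarrow>
   ('e, 'p, complex) fbundle \<Rightarrow> ('e \<Rightarrow> (nat \<Rightarrow> 'p tvec) \<Rightarrow> complex) \<Rightarrow> int \<Rightarrow>
   (nat \<Rightarrow> complex^'s^'s) \<Rightarrow> ('q, 'p, complex^'s^'s) fbundle \<Rightarrow>
   ('q \<Rightarrow> nat \<Rightarrow> 'p tvec) \<Rightarrow> ('q \<Rightarrow> 'e \<Rightarrow> complex) \<Rightarrow>
   ('q \<Rightarrow> complex^'s) \<Rightarrow> 'q \<Rightarrow> complex^'s" where
  "kohn_dirac m M \<theta> nab E \<kappa> wt \<gamma> P fr dt \<phi> q =
     (\<Sum>i<2*m. clifford_mult m M \<theta> \<gamma> P fr q (fr q i) *v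
        spinor_deriv m M \<theta> nab E \<kappa> wt \<gamma> P fr dt q (fr q i) \<phi>)"

text \<open>
  The spin\<open>\<^sup>c\<close> structure of \<open>\<theta>' = e\<^sup>2\<^sup>f \<theta>\<close> that corresponds to \<open>(P, fr, dt)\<close>. Its spinor frames are those
  of \<open>\<theta>\<close>, so the principal bundle is again \<open>P\<close>, but \<open>q\<close> now covers the rescaled orthonormal frame
  \<open>e\<^sup>-\<^sup>f fr q\<close> and the positively rescaled unit vector of \<open>E(wt)\<close>. The induced isomorphism of spinor
  bundles maps the class \<open>[q, \<psi>]\<close> for \<open>\<theta>\<close> to the class \<open>[q, \<psi>]\<close> for \<open>\<theta>'\<close>: a spinor field and its
  image are the same equivariant function on \<open>P\<close>.
\<close>

definition conformal_spinc ::
  "nat \<Rightarrow> ('p::topological_space, 'n::finite) cr_struct \<Rightarrow> ('p \<Rightarrow> 'p tvec \<Rightarrow> real) \<Rightarrow> ('p \<Rightarrow> real) \<Rightarrow>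
   ('e, 'p, complex) fbundle \<Rightarrow> ('e \<Rightarrow> (nat \<Rightarrow> 'p tvec) \<Rightarrow> complex) \<Rightarrow> int \<Rightarrow>
   (nat \<Rightarrow> complex^'s^'s) \<Rightarrow> ('q, 'p, complex^'s^'s) fbundle \<Rightarrow>
   ('q \<Rightarrow> nat \<Rightarrow> 'p tvec) \<Rightarrow> ('q \<Rightarrow> 'e \<Rightarrow> complex) \<Rightarrow>
   ('q \<Rightarrow> nat \<Rightarrow> 'p tvec) \<Rightarrow> ('q \<Rightarrow> 'e \<Rightarrow> complex) \<Rightarrow> bool" where
  "conformal_spinc m M \<theta> f E \<kappa> wt \<gamma> P fr dt fr' dt' \<longleftrightarrow>
     spinc_structure m M (\<lambda>x v. exp (2 * f x) * \<theta> x v) E \<kappa> wt \<gamma> P fr' dt' \<and>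
     (\<forall>q. \<forall>i<2*m. fr' q i = tscale (exp (- f (proj P q))) (fr q i)) \<and>
     (\<forall>q. \<exists>c>0. \<forall>\<xi>. dt' q \<xi> = of_real c * dt q \<xi>)"

end

(*
  Write exp (2 f) T' = T + V with V horizontal; then V = - J (grad f), because d\<theta>(V, X) = 2 X f on H.
  The two Webster--Tanaka connections differ on H by a term whose trace part is X f and whose skew part
  Koszul's argument computes from the torsions d\<theta>(X, Y) T and d\<theta>'(X, Y) T'. Contracting it with
  Clifford multiplication, the Dirac operator changes by (m + 1) (grad f) + (1/4) V \<Omega>, where
  \<Omega> = -2 i \<Theta>. The complex trace of the same term, on (m+1,0)-forms, shows that the connection
  form of E(l) in the unit frame changes by - i l g(V, X), which contributes - (i l / 2) V to the Dirac
  operator. The weight exp (- (m + 1) f) cancels the gradient, and on the eigenspace \<Theta> = - l the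
  two terms in V cancel each other.
*)
theory Submission
  imports Defs
begin

section \<open>Calculus of smooth functions\<close>

text \<open>Tensors are evaluated through chosen extensions and chosen local sections, so each
  formula must first be freed from its choice. The lever is \<open>tensorial\<close>: a map of
  vector fields that is linear over smooth germs sees only the value at the point. It needs smooth
  coefficients in a local frame, which Cramer's rule supplies once the coordinate derivations are
  known to span the tangent space. Smooth orthonormal frames are images of local sections of
  \<open>P\<close>. Origin of the constants: a unitary frame scales by exp (- f) and the Reeb field,
  up to V, by exp (- 2 f), so norms of (m+1,0)-forms scale with exponent -(m+2). The complex trace
  of the connection difference has the same factor m+2: X f from each of m vectors and 2 X f from T.
  The root divides it out and leaves X f - i g(V,X), whose real part is cancelled by the rescaling
  of unit sections. The m+1 is a quarter of 8 - 2 + (2m-2) + 2m: two commutators with the complex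
  structure, one exchange of factors, and the two delta terms in
  \<open>dirac_identity\<close>.\<close>

lemma diff_k_on_subset: "diff_k_on k S f \<Longrightarrow> T \<subseteq> S \<Longrightarrow> diff_k_on k T f"
proof (induction k arbitrary: f)
  case 0
  then show ?case by (auto intro: continuous_on_subset)
next
  case (Suc k)
  then show ?case by auto
qed

lemma diff_k_on_SucD: "diff_k_on (Suc k) S f \<Longrightarrow> diff_k_on k S f"
proof (induction k arbitrary: f)
  case 0
  then show ?case
    by (auto intro!: continuous_at_imp_continuous_on differentiable_imp_continuous_within)
next
  case (Suc k)
  show ?case
    unfolding diff_k_on.simps(2)[of k]
    using Suc.prems Suc.IH unfolding diff_k_on.simps(2)[of "Suc k"] by blast
qed

text \<open>Openness matters: the derivatives are taken \<open>at x\<close>, not within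
  \<open>S\<close>, so agreement on \<open>S\<close> has to cover a neighbourhood of each
  point.\<close>

lemma diff_k_on_cong:
  assumes "open S" "\<And>x. x \<in> S \<Longrightarrow> f x = g x" "diff_k_on k S f"
  shows "diff_k_on k S g"
  using assms(2,3)
proof (induction k arbitrary: f g)
  case 0
  then show ?case using continuous_on_cong[of S S f g] by auto
next
  case (Suc k)
  have der: "(g has_derivative frechet_derivative f (at x)) (at x)" if "x \<in> S" for x
  proof -
    have "(f has_derivative frechet_derivative f (at x)) (at x)"
      using Suc.prems that frechet_derivative_works by auto
    then show ?thesis
      by (rule has_derivative_transform_within_open[OF _ assms(1) that]) (use Suc.prems in auto)
  qed
  have eq: "frechet_derivative f (at x) = frechet_derivative g (at x)" if "x \<in> S" for x
    using frechet_derivative_at[OF der[OF that]] .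
  have "diff_k_on k S (\<lambda>x. frechet_derivative g (at x) v)" for v
    using Suc.IH[of "\<lambda>x. frechet_derivative f (at x) v" "\<lambda>x. frechet_derivative g (at x) v"]
      Suc.prems eq by auto
  then show ?case using der by (auto simp: differentiable_def)
qed

lemma diff_k_on_const: "diff_k_on k S (\<lambda>x. c)"
  by (induction k arbitrary: c) auto

lemma diff_k_on_add:
  assumes "open S" "diff_k_on k S f" "diff_k_on k S g"
  shows "diff_k_on k S (\<lambda>x. f x + g x)"
  using assms(2,3)
proof (induction k arbitrary: f g)
  case 0
  then show ?case by (auto intro: continuous_on_add)
next
  case (Suc k)
  have der: "((\<lambda>x. f x + g x) has_derivative
      (\<lambda>v. frechet_derivative f (at x) v + frechet_derivative g (at x) v)) (at x)" if "x \<in> S" for x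
    using Suc.prems that by (auto intro!: has_derivative_add simp: frechet_derivative_works[symmetric])
  have "diff_k_on k S (\<lambda>x. frechet_derivative (\<lambda>x. f x + g x) (at x) v)" for v
    by (rule diff_k_on_cong[OF assms(1), where f = "\<lambda>x. frechet_derivative f (at x) v + frechet_derivative g (at x) v"])
      (use Suc frechet_derivative_at[OF der] in \<open>auto simp: fun_eq_iff\<close>)
  then show ?case using der by (auto simp: differentiable_def)
qed

lemma diff_k_on_bilinear:
  assumes "bounded_bilinear pr" "open S" "diff_k_on k S f" "diff_k_on k S g"
  shows "diff_k_on k S (\<lambda>x. pr (f x) (g x))"
  using assms(3,4)
proof (induction k arbitrary: f g)
  case 0
  then show ?case by (auto intro: bounded_bilinear.continuous_on[OF assms(1)])
next
  case (Suc k)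
  have der: "((\<lambda>x. pr (f x) (g x)) has_derivative
      (\<lambda>v. pr (f x) (frechet_derivative g (at x) v) + pr (frechet_derivative f (at x) v) (g x))) (at x)"
    if "x \<in> S" for x
    using Suc.prems that
    by (auto intro!: bounded_bilinear.FDERIV[OF assms(1)] simp: frechet_derivative_works[symmetric])
  have "diff_k_on k S (\<lambda>x. frechet_derivative (\<lambda>x. pr (f x) (g x)) (at x) v)" for v
    by (rule diff_k_on_cong[OF assms(2), where f = "\<lambda>x. pr (f x) (frechet_derivative g (at x) v) +
          pr (frechet_derivative f (at x) v) (g x)"])
      (use Suc frechet_derivative_at[OF der] diff_k_on_SucD[OF Suc.prems(1)] diff_k_on_SucD[OF Suc.prems(2)]
       in \<open>auto simp: fun_eq_iff intro!: diff_k_on_add[OF assms(2)]\<close>)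
  then show ?case using der by (auto simp: differentiable_def)
qed

text \<open>Scaling the image by a constant is a bilinear operation, so the product rule with the
  constant 1 covers linear maps.\<close>

lemma diff_k_on_linear:
  assumes "bounded_linear L" "open S" "diff_k_on k S f"
  shows "diff_k_on k S (\<lambda>x. L (f x))"
proof -
  interpret bounded_linear L by fact
  have "bounded_bilinear (\<lambda>a b. a *\<^sub>R L b)"
    by (rule bounded_bilinear.comp[OF bounded_bilinear_scaleR bounded_linear_ident assms(1)])
  from diff_k_on_bilinear[OF this assms(2) diff_k_on_const assms(3), of 1] show ?thesis by simp
qed

text \<open>The derivative of 1/f is a product of 1/f, f' and 1/f, so order \<open>k\<close> of the
  reciprocal itself gives order \<open>Suc k\<close>; \<open>f\<close> stays fixed in the
  induction.\<close>

lemma diff_k_on_inverse: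
  fixes f :: "'a::euclidean_space \<Rightarrow> real"
  assumes "open S" "diff_k_on k S f" "\<And>x. x \<in> S \<Longrightarrow> f x \<noteq> 0"
  shows "diff_k_on k S (\<lambda>x. inverse (f x))"
  using assms(2)
proof (induction k)
  case 0
  then show ?case using assms by (auto intro: continuous_on_inverse)
next
  case (Suc k)
  have der: "((\<lambda>x. inverse (f x)) has_derivative
      (\<lambda>v. - (inverse (f x) * frechet_derivative f (at x) v * inverse (f x)))) (at x)" if "x \<in> S" for x
    using Suc.prems that assms(3)
    by (intro Deriv.has_derivative_inverse) (auto simp: frechet_derivative_works[symmetric])
  have "diff_k_on k S (\<lambda>x. frechet_derivative (\<lambda>x. inverse (f x)) (at x) v)" for v
  proof (rule diff_k_on_cong[OF assms(1), where f = "\<lambda>x. (-1) * ((inverse (f x) * frechet_derivative f (at x) v) * inverse (f x))"])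
    have "diff_k_on k S (\<lambda>x. inverse (f x))" "diff_k_on k S (\<lambda>x. frechet_derivative f (at x) v)"
      using Suc.prems diff_k_on_SucD[OF Suc.prems] by (auto intro: Suc.IH)
    then show "diff_k_on k S (\<lambda>x. (-1) * ((inverse (f x) * frechet_derivative f (at x) v) * inverse (f x)))"
      by (intro diff_k_on_bilinear[OF bounded_bilinear_mult assms(1)] diff_k_on_const)
  qed (use frechet_derivative_at[OF der] in \<open>auto simp: fun_eq_iff\<close>)
  then show ?case using der by (auto simp: differentiable_def)
qed

lemma diff_k_on_exp:
  fixes f :: "'a::euclidean_space \<Rightarrow> real"
  assumes "open S" "diff_k_on k S f"
  shows "diff_k_on k S (\<lambda>x. exp (f x))"
  using assms(2)
proof (induction k)
  case 0
  then show ?case using assms by (auto intro: continuous_on_exp)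
next
  case (Suc k)
  have der: "((\<lambda>x. exp (f x)) has_derivative
      (\<lambda>v. frechet_derivative f (at x) v * exp (f x))) (at x)" if "x \<in> S" for x
  proof -
    have "(f has_derivative frechet_derivative f (at x)) (at x)"
      using Suc.prems that by (auto simp: frechet_derivative_works[symmetric])
    from has_derivative_exp[OF this] show ?thesis by simp
  qed
  have "diff_k_on k S (\<lambda>x. frechet_derivative (\<lambda>x. exp (f x)) (at x) v)" for v
  proof (rule diff_k_on_cong[OF assms(1), where f = "\<lambda>x. frechet_derivative f (at x) v * exp (f x)"])
    have "diff_k_on k S (\<lambda>x. exp (f x))" "diff_k_on k S (\<lambda>x. frechet_derivative f (at x) v)"
      using Suc.prems diff_k_on_SucD[OF Suc.prems] by (auto intro: Suc.IH)
    then show "diff_k_on k S (\<lambda>x. frechet_derivative f (at x) v * exp (f x))"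
      by (intro diff_k_on_bilinear[OF bounded_bilinear_mult assms(1)])
  qed (use frechet_derivative_at[OF der] in \<open>auto simp: fun_eq_iff\<close>)
  then show ?case using der by (auto simp: differentiable_def)
qed


section \<open>Germs of smooth functions and tangent vectors\<close>

lemma tscale_simps [simp]:
  "tscale 1 v = v" "tscale 0 v = 0" "tscale c 0 = 0" "tscale a (tscale b v) = tscale (a * b) v"
  "tscale c v h = c * v h"
  by (auto simp: tscale_def fun_eq_iff)

lemma tscale_add: "tscale (a + b) v = tscale a v + tscale b v" "tscale a (v + w) = tscale a v + tscale a w"
  and tscale_minus: "tscale (- a) v = - tscale a v" "tscale a (- v) = - tscale a v"
  by (auto simp: tscale_def fun_eq_iff algebra_simps)

lemma tscale_sum: "tscale a (sum f I) = (\<Sum>i\<in>I. tscale a (f i))"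
  "tscale (sum c I) v = (\<Sum>i\<in>I. tscale (c i) v)"
  by (induction I rule: infinite_finite_induct) (auto simp: tscale_add)

lemma tvec_sum_apply: "(sum f I :: 'p tvec) h = (\<Sum>i\<in>I. f i h)"
  by (induction I rule: infinite_finite_induct) auto

interpretation tv: vector_space tscale
  by unfold_locales (auto simp: tscale_add)

locale smooth_manifold =
  fixes M :: "('p::t2_space, 'n::finite) cr_struct"
  assumes atlas: "smooth_atlas (charts M)"
begin

lemma chart_covers: "\<exists>V \<psi>. (V, \<psi>) \<in> charts M \<and> x \<in> V"
proof -
  have "x \<in> (\<Union>(V, \<psi>)\<in>charts M. V)" using atlas unfolding smooth_atlas_def by (metis UNIV_I)
  then show ?thesis by auto
qed

lemma chart_props:
  assumes "(V, \<psi>) \<in> charts M"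
  shows "open V" "open (\<psi> ` V)" "homeomorphism V (\<psi> ` V) \<psi> (inv_into V \<psi>)"
proof -
  have "\<forall>(U, x)\<in>charts M. open U \<and> open (x ` U) \<and> homeomorphism U (x ` U) x (inv_into U x)"
    using atlas unfolding smooth_atlas_def by (elim conjE)
  with assms show "open V" "open (\<psi> ` V)" "homeomorphism V (\<psi> ` V) \<psi> (inv_into V \<psi>)" by auto
qed

lemma chart_inv:
  assumes "(V, \<psi>) \<in> charts M" "y \<in> V"
  shows "inv_into V \<psi> (\<psi> y) = y"
  using chart_props(3)[OF assms(1)] assms(2) unfolding homeomorphism_def by auto

lemma open_chart_image:
  assumes "(V, \<psi>) \<in> charts M" "open U"
  shows "open (\<psi> ` (U \<inter> V))"
proof -
  note hom = chart_props(3)[OF assms(1)]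
  have "openin (top_of_set (\<psi> ` V)) (\<psi> ` (U \<inter> V))"
    by (rule homeomorphism_imp_open_map[OF hom]) (use assms(2) in \<open>auto simp: openin_open\<close>)
  then show ?thesis using chart_props(2)[OF assms(1)] openin_open_trans by blast
qed

lemma smooth_fun_open: "smooth_fun M U h \<Longrightarrow> open U"
  by (simp add: smooth_fun_def)

lemma smooth_fun_diff_k:
  "smooth_fun M U h \<Longrightarrow> (V, \<psi>) \<in> charts M \<Longrightarrow> diff_k_on k (\<psi> ` (U \<inter> V)) (h \<circ> inv_into V \<psi>)"
  by (auto simp: smooth_fun_def smooth_on_def)

lemma smooth_funI:
  assumes "open U"
    "\<And>V \<psi> k. (V, \<psi>) \<in> charts M \<Longrightarrow> open (\<psi> ` (U \<inter> V)) \<Longrightarrow>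
      (\<And>z. z \<in> \<psi> ` (U \<inter> V) \<Longrightarrow> inv_into V \<psi> z \<in> U) \<Longrightarrow>
      diff_k_on k (\<psi> ` (U \<inter> V)) (h \<circ> inv_into V \<psi>)"
  shows "smooth_fun M U h"
proof -
  have "smooth_on (\<psi> ` (U \<inter> V)) (h \<circ> inv_into V \<psi>)" if c: "(V, \<psi>) \<in> charts M" for V \<psi>
    unfolding smooth_on_def
  proof
    have "inv_into V \<psi> z \<in> U" if "z \<in> \<psi> ` (U \<inter> V)" for z
      using that chart_inv[OF c] by auto
    then show "diff_k_on k (\<psi> ` (U \<inter> V)) (h \<circ> inv_into V \<psi>)" for k
      using assms(2)[OF c open_chart_image[OF c assms(1)]] by blast
  qed
  then show ?thesis using assms(1) unfolding smooth_fun_def by blast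
qed

lemma smooth_fun_subset: "smooth_fun M U h \<Longrightarrow> open W \<Longrightarrow> W \<subseteq> U \<Longrightarrow> smooth_fun M W h"
  by (rule smooth_funI) (auto intro: diff_k_on_subset[OF smooth_fun_diff_k])

lemma smooth_fun_Int:
  assumes "open W" "smooth_fun M U h"
  shows "smooth_fun M (U \<inter> W) h" "smooth_fun M (W \<inter> U) h"
  using assms smooth_fun_open[of U h] by (auto intro: smooth_fun_subset)

lemma smooth_fun_cong:
  "smooth_fun M U g \<Longrightarrow> (\<And>y. y \<in> U \<Longrightarrow> g y = h y) \<Longrightarrow> smooth_fun M U h"
  by (rule smooth_funI)
    (auto simp: smooth_fun_open intro: diff_k_on_cong[OF _ _ smooth_fun_diff_k[of U g]])

lemma smooth_fun_const: "open U \<Longrightarrow> smooth_fun M U (\<lambda>y. c)"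
  by (rule smooth_funI) (auto simp: comp_def diff_k_on_const)

lemma smooth_fun_add:
  "smooth_fun M U g \<Longrightarrow> smooth_fun M U h \<Longrightarrow> smooth_fun M U (\<lambda>y. g y + h y)"
  using diff_k_on_add[OF _ smooth_fun_diff_k smooth_fun_diff_k]
  by (intro smooth_funI) (auto simp: comp_def smooth_fun_open)

lemma smooth_fun_bilinear:
  "bounded_bilinear pr \<Longrightarrow> smooth_fun M U g \<Longrightarrow> smooth_fun M U h \<Longrightarrow> smooth_fun M U (\<lambda>y. pr (g y) (h y))"
  using diff_k_on_bilinear[OF _ _ smooth_fun_diff_k smooth_fun_diff_k]
  by (intro smooth_funI) (auto simp: comp_def smooth_fun_open)

lemma smooth_fun_linear:
  "bounded_linear L \<Longrightarrow> smooth_fun M U h \<Longrightarrow> smooth_fun M U (\<lambda>y. L (h y))"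
  using diff_k_on_linear[OF _ _ smooth_fun_diff_k]
  by (intro smooth_funI) (auto simp: comp_def smooth_fun_open)

lemma smooth_fun_exp: "smooth_fun M U h \<Longrightarrow> smooth_fun M U (\<lambda>y. exp (h y) :: real)"
  using diff_k_on_exp[OF _ smooth_fun_diff_k]
  by (intro smooth_funI) (auto simp: comp_def smooth_fun_open)

lemma smooth_fun_inverse:
  assumes "smooth_fun M U h" "\<And>y. y \<in> U \<Longrightarrow> h y \<noteq> 0"
  shows "smooth_fun M U (\<lambda>y. inverse (h y) :: real)"
proof (rule smooth_funI)
  show "diff_k_on k (\<psi> ` (U \<inter> V)) ((\<lambda>y. inverse (h y)) \<circ> inv_into V \<psi>)"
    if "(V, \<psi>) \<in> charts M" "open (\<psi> ` (U \<inter> V))"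
      "\<And>z. z \<in> \<psi> ` (U \<inter> V) \<Longrightarrow> inv_into V \<psi> z \<in> U" for V \<psi> k
    using diff_k_on_inverse[OF that(2) smooth_fun_diff_k[OF assms(1) that(1)], of k] that(3) assms(2)
    by (simp add: comp_def)
qed (use assms smooth_fun_open in auto)

lemma smooth_fun_continuous:
  assumes "smooth_fun M U h"
  shows "continuous_on U h"
proof -
  have "isCont h y" if "y \<in> U" for y
  proof -
    obtain V \<psi> where V: "(V, \<psi>) \<in> charts M" "y \<in> V" using chart_covers by blast
    have op: "open (U \<inter> V)" using V assms smooth_fun_open chart_props(1) by blast
    have 1: "continuous_on (U \<inter> V) \<psi>"
      using chart_props(3)[OF V(1)] unfolding homeomorphism_def by (auto intro: continuous_on_subset)
    have 2: "continuous_on (\<psi> ` (U \<inter> V)) (h \<circ> inv_into V \<psi>)"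
      using smooth_fun_diff_k[OF assms V(1), of 0] by simp
    have "continuous_on (U \<inter> V) ((h \<circ> inv_into V \<psi>) \<circ> \<psi>)"
      by (rule continuous_on_compose[OF 1 2])
    then have "continuous_on (U \<inter> V) h"
      by (rule continuous_on_eq) (use chart_inv[OF V(1)] in auto)
    then show ?thesis using continuous_on_eq_continuous_at[OF op] V that by blast
  qed
  then show "continuous_on U h" by (auto intro: continuous_at_imp_continuous_on)
qed

lemma smooth_germ_fun: "smooth_fun M U h \<Longrightarrow> x \<in> U \<Longrightarrow> smooth_germ M x h"
  by (auto simp: smooth_germ_def)

lemma smooth_germ_eventually:
  assumes "smooth_germ M x h"
  shows "\<forall>\<^sub>F y in nhds x. smooth_germ M y h"
  using assms by (auto simp: smooth_germ_def eventually_nhds smooth_fun_def)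

lemma smooth_germ_cong:
  assumes "smooth_germ M x g" "\<forall>\<^sub>F y in nhds x. g y = h y"
  shows "smooth_germ M x h"
proof -
  obtain U W where U: "x \<in> U" "smooth_fun M U g" and W: "open W" "x \<in> W" "\<And>y. y \<in> W \<Longrightarrow> g y = h y"
    using assms by (auto simp: smooth_germ_def eventually_nhds)
  have "smooth_fun M (U \<inter> W) h"
    by (rule smooth_fun_cong[OF smooth_fun_subset[OF U(2)]]) (use U W smooth_fun_open in auto)
  then show ?thesis using U W by (auto simp: smooth_germ_def)
qed

lemma smooth_germ_const [simp]: "smooth_germ M x (\<lambda>y. c)"
  using smooth_fun_const[of UNIV c] by (auto simp: smooth_germ_def)

lemma smooth_germ_bilinear:
  assumes "bounded_bilinear pr" "smooth_germ M x g" "smooth_germ M x h"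
  shows "smooth_germ M x (\<lambda>y. pr (g y) (h y))"
proof -
  obtain U W where U: "x \<in> U" "smooth_fun M U g" and W: "x \<in> W" "smooth_fun M W h"
    using assms by (auto simp: smooth_germ_def)
  have "smooth_fun M (U \<inter> W) (\<lambda>y. pr (g y) (h y))"
    by (rule smooth_fun_bilinear[OF assms(1)])
      (use smooth_fun_Int[OF smooth_fun_open[OF W(2)] U(2)] smooth_fun_Int[OF smooth_fun_open[OF U(2)] W(2)] in auto)
  then show ?thesis using U W by (auto simp: smooth_germ_def)
qed

lemmas smooth_germ_mult = smooth_germ_bilinear[OF bounded_bilinear_mult]

lemma smooth_germ_add:
  assumes "smooth_germ M x g" "smooth_germ M x h"
  shows "smooth_germ M x (\<lambda>y. g y + h y)"
proof -
  obtain U W where U: "x \<in> U" "smooth_fun M U g" and W: "x \<in> W" "smooth_fun M W h"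
    using assms by (auto simp: smooth_germ_def)
  have "smooth_fun M (U \<inter> W) (\<lambda>y. g y + h y)"
    by (rule smooth_fun_add) (use smooth_fun_Int[OF smooth_fun_open[OF W(2)] U(2)] smooth_fun_Int[OF smooth_fun_open[OF U(2)] W(2)] in auto)
  then show ?thesis using U W by (auto simp: smooth_germ_def)
qed

lemma smooth_germ_linear:
  "bounded_linear L \<Longrightarrow> smooth_germ M x h \<Longrightarrow> smooth_germ M x (\<lambda>y. L (h y))"
  using smooth_fun_linear by (auto simp: smooth_germ_def)

lemma smooth_germ_uminus: "smooth_germ M x h \<Longrightarrow> smooth_germ M x (\<lambda>y. - h y)"
  by (rule smooth_germ_linear[OF bounded_linear_minus[OF bounded_linear_ident]])

lemma smooth_germ_diff:
  "smooth_germ M x g \<Longrightarrow> smooth_germ M x h \<Longrightarrow> smooth_germ M x (\<lambda>y. g y - h y)"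
  using smooth_germ_add[of x g "\<lambda>y. - h y"] smooth_germ_uminus[of x h] by simp

lemma smooth_germ_sum:
  "(\<And>i. i \<in> I \<Longrightarrow> smooth_germ M x (g i)) \<Longrightarrow> smooth_germ M x (\<lambda>y. \<Sum>i\<in>I. g i y)"
  by (induction I rule: infinite_finite_induct) (auto intro: smooth_germ_add)

lemma smooth_germ_prod:
  fixes g :: "_ \<Rightarrow> _ \<Rightarrow> real"
  shows "(\<And>i. i \<in> I \<Longrightarrow> smooth_germ M x (g i)) \<Longrightarrow> smooth_germ M x (\<lambda>y. \<Prod>i\<in>I. g i y)"
  by (induction I rule: infinite_finite_induct) (auto intro: smooth_germ_mult)

lemma smooth_germ_exp: "smooth_germ M x h \<Longrightarrow> smooth_germ M x (\<lambda>y. exp (h y) :: real)"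
  using smooth_fun_exp by (auto simp: smooth_germ_def)

lemma smooth_germ_isCont:
  assumes "smooth_germ M x h"
  shows "isCont h x"
proof -
  obtain U where "x \<in> U" "smooth_fun M U h" using assms by (auto simp: smooth_germ_def)
  then show ?thesis
    using smooth_fun_continuous[of U h] smooth_fun_open[of U h] continuous_on_eq_continuous_at by blast
qed

lemma smooth_germ_nonzero:
  assumes "smooth_germ M x h" "h x \<noteq> 0"
  shows "\<forall>\<^sub>F y in nhds x. h y \<noteq> 0"
  using tendsto_imp_eventually_ne[of h "h x" "nhds x" 0] smooth_germ_isCont[OF assms(1)] assms(2)
  by (simp add: continuous_at tendsto_at_iff_tendsto_nhds)

lemma smooth_germ_inverse:
  assumes "smooth_germ M x h" "h x \<noteq> 0"
  shows "smooth_germ M x (\<lambda>y. inverse (h y) :: real)"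
proof -
  obtain U where U: "x \<in> U" "smooth_fun M U h" using assms by (auto simp: smooth_germ_def)
  obtain W where W: "open W" "x \<in> W" "\<And>y. y \<in> W \<Longrightarrow> h y \<noteq> 0"
    using smooth_germ_nonzero[OF assms] by (auto simp: eventually_nhds)
  have "smooth_fun M (U \<inter> W) (\<lambda>y. inverse (h y))"
    by (rule smooth_fun_inverse) (use smooth_fun_Int[OF W(1) U(2)] W in auto)
  then show ?thesis using U W by (auto simp: smooth_germ_def)
qed

section \<open>Tangent vectors as derivations, germs of vector fields\<close>

lemma tangentD:
  assumes "v \<in> tangent M x"
  shows "smooth_germ M x g \<Longrightarrow> smooth_germ M x h \<Longrightarrow> v (\<lambda>y. g y + h y) = v g + v h"
    and "smooth_germ M x g \<Longrightarrow> smooth_germ M x h \<Longrightarrow> v (\<lambda>y. g y * h y) = v g * h x + g x * v h"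
    and "smooth_germ M x h \<Longrightarrow> v (\<lambda>y. c * h y) = c * v h"
    and "\<not> smooth_germ M x h \<Longrightarrow> v h = 0"
  using assms unfolding tangent_def by blast+

lemma tangentI:
  assumes "\<And>g h. smooth_germ M x g \<Longrightarrow> smooth_germ M x h \<Longrightarrow> v (\<lambda>y. g y + h y) = v g + v h"
    and "\<And>g h. smooth_germ M x g \<Longrightarrow> smooth_germ M x h \<Longrightarrow> v (\<lambda>y. g y * h y) = v g * h x + g x * v h"
    and "\<And>h c. smooth_germ M x h \<Longrightarrow> v (\<lambda>y. c * h y) = c * v h"
    and "\<And>h. \<not> smooth_germ M x h \<Longrightarrow> v h = 0"
  shows "v \<in> tangent M x"
  unfolding tangent_def using assms by auto

lemma tangent_const: "v \<in> tangent M x \<Longrightarrow> v (\<lambda>y. c) = 0"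
  using tangentD(2)[of v x "\<lambda>y. 1" "\<lambda>y. 1"] tangentD(3)[of v x "\<lambda>y. 1" c] by simp

text \<open>The indicator b of a neighbourhood is a smooth germ with b * b = b, so the Leibniz rule
  gives v b = 2 v b, hence v b = 0. As b * g and b * h are the same function, v g and v h
  agree.\<close>

lemma tangent_cong:
  assumes "v \<in> tangent M x" "\<forall>\<^sub>F y in nhds x. g y = h y"
  shows "v g = v h"
proof (cases "smooth_germ M x g")
  case True
  then have h: "smooth_germ M x h" using assms(2) by (rule smooth_germ_cong)
  obtain W where W: "open W" "x \<in> W" "\<And>y. y \<in> W \<Longrightarrow> g y = h y"
    using assms(2) by (auto simp: eventually_nhds)
  define b where "b = (\<lambda>y. if y \<in> W then 1 else (0::real))"
  have ev: "\<forall>\<^sub>F y in nhds x. b y = 1" using W by (auto simp: eventually_nhds b_def)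
  have sm: "smooth_germ M x b"
    by (rule smooth_germ_cong[OF smooth_germ_const[of x 1]]) (use ev in \<open>auto elim: eventually_mono\<close>)
  have b1: "b x = 1" using W by (simp add: b_def)
  have "(\<lambda>y. b y * b y) = b" by (auto simp: b_def)
  then have 0: "v b = 0" using tangentD(2)[OF assms(1) sm sm] b1 by simp
  have "(\<lambda>y. b y * g y) = (\<lambda>y. b y * h y)" using W by (auto simp: b_def)
  then show ?thesis
    using tangentD(2)[OF assms(1) sm True] tangentD(2)[OF assms(1) sm h] 0 b1 by simp
next
  \<comment> \<open>Both functions then fail to be smooth near x, and the encoding prescribes the
    value 0 on either.\<close>
  case False
  then have "\<not> smooth_germ M x h" using smooth_germ_cong assms(2)
    by (metis (mono_tags, lifting) eventually_mono)
  with False show ?thesis using tangentD(4)[OF assms(1)] by simp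
qed

lemma tangent_diff:
  assumes "v \<in> tangent M x" "smooth_germ M x g" "smooth_germ M x h"
  shows "v (\<lambda>y. g y - h y) = v g - v h"
  using tangentD(1)[OF assms(1,2), of "\<lambda>y. (-1) * h y"] tangentD(3)[OF assms(1,3), of "-1"]
    smooth_germ_uminus[OF assms(3)] by simp

lemma tangent_subspace: "tv.subspace (tangent M x)"
proof (rule tv.subspaceI)
  show "0 \<in> tangent M x" by (rule tangentI) auto
  show "v + w \<in> tangent M x" if "v \<in> tangent M x" "w \<in> tangent M x" for v w
    using that by (intro tangentI) (simp_all add: tangentD algebra_simps)
  show "tscale c v \<in> tangent M x" if "v \<in> tangent M x" for c v
    using that by (intro tangentI) (simp_all add: tangentD algebra_simps)
qed

lemma tangent_closed:
  "0 \<in> tangent M x"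
  "v \<in> tangent M x \<Longrightarrow> w \<in> tangent M x \<Longrightarrow> v + w \<in> tangent M x"
  "v \<in> tangent M x \<Longrightarrow> w \<in> tangent M x \<Longrightarrow> v - w \<in> tangent M x"
  "v \<in> tangent M x \<Longrightarrow> tscale c v \<in> tangent M x"
  "v \<in> tangent M x \<Longrightarrow> - v \<in> tangent M x"
  "(\<And>i. i \<in> I \<Longrightarrow> u i \<in> tangent M x) \<Longrightarrow> sum u I \<in> tangent M x"
  using tangent_subspace[of x]
  by (simp_all add: tv.subspace_0 tv.subspace_add tv.subspace_diff tv.subspace_scale tv.subspace_neg
    tv.subspace_sum)

lemma vec_germ_tangent: "vec_germ M x X \<Longrightarrow> X x \<in> tangent M x"
  by (auto simp: vec_germ_def vec_field_def)

lemma vec_germ_eventually: "vec_germ M x X \<Longrightarrow> \<forall>\<^sub>F y in nhds x. vec_germ M y X"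
  by (auto simp: vec_germ_def vec_field_def eventually_nhds)

lemma vec_germ_apply:
  assumes "vec_germ M x X" "smooth_germ M x h"
  shows "smooth_germ M x (\<lambda>y. X y h)"
proof -
  obtain U W where U: "x \<in> U" "vec_field M U X" and W: "x \<in> W" "smooth_fun M W h"
    using assms by (auto simp: smooth_germ_def vec_germ_def)
  have "smooth_fun M (U \<inter> W) h"
    by (rule smooth_fun_subset[OF W(2)]) (use U W smooth_fun_open in \<open>auto simp: vec_field_def\<close>)
  then have "smooth_fun M (U \<inter> W) (\<lambda>y. X y h)" using U by (auto simp: vec_field_def)
  then show ?thesis using U W by (auto simp: smooth_germ_def)
qed

lemma vec_field_subset: "vec_field M U X \<Longrightarrow> open W \<Longrightarrow> W \<subseteq> U \<Longrightarrow> vec_field M W X"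
  by (auto simp: vec_field_def)

lemma vec_field_cong:
  assumes "vec_field M U X" "\<And>y. y \<in> U \<Longrightarrow> X y = Y y"
  shows "vec_field M U Y"
  unfolding vec_field_def
proof (intro conjI ballI allI impI)
  show "open U" using assms by (auto simp: vec_field_def)
  show "Y x \<in> tangent M x" if "x \<in> U" for x using assms that by (auto simp: vec_field_def)
  show "smooth_fun M V (\<lambda>y. Y y h)" if "V \<subseteq> U \<and> smooth_fun M V h" for V h
    by (rule smooth_fun_cong[of V "\<lambda>y. X y h"]) (use that assms in \<open>auto simp: vec_field_def\<close>)
qed

lemma vec_germ_cong:
  assumes "vec_germ M x X" "\<forall>\<^sub>F y in nhds x. X y = Y y"
  shows "vec_germ M x Y"
proof -
  obtain U W where U: "x \<in> U" "vec_field M U X" and W: "open W" "x \<in> W" "\<And>y. y \<in> W \<Longrightarrow> X y = Y y"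
    using assms by (auto simp: vec_germ_def eventually_nhds)
  have "vec_field M (U \<inter> W) Y"
    by (rule vec_field_cong[OF vec_field_subset[OF U(2)]]) (use U W in \<open>auto simp: vec_field_def\<close>)
  then show ?thesis using U W by (auto simp: vec_germ_def)
qed

lemma vec_germ_add:
  assumes "vec_germ M x X" "vec_germ M x Y"
  shows "vec_germ M x (\<lambda>y. X y + Y y)"
proof -
  obtain U W where U: "x \<in> U" "vec_field M U X" and W: "x \<in> W" "vec_field M W Y"
    using assms by (auto simp: vec_germ_def)
  have "vec_field M (U \<inter> W) (\<lambda>y. X y + Y y)"
    using U W by (auto simp: vec_field_def tangent_closed intro!: smooth_fun_add)
  then show ?thesis using U W by (auto simp: vec_germ_def)
qed

lemma vec_germ_scale:
  assumes "smooth_germ M x h" "vec_germ M x X"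
  shows "vec_germ M x (\<lambda>y. tscale (h y) (X y))"
proof -
  obtain U W where U: "x \<in> U" "vec_field M U X" and W: "x \<in> W" "smooth_fun M W h"
    using assms by (auto simp: vec_germ_def smooth_germ_def)
  have "open W" using W smooth_fun_open by blast
  then have "vec_field M (U \<inter> W) (\<lambda>y. tscale (h y) (X y))"
    using U W unfolding vec_field_def
    by (auto simp: tangent_closed intro!: smooth_fun_bilinear[OF bounded_bilinear_mult]
        intro: smooth_fun_subset[OF W(2) smooth_fun_open])
  then show ?thesis using U W by (auto simp: vec_germ_def)
qed

lemma vec_germ_zero: "vec_germ M x (\<lambda>y. 0)"
  unfolding vec_germ_def vec_field_def
  by (rule exI[of _ UNIV]) (auto simp: tangent_closed(1) intro!: smooth_fun_const intro: smooth_fun_open)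

lemma vec_germ_uminus: "vec_germ M x X \<Longrightarrow> vec_germ M x (\<lambda>y. - X y)"
  using vec_germ_scale[of x "\<lambda>y. -1" X] by (simp add: tscale_minus)

lemma vec_germ_diff: "vec_germ M x X \<Longrightarrow> vec_germ M x Y \<Longrightarrow> vec_germ M x (\<lambda>y. X y - Y y)"
  using vec_germ_add[OF _ vec_germ_uminus, of x X Y] by simp

lemma vec_germ_sum:
  "(\<And>i. i \<in> I \<Longrightarrow> vec_germ M x (X i)) \<Longrightarrow> vec_germ M x (\<lambda>y. \<Sum>i\<in>I. X i y)"
  by (induction I rule: infinite_finite_induct) (auto intro: vec_germ_add vec_germ_zero)

lemma hor_germ_iff: "hor_germ M x X \<longleftrightarrow> vec_germ M x X \<and> (\<forall>\<^sub>F y in nhds x. X y \<in> hdist M y)"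
proof
  assume "hor_germ M x X"
  then show "vec_germ M x X \<and> (\<forall>\<^sub>F y in nhds x. X y \<in> hdist M y)"
    by (auto simp: hor_germ_def vec_germ_def eventually_nhds vec_field_def)
next
  assume "vec_germ M x X \<and> (\<forall>\<^sub>F y in nhds x. X y \<in> hdist M y)"
  then obtain U W where U: "x \<in> U" "vec_field M U X" and W: "open W" "x \<in> W" "\<And>y. y \<in> W \<Longrightarrow> X y \<in> hdist M y"
    by (auto simp: vec_germ_def eventually_nhds)
  have "vec_field M (U \<inter> W) X"
    by (rule vec_field_subset[OF U(2)]) (use U W in \<open>auto simp: vec_field_def\<close>)
  then show "hor_germ M x X" using U W by (auto simp: hor_germ_def intro!: exI[of _ "U \<inter> W"])
qed

end


section \<open>Coordinate derivations and smooth local frames\<close>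

lemma is_basis_iff:
  assumes "is_basis n b S"
  shows "v \<in> S \<longleftrightarrow> (\<exists>c. v = (\<Sum>i<n. tscale (c i) (b i)))"
proof -
  have S: "S = (\<lambda>c. \<Sum>i<n. tscale (c i) (b i)) ` ({..<n} \<rightarrow>\<^sub>E UNIV)"
    using assms by (simp add: is_basis_def bij_betw_def)
  have "(\<Sum>i<n. tscale (c i) (b i)) \<in> S" for c
    unfolding S by (rule image_eqI[of _ _ "restrict c {..<n}"]) auto
  then show ?thesis using S by auto
qed

lemma is_basis_span:
  assumes "is_basis n b S"
  shows "S = tv.span (b ` {..<n})"
proof
  show "S \<subseteq> tv.span (b ` {..<n})"
  proof
    fix v assume "v \<in> S"
    then obtain c where "v = (\<Sum>i<n. tscale (c i) (b i))" using is_basis_iff[OF assms] by blast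
    then show "v \<in> tv.span (b ` {..<n})"
      by (simp only:) (intro tv.span_sum tv.span_scale tv.span_base imageI)
  qed
  have "tv.subspace S"
  proof (rule tv.subspaceI)
    show "0 \<in> S" unfolding is_basis_iff[OF assms] by (rule exI[of _ "\<lambda>i. 0"]) simp
    show "v + w \<in> S" if vw: "v \<in> S" "w \<in> S" for v w
    proof -
      obtain c d where "v = (\<Sum>i<n. tscale (c i) (b i))" "w = (\<Sum>i<n. tscale (d i) (b i))"
        using vw is_basis_iff[OF assms] by auto
      then have "v + w = (\<Sum>i<n. tscale (c i + d i) (b i))" by (simp add: tscale_add sum.distrib)
      then show ?thesis unfolding is_basis_iff[OF assms] by (rule exI[of _ "\<lambda>i. c i + d i"])
    qed
    show "tscale a v \<in> S" if v: "v \<in> S" for a v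
    proof -
      obtain c where "v = (\<Sum>i<n. tscale (c i) (b i))" using v is_basis_iff[OF assms] by auto
      then have "tscale a v = (\<Sum>i<n. tscale (a * c i) (b i))" by (simp add: tscale_sum)
      then show ?thesis unfolding is_basis_iff[OF assms] by (rule exI[of _ "\<lambda>i. a * c i"])
    qed
  qed
  moreover have "b ` {..<n} \<subseteq> S"
  proof
    fix v assume "v \<in> b ` {..<n}"
    then obtain i where i: "i < n" "v = b i" by auto
    have "v = (\<Sum>j<n. tscale (if j = i then 1 else 0) (b j))"
      using i by (simp add: if_distrib[of "\<lambda>c. tscale c _"] cong: if_cong)
    then show "v \<in> S" unfolding is_basis_iff[OF assms] by (rule exI[of _ "\<lambda>j. if j = i then 1 else 0"])
  qed
  ultimately show "tv.span (b ` {..<n}) \<subseteq> S" by (rule tv.span_minimal[rotated])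
qed

context smooth_manifold
begin

lemma chart_has_derivative:
  assumes "(V, \<psi>) \<in> charts M" "x \<in> V" "smooth_germ M x h"
  shows "((h \<circ> inv_into V \<psi>) has_derivative frechet_derivative (h \<circ> inv_into V \<psi>) (at (\<psi> x))) (at (\<psi> x))"
proof -
  obtain U where U: "x \<in> U" "smooth_fun M U h" using assms(3) by (auto simp: smooth_germ_def)
  have "diff_k_on (Suc 0) (\<psi> ` (U \<inter> V)) (h \<circ> inv_into V \<psi>)"
    by (rule smooth_fun_diff_k[OF U(2) assms(1)])
  then show ?thesis using U(1) assms(2) by (simp add: frechet_derivative_works[symmetric])
qed

text \<open>The directional derivative read in a chart; the branch 0 is the normalisation that
  \<open>tangent\<close> imposes on functions that are not smooth near the point.\<close>

definition coord_vec :: "'p set \<Rightarrow> ('p \<Rightarrow> real^'n) \<Rightarrow> 'p \<Rightarrow> real^'n \<Rightarrow> 'p tvec" where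
  "coord_vec V \<psi> x a = (\<lambda>h. if smooth_germ M x h
     then frechet_derivative (h \<circ> inv_into V \<psi>) (at (\<psi> x)) a else 0)"

lemma coord_vec_eqI:
  assumes "smooth_germ M x h" "((h \<circ> inv_into V \<psi>) has_derivative h') (at (\<psi> x))"
  shows "coord_vec V \<psi> x a h = h' a"
  using assms frechet_derivative_at[OF assms(2)] by (simp add: coord_vec_def)

lemma coord_vec_has_derivative:
  assumes "(V, \<psi>) \<in> charts M" "x \<in> V" "smooth_germ M x h"
  shows "((h \<circ> inv_into V \<psi>) has_derivative (\<lambda>a. coord_vec V \<psi> x a h)) (at (\<psi> x))"
  using chart_has_derivative[OF assms] assms(3) by (simp add: coord_vec_def)

lemma coord_vec_tangent:
  assumes "(V, \<psi>) \<in> charts M" "x \<in> V"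
  shows "coord_vec V \<psi> x a \<in> tangent M x"
proof (rule tangentI)
  note der = coord_vec_has_derivative[OF assms, unfolded comp_def]
  show "coord_vec V \<psi> x a (\<lambda>y. g y + h y) = coord_vec V \<psi> x a g + coord_vec V \<psi> x a h"
    if "smooth_germ M x g" "smooth_germ M x h" for g h
    using coord_vec_eqI[OF smooth_germ_add[OF that], unfolded comp_def,
        OF has_derivative_add[OF der[OF that(1)] der[OF that(2)]]] .
  show "coord_vec V \<psi> x a (\<lambda>y. g y * h y) = coord_vec V \<psi> x a g * h x + g x * coord_vec V \<psi> x a h"
    if "smooth_germ M x g" "smooth_germ M x h" for g h
    using coord_vec_eqI[OF smooth_germ_mult[OF that], unfolded comp_def,
        OF has_derivative_mult[OF der[OF that(1)] der[OF that(2)]]] chart_inv[OF assms] by simp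
  show "coord_vec V \<psi> x a (\<lambda>y. c * h y) = c * coord_vec V \<psi> x a h" if "smooth_germ M x h" for h c
    using coord_vec_eqI[OF smooth_germ_mult[OF smooth_germ_const that], unfolded comp_def,
        OF has_derivative_mult_right[OF der[OF that]]] .
qed (simp add: coord_vec_def)

lemma coord_vec_lincomb:
  assumes "(V, \<psi>) \<in> charts M" "x \<in> V"
  shows "coord_vec V \<psi> x (a + b) = coord_vec V \<psi> x a + coord_vec V \<psi> x b"
    and "coord_vec V \<psi> x (c *\<^sub>R a) = tscale c (coord_vec V \<psi> x a)"
    and "coord_vec V \<psi> x 0 = 0"
proof -
  have lin: "linear (\<lambda>a. coord_vec V \<psi> x a h)" if "smooth_germ M x h" for h
    using coord_vec_has_derivative[OF assms that] by (rule has_derivative_linear)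
  have 0: "coord_vec V \<psi> x a h = 0" if "\<not> smooth_germ M x h" for a h
    using that by (simp add: coord_vec_def)
  show "coord_vec V \<psi> x (a + b) = coord_vec V \<psi> x a + coord_vec V \<psi> x b"
  proof
    show "coord_vec V \<psi> x (a + b) h = (coord_vec V \<psi> x a + coord_vec V \<psi> x b) h" for h
      by (cases "smooth_germ M x h") (auto simp: 0 linear_add[OF lin])
  qed
  show "coord_vec V \<psi> x (c *\<^sub>R a) = tscale c (coord_vec V \<psi> x a)"
  proof
    show "coord_vec V \<psi> x (c *\<^sub>R a) h = tscale c (coord_vec V \<psi> x a) h" for h
      by (cases "smooth_germ M x h") (auto simp: 0 linear_cmul[OF lin])
  qed
  show "coord_vec V \<psi> x 0 = 0"
  proof
    show "coord_vec V \<psi> x 0 h = 0 h" for h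
      by (cases "smooth_germ M x h") (auto simp: 0 linear_0[OF lin])
  qed
qed

lemma smooth_chart_coord:
  assumes "(V, \<psi>) \<in> charts M" "x \<in> V"
  shows "smooth_germ M x (\<lambda>y. \<psi> y $ k)"
proof -
  have "smooth_fun M V \<psi>"
  proof (rule smooth_funI)
    show "open V" by (rule chart_props(1)[OF assms(1)])
    have "\<forall>(U, x)\<in>charts M. \<forall>(V, y)\<in>charts M. smooth_on (x ` (U \<inter> V)) (y \<circ> inv_into U x)"
      using atlas unfolding smooth_atlas_def by (elim conjE)
    then show "diff_k_on j (\<phi> ` (V \<inter> W)) (\<psi> \<circ> inv_into W \<phi>)" if "(W, \<phi>) \<in> charts M" for W \<phi> j
      using that assms(1) unfolding smooth_on_def by (fastforce simp: Int_commute)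
  qed
  then show ?thesis
    using smooth_germ_linear[OF bounded_linear_vec_nth smooth_germ_fun[OF _ assms(2)]] by blast
qed

lemma coord_vec_chart:
  assumes "(V, \<psi>) \<in> charts M" "x \<in> V"
  shows "coord_vec V \<psi> x a (\<lambda>y. \<psi> y $ k) = a $ k"
proof (rule coord_vec_eqI[OF smooth_chart_coord[OF assms]])
  have "((\<lambda>z. z $ k) has_derivative (\<lambda>a. a $ k)) (at (\<psi> x))"
    by (rule bounded_linear_imp_has_derivative[OF bounded_linear_vec_nth])
  moreover have "z $ k = ((\<lambda>y. \<psi> y $ k) \<circ> inv_into V \<psi>) z" if "z \<in> \<psi> ` V" for z
    using that by (auto simp: f_inv_into_f)
  ultimately show "(((\<lambda>y. \<psi> y $ k) \<circ> inv_into V \<psi>) has_derivative (\<lambda>a. a $ k)) (at (\<psi> x))"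
    using has_derivative_transform_within_open[OF _ chart_props(2)[OF assms(1)]] assms(2) by blast
qed

lemma smooth_germ_det:
  fixes A :: "'p \<Rightarrow> real^'k^'k"
  assumes "\<And>i j. smooth_germ M x (\<lambda>y. A y $ i $ j)"
  shows "smooth_germ M x (\<lambda>y. det (A y))"
  unfolding det_def by (intro smooth_germ_sum smooth_germ_mult smooth_germ_const smooth_germ_prod assms)

lemma eventually_chart: "(V, \<psi>) \<in> charts M \<Longrightarrow> x \<in> V \<Longrightarrow> \<forall>\<^sub>F y in nhds x. y \<in> V"
  using chart_props(1) eventually_nhds by blast

text \<open>Locality is automatic, because the indicator function of a neighbourhood is a smooth germ.\<close>

lemma germ_functional_cong:
  fixes \<Phi> :: "('p \<Rightarrow> 'p tvec) \<Rightarrow> 'b::real_vector"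
  assumes hom: "\<And>h X. smooth_germ M x h \<Longrightarrow> vec_germ M x X \<Longrightarrow> \<Phi> (\<lambda>y. tscale (h y) (X y)) = h x *\<^sub>R \<Phi> X"
    and X: "vec_germ M x X" and ev: "\<forall>\<^sub>F y in nhds x. X y = Y y"
  shows "\<Phi> X = \<Phi> Y"
proof -
  obtain W where W: "open W" "x \<in> W" "\<And>y. y \<in> W \<Longrightarrow> X y = Y y"
    using ev by (auto simp: eventually_nhds)
  define b where "b = (\<lambda>y. if y \<in> W then 1 else (0::real))"
  have "\<forall>\<^sub>F y in nhds x. 1 = b y" using W by (auto simp: eventually_nhds b_def)
  then have sm: "smooth_germ M x b" by (rule smooth_germ_cong[OF smooth_germ_const])
  have "(\<lambda>y. tscale (b y) (X y)) = (\<lambda>y. tscale (b y) (Y y))" using W by (auto simp: b_def)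
  then show ?thesis
    using hom[OF sm X] hom[OF sm vec_germ_cong[OF X ev]] W by (simp add: b_def)
qed

end

locale cr_mfd =
  fixes M :: "('p::{t2_space, second_countable_topology}, 'n::finite) cr_struct" and m :: nat
  assumes cr: "cr_manifold m M"
begin

sublocale smooth_manifold M
  using cr by unfold_locales (simp add: cr_manifold_def)

text \<open>
  The coordinate derivations lie in the tangent space, whose dimension is given, so they span it; this
  replaces Hadamard's lemma.
\<close>

lemma chart_frame:
  fixes x :: 'p and b :: "nat \<Rightarrow> 'p tvec"
  assumes ch: "(V, \<psi>) \<in> charts M" "x \<in> V" and bas: "is_basis (2*m + 1) b (tangent M x)"
    and idx: "bij_betw idx (UNIV :: 'n set) {..<2*m + 1}"
  defines "B \<equiv> (\<chi> i k. b (idx i) (\<lambda>y. \<psi> y $ k)) :: real^'n^'n"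
  shows "det B \<noteq> 0" "tangent M x \<subseteq> range (coord_vec V \<psi> x)"
proof -
  have "\<exists>c. coord_vec V \<psi> x (axis k 1) = (\<Sum>i<2*m + 1. tscale (c i) (b i))" for k
    using is_basis_iff[OF bas] coord_vec_tangent[OF ch] by blast
  then obtain c where c: "\<And>k. coord_vec V \<psi> x (axis k 1) = (\<Sum>i<2*m + 1. tscale (c k i) (b i))" by metis
  define C :: "real^'n^'n" where "C = (\<chi> k i. c k (idx i))"
  have C: "coord_vec V \<psi> x (axis k 1) = (\<Sum>i\<in>UNIV. tscale (C $ k $ i) (b (idx i)))" for k
    unfolding c C_def using sum.reindex_bij_betw[OF idx, of "\<lambda>i. tscale (c k i) (b i)"] by simp
  \<comment> \<open>\<open>C\<close> expands the coordinate derivations in the basis and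
    \<open>B\<close> evaluates the basis on the coordinate functions, so the product holds the
    partial derivatives of the coordinates. Both matrices are square, which makes \<open>C\<close> a
    right inverse of \<open>B\<close> too.\<close>
  have "C ** B = mat 1"
  proof -
    have "(C ** B) $ k $ l = mat 1 $ k $ l" for k l
    proof -
      have "(C ** B) $ k $ l = (\<Sum>i\<in>UNIV. tscale (C $ k $ i) (b (idx i))) (\<lambda>y. \<psi> y $ l)"
        by (simp add: matrix_matrix_mult_def B_def tvec_sum_apply)
      also have "\<dots> = axis k 1 $ l" unfolding C[symmetric] by (rule coord_vec_chart[OF ch])
      finally show ?thesis by (simp add: axis_def mat_def)
    qed
    then show ?thesis by (simp add: vec_eq_iff)
  qed
  then have BC: "B ** C = mat 1" by (simp add: matrix_left_right_inverse)
  then show "det B \<noteq> 0" by (metis det_I det_mul mult_zero_left zero_neq_one)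
  have sub: "tv.subspace (range (coord_vec V \<psi> x))"
    by (rule tv.subspaceI)
      (auto simp: coord_vec_lincomb[OF ch, symmetric] image_iff intro: exI[of _ 0])
  have "b j \<in> range (coord_vec V \<psi> x)" if "j < 2*m + 1" for j
  proof -
    obtain i where i: "idx i = j" using idx \<open>j < 2*m + 1\<close> unfolding bij_betw_def by (metis imageE lessThan_iff)
    have "(\<Sum>k\<in>UNIV. tscale (B $ i $ k) (coord_vec V \<psi> x (axis k 1)))
        = (\<Sum>k\<in>UNIV. \<Sum>l\<in>UNIV. tscale (B $ i $ k * C $ k $ l) (b (idx l)))"
      by (simp add: C tscale_sum)
    also have "\<dots> = (\<Sum>l\<in>UNIV. tscale ((B ** C) $ i $ l) (b (idx l)))"
      by (subst sum.swap) (simp add: matrix_matrix_mult_def tscale_sum)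
    also have "\<dots> = b j"
      by (simp add: BC mat_def i if_distrib[of "\<lambda>c. tscale c _"] cong: if_cong)
    finally have "b j = (\<Sum>k\<in>UNIV. tscale (B $ i $ k) (coord_vec V \<psi> x (axis k 1)))" ..
    then show ?thesis by (auto intro!: tv.subspace_sum[OF sub] tv.subspace_scale[OF sub])
  qed
  then show "tangent M x \<subseteq> range (coord_vec V \<psi> x)"
    unfolding is_basis_span[OF bas] by (intro tv.span_minimal[OF _ sub]) auto
qed

lemma ex_idx: "\<exists>idx. bij_betw idx (UNIV :: 'n set) {..<2*m + 1}"
  using cr ex_bij_betw_finite_nat[of "UNIV :: 'n set"] by (auto simp: cr_manifold_def atLeast0LessThan)

lemma corank_frame:
  obtains b where "\<And>i. i < 2*m + 1 \<Longrightarrow> vec_germ M x (\<lambda>y. b y i)"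
    "\<forall>\<^sub>F y in nhds x. is_basis (2*m) (b y) (hdist M y) \<and> is_basis (2*m + 1) (b y) (tangent M y)"
proof -
  obtain U b where U: "x \<in> U" "\<And>i. i \<le> 2*m \<Longrightarrow> vec_field M U (\<lambda>y. b y i)"
     "\<And>y. y \<in> U \<Longrightarrow> is_basis (2*m) (b y) (hdist M y) \<and> is_basis (2*m + 1) (b y) (tangent M y)"
    using cr unfolding cr_manifold_def corank_one_def by blast
  have "open U" using U(2)[of 0] by (auto simp: vec_field_def)
  then show thesis
    using U by (intro that[of b]) (auto simp: vec_germ_def eventually_nhds)
qed

lemma tangent_chart:
  assumes "(V, \<psi>) \<in> charts M" "x \<in> V" "v \<in> tangent M x"
  obtains a where "v = coord_vec V \<psi> x a"
proof -
  obtain b where "\<forall>\<^sub>F y in nhds x. is_basis (2*m) (b y) (hdist M y) \<and> is_basis (2*m + 1) (b y) (tangent M y)"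
    by (rule corank_frame)
  then have "is_basis (2*m + 1) (b x) (tangent M x)" using eventually_nhds_x_imp_x by fastforce
  then show thesis using chart_frame(2)[OF assms(1,2)] ex_idx assms(3) that by blast
qed

text \<open>The axioms of a derivation concern sums and products only; the chain rule for exp is
  borrowed from a chart, in which every tangent vector is a directional derivative.\<close>

lemma tangent_exp:
  assumes "v \<in> tangent M x" "smooth_germ M x h"
  shows "v (\<lambda>y. exp (h y)) = v h * exp (h x)"
proof -
  obtain V \<psi> where V: "(V, \<psi>) \<in> charts M" "x \<in> V" using chart_covers by blast
  obtain a where a: "v = coord_vec V \<psi> x a" by (rule tangent_chart[OF V assms(1)])
  show ?thesis unfolding a
    using coord_vec_eqI[OF smooth_germ_exp[OF assms(2)], unfolded comp_def,
        OF has_derivative_exp[OF coord_vec_has_derivative[OF V assms(2), unfolded comp_def]]]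
      chart_inv[OF V] by simp
qed

text \<open>Coefficients exist pointwise because the frame is a basis. Evaluating both sides on the
  coordinate functions gives a linear system with smooth entries, and Cramer's rule writes the
  coefficients as quotients of smooth determinants.\<close>

lemma smooth_frame:
  obtains b where "\<And>i. i < 2*m + 1 \<Longrightarrow> vec_germ M x (\<lambda>y. b y i)"
    "\<forall>\<^sub>F y in nhds x. is_basis (2*m) (b y) (hdist M y) \<and> is_basis (2*m + 1) (b y) (tangent M y)"
    "\<And>X. vec_germ M x X \<Longrightarrow> \<exists>h. (\<forall>i<2*m + 1. smooth_germ M x (h i)) \<and>
        (\<forall>\<^sub>F y in nhds x. X y = (\<Sum>i<2*m + 1. tscale (h i y) (b y i)))"
proof -
  obtain b where b: "\<And>i. i < 2*m + 1 \<Longrightarrow> vec_germ M x (\<lambda>y. b y i)"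
    and ev: "\<forall>\<^sub>F y in nhds x. is_basis (2*m) (b y) (hdist M y) \<and> is_basis (2*m + 1) (b y) (tangent M y)"
    by (rule corank_frame) blast
  obtain idx where idx: "bij_betw idx (UNIV :: 'n set) {..<2*m + 1}" using ex_idx by blast
  have idx_lt: "idx i < 2*m + 1" for i using idx by (auto simp: bij_betw_def)
  obtain V \<psi> where V: "(V, \<psi>) \<in> charts M" "x \<in> V" using chart_covers by blast
  have "\<exists>h. (\<forall>i<2*m + 1. smooth_germ M x (h i)) \<and>
        (\<forall>\<^sub>F y in nhds x. X y = (\<Sum>i<2*m + 1. tscale (h i y) (b y i)))" if X: "vec_germ M x X" for X
  proof -
    \<comment> \<open>\<open>K y l\<close> is \<open>B y\<close> with column \<open>l\<close>
      replaced by the values of \<open>X\<close> on the coordinates: the numerator in Cramer's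
      rule.\<close>
    define B :: "'p \<Rightarrow> real^'n^'n" where "B y = (\<chi> k i. b y (idx i) (\<lambda>y. \<psi> y $ k))" for y
    define K :: "'p \<Rightarrow> 'n \<Rightarrow> real^'n^'n"
      where "K y l = (\<chi> k i. if i = l then X y (\<lambda>y. \<psi> y $ k) else B y $ k $ i)" for y l
    define h where "h i y = det (K y (inv_into UNIV idx i)) / det (B y)" for i y
    have Bs: "smooth_germ M x (\<lambda>y. B y $ k $ i)" for k i
      unfolding B_def using vec_germ_apply[OF b[OF idx_lt] smooth_chart_coord[OF V]] by simp
    have Ks: "smooth_germ M x (\<lambda>y. K y l $ k $ i)" for l k i
      unfolding K_def by (cases "i = l") (simp_all add: vec_germ_apply[OF X smooth_chart_coord[OF V]] Bs)
    have tr: "transpose (B y) = (\<chi> i k. b y (idx i) (\<lambda>y. \<psi> y $ k))" for y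
      by (simp add: B_def transpose_def)
    have detB: "det (B y) \<noteq> 0" if "y \<in> V" "is_basis (2*m + 1) (b y) (tangent M y)" for y
      using chart_frame(1)[OF V(1) that idx] tr[of y] by (metis det_transpose)
    have "det (B x) \<noteq> 0"
      using eventually_nhds_x_imp_x[OF ev] V by (intro detB) auto
    then have "smooth_germ M x (h i)" for i
      unfolding h_def divide_inverse
      by (intro smooth_germ_mult smooth_germ_inverse smooth_germ_det Bs Ks)
    moreover have "\<forall>\<^sub>F y in nhds x. X y = (\<Sum>i<2*m + 1. tscale (h i y) (b y i))"
      using ev eventually_chart[OF V] vec_germ_eventually[OF X]
    proof eventually_elim
      case (elim y)
      then obtain c where c: "X y = (\<Sum>i<2*m + 1. tscale (c i) (b y i))"
        using is_basis_iff vec_germ_tangent[of y X] by blast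
      have eq0: "B y *v (\<chi> i. c (idx i)) = (\<chi> k. X y (\<lambda>y. \<psi> y $ k))"
        unfolding vec_eq_iff
      proof
        fix k
        have "(B y *v (\<chi> i. c (idx i))) $ k = (\<Sum>i\<in>UNIV. b y (idx i) (\<lambda>y. \<psi> y $ k) * c (idx i))"
          by (simp add: matrix_vector_mult_def B_def)
        also have "\<dots> = (\<Sum>i<2*m + 1. b y i (\<lambda>y. \<psi> y $ k) * c i)"
          by (rule sum.reindex_bij_betw[OF idx, of "\<lambda>i. b y i (\<lambda>y. \<psi> y $ k) * c i"])
        also have "\<dots> = X y (\<lambda>y. \<psi> y $ k)" by (simp add: c tvec_sum_apply mult.commute)
        finally show "(B y *v (\<chi> i. c (idx i))) $ k = (\<chi> k. X y (\<lambda>y. \<psi> y $ k)) $ k" by simp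
      qed
      have eq: "(\<chi> i. c (idx i)) = (\<chi> l. det (K y l) / det (B y))"
      proof -
        have "(\<chi> i j. if j = l then (\<chi> k. X y (\<lambda>y. \<psi> y $ k)) $ i else B y $ i $ j) = K y l" for l
          by (auto simp: K_def vec_eq_iff)
        then show ?thesis using cramer[OF detB, of y] elim eq0 by simp
      qed
      have "c i = h i y" if i: "i < 2*m + 1" for i
      proof -
        have "idx (inv_into UNIV idx i) = i"
          using idx i by (auto simp: bij_betw_def intro!: f_inv_into_f)
        then show ?thesis using arg_cong[OF eq, of "\<lambda>v. v $ inv_into UNIV idx i"] by (simp add: h_def)
      qed
      then show ?case using c by simp
    qed
    ultimately show ?thesis by blast
  qed
  then show thesis using that[of b] b ev by blast
qed

text \<open>Near \<open>x\<close> the difference of the two fields is a combination of frame fields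
  with smooth coefficients that vanish at \<open>x\<close>; linearity over germs evaluates exactly
  these coefficients at \<open>x\<close>.\<close>

lemma tensorial:
  fixes \<Phi> :: "('p \<Rightarrow> 'p tvec) \<Rightarrow> 'b::real_vector"
  assumes add: "\<And>X Y. vec_germ M x X \<Longrightarrow> vec_germ M x Y \<Longrightarrow> \<Phi> (\<lambda>y. X y + Y y) = \<Phi> X + \<Phi> Y"
    and hom: "\<And>h X. smooth_germ M x h \<Longrightarrow> vec_germ M x X \<Longrightarrow> \<Phi> (\<lambda>y. tscale (h y) (X y)) = h x *\<^sub>R \<Phi> X"
    and X: "vec_germ M x X" and Y: "vec_germ M x Y" and eq: "X x = Y x"
  shows "\<Phi> X = \<Phi> Y"
proof -
  obtain b where b: "\<And>i. i < 2*m + 1 \<Longrightarrow> vec_germ M x (\<lambda>y. b y i)"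
    and ev: "\<forall>\<^sub>F y in nhds x. is_basis (2*m) (b y) (hdist M y) \<and> is_basis (2*m + 1) (b y) (tangent M y)"
    and fr: "\<And>X. vec_germ M x X \<Longrightarrow> \<exists>h. (\<forall>i<2*m + 1. smooth_germ M x (h i)) \<and>
        (\<forall>\<^sub>F y in nhds x. X y = (\<Sum>i<2*m + 1. tscale (h i y) (b y i)))"
    by (rule smooth_frame) blast
  have bas: "is_basis (2*m + 1) (b x) (tangent M x)" using eventually_nhds_x_imp_x[OF ev] by blast
  obtain h where h: "\<And>i. i < 2*m + 1 \<Longrightarrow> smooth_germ M x (h i)"
    and Xh: "\<forall>\<^sub>F y in nhds x. X y - Y y = (\<Sum>i<2*m + 1. tscale (h i y) (b y i))"
    using fr[OF vec_germ_diff[OF X Y]] by blast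
  define F where "F c = (\<Sum>i<2*m + 1. tscale (c i) (b x i))" for c :: "nat \<Rightarrow> real"
  have F: "F (restrict c {..<2*m + 1}) = F c" for c
    unfolding F_def by (rule sum.cong) simp_all
  have "F (\<lambda>i. h i x) = F (\<lambda>i. 0)"
    using eventually_nhds_x_imp_x[OF Xh] eq unfolding F_def by simp
  then have *: "F (restrict (\<lambda>i. h i x) {..<2*m + 1}) = F (restrict (\<lambda>i. 0) {..<2*m + 1})"
    unfolding F .
  have "inj_on F ({..<2*m + 1} \<rightarrow>\<^sub>E UNIV)"
    using bas unfolding F_def[abs_def] is_basis_def bij_betw_def by blast
  then have "restrict (\<lambda>i. h i x) {..<2*m + 1} = restrict (\<lambda>i. 0) {..<2*m + 1}"
    using * unfolding inj_on_def by (simp add: restrict_PiE_iff)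
  then have h0: "h i x = 0" if "i < 2*m + 1" for i
    using that by (metis lessThan_iff restrict_apply')
  have zero: "\<Phi> (\<lambda>y. 0) = 0" using hom[OF smooth_germ_const vec_germ_zero, of 0] by simp
  have sum: "\<Phi> (\<lambda>y. \<Sum>i\<in>I. tscale (h i y) (b y i)) = 0" if "finite I" "I \<subseteq> {..<2*m + 1}" for I
    using that
  proof (induction I rule: finite_induct)
    case (insert i I)
    have "\<Phi> (\<lambda>y. \<Sum>j\<in>insert i I. tscale (h j y) (b y j)) =
        \<Phi> (\<lambda>y. tscale (h i y) (b y i)) + \<Phi> (\<lambda>y. \<Sum>j\<in>I. tscale (h j y) (b y j))"
      using insert by (subst add[symmetric]) (auto intro!: vec_germ_sum vec_germ_scale b h)
    then show ?case using insert hom[OF h b, of i i] h0[of i] by (simp del: tscale_simps(5) plus_fun_apply)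
  qed (simp add: zero)
  have "\<Phi> (\<lambda>y. X y - Y y) = \<Phi> (\<lambda>y. \<Sum>i<2*m + 1. tscale (h i y) (b y i))"
    by (rule germ_functional_cong[where \<Phi> = \<Phi> and x = x, OF _ vec_germ_diff[OF X Y] Xh]) (rule hom)
  also have "\<dots> = 0" by (rule sum) auto
  finally have "\<Phi> (\<lambda>y. X y - Y y) = 0" .
  moreover have "\<Phi> X = \<Phi> (\<lambda>y. X y - Y y) + \<Phi> Y"
    using add[OF vec_germ_diff[OF X Y] Y] by simp
  ultimately show ?thesis by simp
qed

lemma hdist_span:
  obtains b where "hdist M x = tv.span (b ` {..<2*m})" "tangent M x = tv.span (b ` {..<2*m + 1})"
proof -
  obtain b where "\<forall>\<^sub>F y in nhds x. is_basis (2*m) (b y) (hdist M y) \<and> is_basis (2*m + 1) (b y) (tangent M y)"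
    by (rule corank_frame)
  from eventually_nhds_x_imp_x[OF this] show thesis using that[of "b x"] is_basis_span by blast
qed

lemma hdist_tangent: "v \<in> hdist M x \<Longrightarrow> v \<in> tangent M x"
proof -
  obtain b where "hdist M x = tv.span (b ` {..<2*m})" "tangent M x = tv.span (b ` {..<2*m + 1})"
    by (rule hdist_span)
  moreover have "b ` {..<2*m} \<subseteq> b ` {..<2*m + 1}" by auto
  ultimately show "v \<in> hdist M x \<Longrightarrow> v \<in> tangent M x" using tv.span_mono by blast
qed

lemma hdist_subspace: "tv.subspace (hdist M x)"
  by (metis hdist_span tv.subspace_span)

lemma hdist_closed:
  "0 \<in> hdist M x"
  "v \<in> hdist M x \<Longrightarrow> w \<in> hdist M x \<Longrightarrow> v + w \<in> hdist M x"
  "v \<in> hdist M x \<Longrightarrow> w \<in> hdist M x \<Longrightarrow> v - w \<in> hdist M x"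
  "v \<in> hdist M x \<Longrightarrow> tscale c v \<in> hdist M x"
  "v \<in> hdist M x \<Longrightarrow> - v \<in> hdist M x"
  "(\<And>i. i \<in> I \<Longrightarrow> u i \<in> hdist M x) \<Longrightarrow> sum u I \<in> hdist M x"
  using hdist_subspace[of x]
  by (simp_all add: tv.subspace_0 tv.subspace_add tv.subspace_diff tv.subspace_scale tv.subspace_neg
    tv.subspace_sum)

lemma ex_vec_germ:
  assumes "v \<in> tangent M x"
  shows "\<exists>X. vec_germ M x X \<and> X x = v"
proof -
  obtain b where b: "\<And>i. i < 2*m + 1 \<Longrightarrow> vec_germ M x (\<lambda>y. b y i)"
    and ev: "\<forall>\<^sub>F y in nhds x. is_basis (2*m) (b y) (hdist M y) \<and> is_basis (2*m + 1) (b y) (tangent M y)"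
    by (rule corank_frame) blast
  obtain c where "v = (\<Sum>i<2*m + 1. tscale (c i) (b x i))"
    using eventually_nhds_x_imp_x[OF ev] is_basis_iff assms by blast
  then show ?thesis
    by (intro exI[of _ "\<lambda>y. \<Sum>i<2*m + 1. tscale (c i) (b y i)"] conjI vec_germ_sum vec_germ_scale
        smooth_germ_const b) simp_all
qed

lemma ex_hor_germ:
  assumes "v \<in> hdist M x"
  shows "\<exists>X. hor_germ M x X \<and> X x = v"
proof -
  obtain b where b: "\<And>i. i < 2*m + 1 \<Longrightarrow> vec_germ M x (\<lambda>y. b y i)"
    and ev: "\<forall>\<^sub>F y in nhds x. is_basis (2*m) (b y) (hdist M y) \<and> is_basis (2*m + 1) (b y) (tangent M y)"
    by (rule corank_frame) blast
  obtain c where c: "v = (\<Sum>i<2*m. tscale (c i) (b x i))"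
    using eventually_nhds_x_imp_x[OF ev] is_basis_iff assms by blast
  have "\<forall>\<^sub>F y in nhds x. (\<Sum>i<2*m. tscale (c i) (b y i)) \<in> hdist M y"
    using ev by eventually_elim (use is_basis_iff in blast)
  moreover have "vec_germ M x (\<lambda>y. \<Sum>i<2*m. tscale (c i) (b y i))"
    by (intro vec_germ_sum vec_germ_scale b smooth_germ_const) simp
  ultimately show ?thesis using c
    by (intro exI[of _ "\<lambda>y. \<Sum>i<2*m. tscale (c i) (b y i)"]) (simp add: hor_germ_iff)
qed

lemma extension:
  assumes "v \<in> tangent M x"
  shows "vec_germ M x (extension M x v)" "extension M x v x = v"
  using someI_ex[OF ex_vec_germ[OF assms]] unfolding extension_def by blast+

end


section \<open>Lie brackets\<close>

text \<open>These rules would rewrite tangent vectors, which are functions, to lambda abstractions.\<close>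

declare zero_fun_apply [simp del] plus_fun_apply [simp del] tscale_simps(5) [simp del]

context cr_mfd
begin

lemma lie_apply: "smooth_germ M x h \<Longrightarrow> lie M X Y x h = X x (\<lambda>y. Y y h) - Y x (\<lambda>y. X y h)"
  by (simp add: lie_def)

lemma lie_eqI:
  assumes "v \<in> tangent M x"
    and "\<And>h. smooth_germ M x h \<Longrightarrow> X x (\<lambda>y. Y y h) - Y x (\<lambda>y. X y h) = v h"
  shows "lie M X Y x = v"
  by (rule ext) (simp add: lie_def assms tangentD(4)[OF assms(1)])

lemma vec_germ_comp_add:
  assumes "vec_germ M x X" "vec_germ M x Y" "smooth_germ M x g" "smooth_germ M x h"
  shows "X x (\<lambda>y. Y y (\<lambda>z. g z + h z)) = X x (\<lambda>y. Y y g) + X x (\<lambda>y. Y y h)"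
proof -
  have "\<forall>\<^sub>F y in nhds x. Y y (\<lambda>z. g z + h z) = Y y g + Y y h"
    using vec_germ_eventually[OF assms(2)] smooth_germ_eventually[OF assms(3)] smooth_germ_eventually[OF assms(4)]
    by eventually_elim (rule tangentD(1)[OF vec_germ_tangent])
  from tangent_cong[OF vec_germ_tangent[OF assms(1)] this] show ?thesis
    by (simp add: tangentD(1)[OF vec_germ_tangent[OF assms(1)]] vec_germ_apply[OF assms(2)] assms(3,4))
qed

lemma vec_germ_comp_scale:
  assumes "vec_germ M x X" "vec_germ M x Y" "smooth_germ M x h"
  shows "X x (\<lambda>y. Y y (\<lambda>z. c * h z)) = c * X x (\<lambda>y. Y y h)"
proof -
  have "\<forall>\<^sub>F y in nhds x. Y y (\<lambda>z. c * h z) = c * Y y h"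
    using vec_germ_eventually[OF assms(2)] smooth_germ_eventually[OF assms(3)]
    by eventually_elim (rule tangentD(3)[OF vec_germ_tangent])
  from tangent_cong[OF vec_germ_tangent[OF assms(1)] this] show ?thesis
    by (simp add: tangentD(3)[OF vec_germ_tangent[OF assms(1)]] vec_germ_apply[OF assms(2)] assms(3))
qed

text \<open>The two middle terms are symmetric in \<open>X\<close> and \<open>Y\<close>, so they
  cancel in the commutator; this is why the bracket obeys the Leibniz rule.\<close>

lemma vec_germ_comp_mult:
  assumes "vec_germ M x X" "vec_germ M x Y" "smooth_germ M x g" "smooth_germ M x h"
  shows "X x (\<lambda>y. Y y (\<lambda>z. g z * h z)) =
    X x (\<lambda>y. Y y g) * h x + Y x g * X x h + X x g * Y x h + g x * X x (\<lambda>y. Y y h)"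
proof -
  have "\<forall>\<^sub>F y in nhds x. Y y (\<lambda>z. g z * h z) = Y y g * h y + g y * Y y h"
    using vec_germ_eventually[OF assms(2)] smooth_germ_eventually[OF assms(3)] smooth_germ_eventually[OF assms(4)]
    by eventually_elim (rule tangentD(2)[OF vec_germ_tangent])
  from tangent_cong[OF vec_germ_tangent[OF assms(1)] this] show ?thesis
    by (simp add: tangentD(1,2)[OF vec_germ_tangent[OF assms(1)]] vec_germ_apply[OF assms(2)] smooth_germ_mult
        assms(3,4))
qed

lemma lie_tangent:
  assumes "vec_germ M x X" "vec_germ M x Y"
  shows "lie M X Y x \<in> tangent M x"
  by (rule tangentI)
    (simp_all add: lie_apply smooth_germ_add smooth_germ_mult vec_germ_comp_add[OF assms]
      vec_germ_comp_add[OF assms(2,1)] vec_germ_comp_scale[OF assms] vec_germ_comp_scale[OF assms(2,1)]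
      vec_germ_comp_mult[OF assms] vec_germ_comp_mult[OF assms(2,1)] lie_def[of M X Y x] algebra_simps)

lemma vec_germ_lie:
  assumes "vec_germ M x X" "vec_germ M x Y"
  shows "vec_germ M x (lie M X Y)"
proof -
  obtain U W where U: "x \<in> U" "vec_field M U X" and W: "x \<in> W" "vec_field M W Y"
    using assms by (auto simp: vec_germ_def)
  have "vec_field M (U \<inter> W) (lie M X Y)"
    unfolding vec_field_def
  proof (intro conjI ballI allI impI)
    show "open (U \<inter> W)" using U W by (auto simp: vec_field_def)
    show "lie M X Y y \<in> tangent M y" if "y \<in> U \<inter> W" for y
      using that U W by (intro lie_tangent) (auto simp: vec_germ_def)
    show "smooth_fun M V (\<lambda>y. lie M X Y y h)" if "V \<subseteq> U \<inter> W \<and> smooth_fun M V h" for V and h :: "'p \<Rightarrow> real"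
    proof (rule smooth_fun_cong)
      have s: "smooth_fun M V (\<lambda>y. X y (\<lambda>y. Y y h))" "smooth_fun M V (\<lambda>y. Y y (\<lambda>y. X y h))"
        using that U W unfolding vec_field_def by (metis le_inf_iff)+
      show "smooth_fun M V (\<lambda>y. X y (\<lambda>y. Y y h) + (-1) * Y y (\<lambda>y. X y h))"
        by (intro smooth_fun_add s smooth_fun_bilinear[OF bounded_bilinear_mult] smooth_fun_const
            smooth_fun_open[OF s(1)])
      show "X y (\<lambda>y. Y y h) + (-1) * Y y (\<lambda>y. X y h) = lie M X Y y h" if "y \<in> V" for y
        using lie_apply[OF smooth_germ_fun[OF _ that], of h X Y] \<open>V \<subseteq> U \<inter> W \<and> smooth_fun M V h\<close> by simp
    qed
  qed
  with U(1) W(1) show ?thesis unfolding vec_germ_def by (intro exI[of _ "U \<inter> W"] conjI IntI)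
qed

lemma lie_add_left:
  assumes "vec_germ M x X" "vec_germ M x X'" "vec_germ M x Y"
  shows "lie M (\<lambda>y. X y + X' y) Y x = lie M X Y x + lie M X' Y x"
  by (rule lie_eqI)
    (simp_all add: plus_fun_apply tscale_simps(5) tangent_closed lie_tangent assms lie_apply tangentD(1)[OF vec_germ_tangent[OF assms(3)]]
      vec_germ_apply[OF assms(1)] vec_germ_apply[OF assms(2)])

lemma lie_scale_left:
  assumes "smooth_germ M x k" "vec_germ M x X" "vec_germ M x Y"
  shows "lie M (\<lambda>y. tscale (k y) (X y)) Y x = tscale (k x) (lie M X Y x) - tscale (Y x k) (X x)"
  by (rule lie_eqI)
    (simp_all add: plus_fun_apply tscale_simps(5) tangent_closed lie_tangent assms lie_apply vec_germ_tangent
      tangentD(2)[OF vec_germ_tangent[OF assms(3)]] vec_germ_apply[OF assms(2)] algebra_simps)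

lemma lie_swap: "lie M Y X x = - lie M X Y x"
  by (rule ext) (simp add: lie_def)

section \<open>Horizontal germs and the complex structure\<close>

lemma almost_complexD:
  assumes "v \<in> hdist M x"
  shows "cplx M x v \<in> hdist M x" "cplx M x (cplx M x v) = - v"
    "cplx M x (tscale c v) = tscale c (cplx M x v)"
    "w \<in> hdist M x \<Longrightarrow> cplx M x (v + w) = cplx M x v + cplx M x w"
  using cr assms unfolding cr_manifold_def almost_complex_def by blast+

lemma cplx_minus: "v \<in> hdist M x \<Longrightarrow> cplx M x (- v) = - cplx M x v"
  using almost_complexD(3)[of v x "-1"] by (simp add: tscale_minus)

lemma hor_germ_J: "hor_germ M x X \<Longrightarrow> hor_germ M x (apply_J M X)"
  using cr unfolding cr_manifold_def almost_complex_def by blast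

lemma hor_germ_vec: "hor_germ M x X \<Longrightarrow> vec_germ M x X"
  by (simp add: hor_germ_iff)

lemma hor_germ_hdist: "hor_germ M x X \<Longrightarrow> X x \<in> hdist M x"
  by (auto simp: hor_germ_def)

lemma hor_germ_eventually: "hor_germ M x X \<Longrightarrow> \<forall>\<^sub>F y in nhds x. hor_germ M y X"
  by (auto simp: hor_germ_def vec_field_def eventually_nhds)

lemma hor_germ_scale: "smooth_germ M x h \<Longrightarrow> hor_germ M x X \<Longrightarrow> hor_germ M x (\<lambda>y. tscale (h y) (X y))"
  unfolding hor_germ_iff by (auto intro: vec_germ_scale hdist_closed elim: eventually_mono)

lemma levi_compatible:
  assumes "hor_germ M x X" "hor_germ M x Y"
  shows "- lie M (apply_J M X) Y x - lie M X (apply_J M Y) x \<in> hdist M x"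
  using cr assms unfolding cr_manifold_def strictly_pseudoconvex_def by blast

text \<open>The last vector of the adapted frame works: a horizontal expansion would be its second
  expansion in the basis of the tangent space.\<close>

lemma tangent_not_horizontal:
  obtains W where "vec_germ M x W" "W x \<notin> hdist M x"
proof -
  obtain b where b: "\<And>i. i < 2*m + 1 \<Longrightarrow> vec_germ M x (\<lambda>y. b y i)"
    and ev: "\<forall>\<^sub>F y in nhds x. is_basis (2*m) (b y) (hdist M y) \<and> is_basis (2*m + 1) (b y) (tangent M y)"
    by (rule corank_frame) blast
  have bas: "is_basis (2*m) (b x) (hdist M x)" "is_basis (2*m + 1) (b x) (tangent M x)"
    using eventually_nhds_x_imp_x[OF ev] by auto
  have "b x (2*m) \<notin> hdist M x"
  proof
    assume "b x (2*m) \<in> hdist M x"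
    then obtain c where c: "b x (2*m) = (\<Sum>i<2*m. tscale (c i) (b x i))"
      using is_basis_iff[OF bas(1)] by blast
    define F where "F c = (\<Sum>i<2*m + 1. tscale (c i) (b x i))" for c :: "nat \<Rightarrow> real"
    have F: "F (restrict c {..<2*m + 1}) = F c" for c
      unfolding F_def by (rule sum.cong) simp_all
    have "(\<Sum>i<2*m. tscale (if i = 2*m then 1 else 0) (b x i)) = 0" by (intro sum.neutral) auto
    then have "F (\<lambda>i. if i = 2*m then 1 else 0) = b x (2*m)" by (simp add: F_def)
    also have "\<dots> = F (\<lambda>i. if i < 2*m then c i else 0)" by (simp add: F_def c)
    finally have "F (restrict (\<lambda>i. if i = 2*m then 1 else 0) {..<2*m + 1}) =
        F (restrict (\<lambda>i. if i < 2*m then c i else 0) {..<2*m + 1})" unfolding F .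
    moreover have "inj_on F ({..<2*m + 1} \<rightarrow>\<^sub>E UNIV)"
      using bas(2) unfolding F_def[abs_def] is_basis_def bij_betw_def by blast
    ultimately have "restrict (\<lambda>i. if i = 2*m then 1 else 0) {..<2*m + 1} =
        restrict (\<lambda>i. if i < 2*m then c i else 0) {..<2*m + 1}"
      unfolding inj_on_def by (simp add: restrict_PiE_iff)
    from fun_cong[OF this, of "2*m"] show False by simp
  qed
  then show thesis using b[of "2*m"] that by auto
qed

end


section \<open>Pseudo-Hermitian structures\<close>

lemma sum_even_odd: "(\<Sum>i<2*(n::nat). F i) = (\<Sum>k<n. F (2*k) + F (2*k + 1))"
  for F :: "nat \<Rightarrow> 'b::comm_monoid_add"
  by (induction n) (simp_all add: ac_simps)

text \<open>Smooth orthonormal frames are assumed because a spin^c structure provides them through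
  its local sections, and rescaling provides them for the second form. They stand in for a smooth
  Gram-Schmidt process and make the Reeb field smooth.\<close>

locale ph_mfd = cr_mfd M m
  for M :: "('p::{t2_space, second_countable_topology}, 'n::finite) cr_struct" and m :: nat +
  fixes \<theta> :: "'p \<Rightarrow> 'p tvec \<Rightarrow> real"
  assumes ph: "pseudo_hermitian M \<theta>"
    and ex_frame: "\<And>x. \<exists>s. (\<forall>k<2*m. hor_germ M x (\<lambda>y. s y k)) \<and>
        (\<forall>\<^sub>F y in nhds x. orthonormal (2*m) M \<theta> y (s y))"
begin

abbreviation "d \<equiv> ext_deriv M \<theta>"
abbreviation "g \<equiv> metric M \<theta>"
abbreviation "J \<equiv> cplx M"
abbreviation "T \<equiv> reeb M \<theta>"

lemma theta_smooth:
  assumes "vec_germ M x X"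
  shows "smooth_germ M x (\<lambda>y. \<theta> y (X y))"
proof -
  have "\<forall>U X. vec_field M U X \<longrightarrow> smooth_fun M U (\<lambda>y. \<theta> y (X y))"
    using ph unfolding pseudo_hermitian_def one_form_def by (elim conjE)
  then show ?thesis using assms unfolding vec_germ_def smooth_germ_def by auto
qed

lemma theta_lin:
  assumes "v \<in> tangent M x"
  shows "w \<in> tangent M x \<Longrightarrow> \<theta> x (v + w) = \<theta> x v + \<theta> x w"
    "\<theta> x (tscale c v) = c * \<theta> x v" "\<theta> x (- v) = - \<theta> x v"
    "w \<in> tangent M x \<Longrightarrow> \<theta> x (v - w) = \<theta> x v - \<theta> x w"
proof -
  have 1: "\<forall>v\<in>tangent M x. (\<forall>w\<in>tangent M x. \<theta> x (v + w) = \<theta> x v + \<theta> x w) \<and> (\<forall>c. \<theta> x (tscale c v) = c * \<theta> x v)"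
    using ph unfolding pseudo_hermitian_def one_form_def by (elim conjE allE[of _ x]) assumption
  then show a: "w \<in> tangent M x \<Longrightarrow> \<theta> x (v + w) = \<theta> x v + \<theta> x w" and b: "\<theta> x (tscale c v) = c * \<theta> x v"
    for c w using assms by blast+
  have m: "tscale (-1) w = - w" for w :: "'p tvec" by (simp add: tscale_minus)
  show c: "\<theta> x (- v) = - \<theta> x v" using b[of "-1"] m by simp
  show "w \<in> tangent M x \<Longrightarrow> \<theta> x (v - w) = \<theta> x v - \<theta> x w"
    using a[of "- w"] 1 tangent_closed(5) m by (metis add_uminus_conv_diff mult_minus1)
qed

lemma theta_hdist_iff: "v \<in> tangent M x \<Longrightarrow> \<theta> x v = 0 \<longleftrightarrow> v \<in> hdist M x"
  using ph unfolding pseudo_hermitian_def by blast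

lemma theta_hdist: "v \<in> hdist M x \<Longrightarrow> \<theta> x v = 0"
  using theta_hdist_iff hdist_tangent by blast

text \<open>The exterior derivative on given fields, free of the choice made inside
  \<open>ext_deriv\<close>; \<open>ext_deriv_germ\<close> identifies the two.\<close>

definition dgerm :: "'p \<Rightarrow> ('p \<Rightarrow> 'p tvec) \<Rightarrow> ('p \<Rightarrow> 'p tvec) \<Rightarrow> real" where
  "dgerm x X Y = X x (\<lambda>y. \<theta> y (Y y)) - Y x (\<lambda>y. \<theta> y (X y)) - \<theta> x (lie M X Y x)"

lemma dgerm_swap:
  assumes "vec_germ M x X" "vec_germ M x Y"
  shows "dgerm x Y X = - dgerm x X Y"
  using theta_lin(3)[OF lie_tangent[OF assms]] lie_swap[of X Y x] by (simp add: dgerm_def)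

lemma dgerm_add:
  assumes "vec_germ M x X" "vec_germ M x X'" "vec_germ M x Y"
  shows "dgerm x (\<lambda>y. X y + X' y) Y = dgerm x X Y + dgerm x X' Y"
proof -
  have "\<forall>\<^sub>F y in nhds x. \<theta> y (X y + X' y) = \<theta> y (X y) + \<theta> y (X' y)"
    using vec_germ_eventually[OF assms(1)] vec_germ_eventually[OF assms(2)]
    by eventually_elim (simp add: theta_lin vec_germ_tangent)
  from tangent_cong[OF vec_germ_tangent[OF assms(3)] this] show ?thesis
    by (simp add: plus_fun_apply tscale_simps(5) dgerm_def lie_add_left assms theta_lin lie_tangent tangentD(1)[OF vec_germ_tangent[OF assms(3)]] theta_smooth)
qed

lemma dgerm_scale:
  assumes "smooth_germ M x h" "vec_germ M x X" "vec_germ M x Y"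
  shows "dgerm x (\<lambda>y. tscale (h y) (X y)) Y = h x * dgerm x X Y"
proof -
  have "\<forall>\<^sub>F y in nhds x. \<theta> y (tscale (h y) (X y)) = h y * \<theta> y (X y)"
    using vec_germ_eventually[OF assms(2)]
    by eventually_elim (simp add: theta_lin vec_germ_tangent)
  from tangent_cong[OF vec_germ_tangent[OF assms(3)] this] show ?thesis
    by (simp add: plus_fun_apply tscale_simps(5) dgerm_def lie_scale_left assms theta_lin lie_tangent tangentD(2)[OF vec_germ_tangent[OF assms(3)]]
        vec_germ_tangent tangent_closed theta_smooth algebra_simps)
qed

text \<open>\<open>tensorial\<close> treats the first slot, skewness carries the result to the
  second. This is what makes the choice in \<open>extension\<close> harmless.\<close>

lemma dgerm_cong:
  assumes "vec_germ M x X" "vec_germ M x X'" "vec_germ M x Y" "vec_germ M x Y'" "X x = X' x" "Y x = Y' x"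
  shows "dgerm x X Y = dgerm x X' Y'"
proof -
  have *: "dgerm x X Y = dgerm x X' Y" if "vec_germ M x X" "vec_germ M x X'" "vec_germ M x Y" "X x = X' x"
    for X X' Y
    by (rule tensorial[of x "\<lambda>X. dgerm x X Y"]) (use that in \<open>simp_all add: dgerm_add dgerm_scale\<close>)
  show ?thesis
    using *[OF assms(1-3,5)] *[OF assms(3,4,2,6)] dgerm_swap[OF assms(2,3)] dgerm_swap[OF assms(2,4)] by simp
qed

lemma ext_deriv_germ:
  assumes "vec_germ M x X" "vec_germ M x Y"
  shows "d x (X x) (Y x) = dgerm x X Y"
proof -
  note e = extension[OF vec_germ_tangent[OF assms(1)]] extension[OF vec_germ_tangent[OF assms(2)]]
  show ?thesis
    using dgerm_cong[OF e(1) assms(1) e(3) assms(2) e(2,4)] e(2,4)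
    by (simp add: ext_deriv_def dgerm_def Let_def)
qed

lemma d_swap:
  assumes "u \<in> tangent M x" "v \<in> tangent M x"
  shows "d x v u = - d x u v"
proof -
  obtain X Y where XY: "vec_germ M x X" "X x = u" "vec_germ M x Y" "Y x = v"
    using ex_vec_germ assms by meson
  show ?thesis using ext_deriv_germ[OF XY(1,3)] ext_deriv_germ[OF XY(3,1)] dgerm_swap[OF XY(1,3)] XY by simp
qed

lemma d_add:
  assumes "u \<in> tangent M x" "v \<in> tangent M x" "w \<in> tangent M x"
  shows "d x (u + v) w = d x u w + d x v w" "d x w (u + v) = d x w u + d x w v"
proof -
  obtain X Y Z where XY: "vec_germ M x X" "X x = u" "vec_germ M x Y" "Y x = v" "vec_germ M x Z" "Z x = w"
    using ex_vec_germ assms by meson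
  show 1: "d x (u + v) w = d x u w + d x v w"
    using ext_deriv_germ[OF vec_germ_add[OF XY(1,3)] XY(5)] ext_deriv_germ[OF XY(1,5)]
        ext_deriv_germ[OF XY(3,5)] dgerm_add[OF XY(1,3,5)] XY by simp
  show "d x w (u + v) = d x w u + d x w v"
    using 1 d_swap[of _ x w] assms by (simp add: tangent_closed)
qed

lemma d_scale:
  assumes "u \<in> tangent M x" "w \<in> tangent M x"
  shows "d x (tscale c u) w = c * d x u w" "d x w (tscale c u) = c * d x w u"
proof -
  obtain X Z where XY: "vec_germ M x X" "X x = u" "vec_germ M x Z" "Z x = w"
    using ex_vec_germ assms by meson
  show 1: "d x (tscale c u) w = c * d x u w"
    using ext_deriv_germ[OF vec_germ_scale[OF smooth_germ_const[of _ c] XY(1)] XY(3)]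
        ext_deriv_germ[OF XY(1,3)] dgerm_scale[OF smooth_germ_const[of _ c] XY(1,3)] XY by simp
  show "d x w (tscale c u) = c * d x w u"
    using 1 d_swap[of _ x w] assms by (simp add: tangent_closed)
qed

lemma d_minus:
  assumes "u \<in> tangent M x" "w \<in> tangent M x"
  shows "d x (- u) w = - d x u w" "d x w (- u) = - d x w u"
  using d_scale[OF assms, of "-1"] by (simp_all add: tscale_minus)

lemma d_smooth:
  assumes "vec_germ M x X" "vec_germ M x Y"
  shows "smooth_germ M x (\<lambda>y. d y (X y) (Y y))"
proof (rule smooth_germ_cong)
  show "smooth_germ M x (\<lambda>y. X y (\<lambda>y. \<theta> y (Y y)) - Y y (\<lambda>y. \<theta> y (X y)) - \<theta> y (lie M X Y y))"
    by (intro smooth_germ_diff vec_germ_apply[OF assms(1)] vec_germ_apply[OF assms(2)] theta_smooth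
        vec_germ_lie assms)
  show "\<forall>\<^sub>F y in nhds x. X y (\<lambda>y. \<theta> y (Y y)) - Y y (\<lambda>y. \<theta> y (X y)) - \<theta> y (lie M X Y y) = d y (X y) (Y y)"
    using vec_germ_eventually[OF assms(1)] vec_germ_eventually[OF assms(2)]
    by eventually_elim (simp add: ext_deriv_germ dgerm_def)
qed

text \<open>On horizontal fields \<theta> vanishes in a whole neighbourhood, so both derivative
  terms drop out and the bracket term remains.\<close>

lemma dgerm_hor:
  assumes "hor_germ M x X" "hor_germ M x Y"
  shows "d x (X x) (Y x) = - \<theta> x (lie M X Y x)"
proof -
  have z: "v (\<lambda>y. \<theta> y (X y)) = 0" if "v \<in> tangent M x" "hor_germ M x X" for v X
  proof -
    have "\<forall>\<^sub>F y in nhds x. \<theta> y (X y) = 0"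
      using hor_germ_eventually[OF that(2)] by eventually_elim (simp add: theta_hdist hor_germ_hdist)
    from tangent_cong[OF that(1) this] show ?thesis using tangent_const[OF that(1)] by simp
  qed
  show ?thesis
    unfolding ext_deriv_germ[OF hor_germ_vec[OF assms(1)] hor_germ_vec[OF assms(2)]] dgerm_def
    by (simp add: z assms vec_germ_tangent hor_germ_vec)
qed

text \<open>This is \<theta> applied to the compatibility of the bracket with J, with brackets
  turned into values of d\<theta> by \<open>dgerm_hor\<close>. Together with skewness of d\<theta>
  it makes the metric symmetric and J-invariant.\<close>

lemma d_J:
  assumes "v \<in> hdist M x" "w \<in> hdist M x"
  shows "d x (J x v) w = - d x v (J x w)"
proof -
  obtain X Y where X: "hor_germ M x X" "X x = v" and Y: "hor_germ M x Y" "Y x = w"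
    using ex_hor_germ assms by meson
  note l = lie_tangent[OF hor_germ_vec[OF hor_germ_J[OF X(1)]] hor_germ_vec[OF Y(1)]]
    lie_tangent[OF hor_germ_vec[OF X(1)] hor_germ_vec[OF hor_germ_J[OF Y(1)]]]
  have "\<theta> x (- lie M (apply_J M X) Y x - lie M X (apply_J M Y) x) = 0"
    using levi_compatible[OF X(1) Y(1)] by (rule theta_hdist)
  moreover have "\<theta> x (- lie M (apply_J M X) Y x - lie M X (apply_J M Y) x) =
      - \<theta> x (lie M (apply_J M X) Y x) - \<theta> x (lie M X (apply_J M Y) x)"
    using theta_lin(4)[OF tangent_closed(5)[OF l(1)] l(2)] theta_lin(3)[OF l(1)] by simp
  ultimately show ?thesis
    using dgerm_hor[OF hor_germ_J[OF X(1)] Y(1)] dgerm_hor[OF X(1) hor_germ_J[OF Y(1)]] X Y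
    by (simp add: apply_J_def)
qed

lemma J_hdist: "v \<in> hdist M x \<Longrightarrow> J x v \<in> hdist M x"
  and J_J: "v \<in> hdist M x \<Longrightarrow> J x (J x v) = - v"
  by (simp_all add: almost_complexD)

lemma d_g:
  assumes "u \<in> hdist M x" "v \<in> hdist M x"
  shows "d x u v = 2 * g x (J x u) v"
  using d_J[OF assms(1) J_hdist[OF assms(2)]] assms
  by (simp add: metric_def d_minus hdist_tangent J_J)

lemma g_J_left:
  assumes "u \<in> hdist M x" "v \<in> hdist M x"
  shows "g x (J x u) v = - g x u (J x v)"
  using d_J[OF assms(1) J_hdist[OF assms(2)]] by (simp add: metric_def)

lemma g_add:
  assumes "u \<in> hdist M x" "v \<in> hdist M x" "w \<in> hdist M x"
  shows "g x (u + v) w = g x u w + g x v w" "g x w (u + v) = g x w u + g x w v"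
  using assms by (simp_all add: metric_def almost_complexD d_add hdist_tangent J_hdist algebra_simps)

lemma g_scale:
  assumes "u \<in> hdist M x" "w \<in> hdist M x"
  shows "g x (tscale c u) w = c * g x u w" "g x w (tscale c u) = c * g x w u"
  using assms by (simp_all add: metric_def almost_complexD d_scale hdist_tangent J_hdist)

lemma g_minus:
  assumes "u \<in> hdist M x" "w \<in> hdist M x"
  shows "g x (- u) w = - g x u w" "g x w (- u) = - g x w u"
  using assms by (simp_all add: metric_def cplx_minus d_minus hdist_tangent J_hdist)

lemma g_diff:
  assumes "u \<in> hdist M x" "v \<in> hdist M x" "w \<in> hdist M x"
  shows "g x (u - v) w = g x u w - g x v w" "g x w (u - v) = g x w u - g x w v"
  using g_add[of u x "- v" w] g_minus[of v x w] assms by (simp_all add: hdist_closed)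

lemma g_sym:
  assumes "u \<in> hdist M x" "v \<in> hdist M x"
  shows "g x u v = g x v u"
  using d_J[OF assms] d_swap[of "J x u" x v] assms by (simp add: metric_def hdist_tangent J_hdist)

lemma g_JJ:
  assumes "u \<in> hdist M x" "v \<in> hdist M x"
  shows "g x (J x u) (J x v) = g x u v"
  using g_J_left[OF assms(1) J_hdist[OF assms(2)]] assms by (simp add: J_J g_minus)

lemma g_J_self:
  assumes "u \<in> hdist M x"
  shows "g x u (J x u) = 0" "g x (J x u) u = 0"
  using g_sym[OF assms J_hdist[OF assms]] g_J_left[OF assms assms] by simp_all

lemma g_zero: "v \<in> hdist M x \<Longrightarrow> g x 0 v = 0"
  using g_scale(1)[of 0 x v 0] by (simp add: hdist_closed)

lemma g_sum:
  assumes "\<And>i. i \<in> I \<Longrightarrow> u i \<in> hdist M x" "v \<in> hdist M x"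
  shows "g x (sum u I) v = (\<Sum>i\<in>I. g x (u i) v)"
  using assms(1)
  by (induction I rule: infinite_finite_induct)
    (simp_all add: g_zero g_add hdist_closed assms(2))

lemma g_pos: "v \<in> hdist M x \<Longrightarrow> v \<noteq> 0 \<Longrightarrow> g x v v > 0"
  using ph by (auto simp: pseudo_hermitian_def)

lemma g_smooth:
  assumes "hor_germ M x X" "hor_germ M x Y"
  shows "smooth_germ M x (\<lambda>y. g y (X y) (Y y))"
  using smooth_germ_mult[OF smooth_germ_const[of x "1/2"] d_smooth[OF hor_germ_vec[OF assms(1)]
      hor_germ_vec[OF hor_germ_J[OF assms(2)]]]]
  by (simp add: metric_def apply_J_def)


lemma d_sum:
  assumes "\<And>i. i \<in> I \<Longrightarrow> u i \<in> tangent M x" "v \<in> tangent M x"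
  shows "d x v (sum u I) = (\<Sum>i\<in>I. d x v (u i))"
  using assms(1)
proof (induction I rule: infinite_finite_induct)
  case empty
  then show ?case using d_scale(2)[of 0 x v 0] assms(2) by (simp add: tangent_closed)
next
  case (infinite A)
  then show ?case using d_scale(2)[of 0 x v 0] assms(2) by (simp add: tangent_closed)
qed (simp_all add: d_add tangent_closed assms(2))

lemma J_sum:
  assumes "\<And>i. i \<in> I \<Longrightarrow> u i \<in> hdist M x" "finite I"
  shows "J x (\<Sum>i\<in>I. tscale (a i) (u i)) = (\<Sum>i\<in>I. tscale (a i) (J x (u i)))"
  using assms(2,1)
proof (induction I rule: finite_induct)
  case empty
  then show ?case using almost_complexD(3)[of 0 x 0] by (simp add: hdist_closed)
qed (simp_all add: almost_complexD hdist_closed)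


subsection \<open>Orthonormal and unitary frames\<close>

lemma orthonormalD:
  assumes "orthonormal k M \<theta> x b"
  shows "i < k \<Longrightarrow> b i \<in> hdist M x" "i < k \<Longrightarrow> j < k \<Longrightarrow> g x (b i) (b j) = (if i = j then 1 else 0)"
  using assms by (auto simp: orthonormal_def)

lemma orthonormal_lincomb:
  assumes "orthonormal k M \<theta> x b" "j < k"
  shows "g x (\<Sum>i<k. tscale (c i) (b i)) (b j) = c j"
proof -
  note o = orthonormalD[OF assms(1)]
  have "g x (\<Sum>i<k. tscale (c i) (b i)) (b j) = (\<Sum>i<k. c i * g x (b i) (b j))"
    using assms(2) by (subst g_sum) (auto simp: o hdist_closed g_scale)
  also have "\<dots> = (\<Sum>i<k. if i = j then c i else 0)"
    by (rule sum.cong) (use assms(2) o in auto)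
  finally show ?thesis using assms(2) by simp
qed

lemma orthonormal_independent:
  assumes o: "orthonormal k M \<theta> x b"
  shows "inj_on b {..<k}" "tv.independent (b ` {..<k})"
proof -
  show inj: "inj_on b {..<k}"
  proof (rule inj_onI)
    fix i j assume ij: "i \<in> {..<k}" "j \<in> {..<k}" "b i = b j"
    have "g x (b i) (b j) = 1" using orthonormalD(2)[OF o, of i i] ij by simp
    then show "i = j" using orthonormalD(2)[OF o, of i j] ij by (simp split: if_splits)
  qed
  show "tv.independent (b ` {..<k})"
  proof
    assume "tv.dependent (b ` {..<k})"
    then obtain f v where v: "v \<in> b ` {..<k}" "f v \<noteq> 0" and z: "(\<Sum>v\<in>b ` {..<k}. tscale (f v) v) = 0"
      using tv.dependent_finite[of "b ` {..<k}"] by auto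
    obtain j where j: "j < k" "v = b j" using v by auto
    have "(\<Sum>i<k. tscale (f (b i)) (b i)) = 0" using z by (simp add: sum.reindex[OF inj])
    then have "g x 0 (b j) = f (b j)"
      using orthonormal_lincomb[OF o j(1), of "\<lambda>i. f (b i)"] by simp
    then show False using g_zero[OF orthonormalD(1)[OF o j(1)]] j v by simp
  qed
qed

text \<open>One Gram-Schmidt step at a single point: what is left after subtracting the projection
  is nonzero, hence of positive length.\<close>

lemma orthonormal_project:
  assumes o: "orthonormal k M \<theta> x b" and v: "v \<in> hdist M x" "v \<notin> tv.span (b ` {..<k})"
  obtains w where "w \<in> hdist M x" "g x w w = 1" "\<And>i. i < k \<Longrightarrow> g x w (b i) = 0"
proof -
  define u where "u = v - (\<Sum>i<k. tscale (g x v (b i)) (b i))"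
  have s: "(\<Sum>i<k. tscale (g x v (b i)) (b i)) \<in> hdist M x"
    using orthonormalD(1)[OF o] by (auto intro!: hdist_closed)
  have u: "u \<in> hdist M x" unfolding u_def by (intro hdist_closed v s)
  have u0: "u \<noteq> 0"
  proof
    assume "u = 0"
    then have "v = (\<Sum>i<k. tscale (g x v (b i)) (b i))" by (simp add: u_def)
    also have "\<dots> \<in> tv.span (b ` {..<k})" by (intro tv.span_sum tv.span_scale tv.span_base imageI)
    finally show False using v(2) by simp
  qed
  have orth: "g x u (b i) = 0" if "i < k" for i
    unfolding u_def using g_diff(1)[OF v(1) s orthonormalD(1)[OF o that]] orthonormal_lincomb[OF o that] by simp
  define c where "c = 1 / sqrt (g x u u)"
  have "c * c * g x u u = 1" using g_pos[OF u u0] by (simp add: c_def)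
  then show thesis
    using u orth orthonormalD(1)[OF o]
    by (intro that[of "tscale c u"]) (simp_all add: hdist_closed g_scale)
qed

lemma orthonormal_insert:
  assumes o: "orthonormal k M \<theta> x b" and w: "w \<in> hdist M x" "g x w w = 1" "\<And>i. i < k \<Longrightarrow> g x w (b i) = 0"
  shows "orthonormal (Suc k) M \<theta> x (b(k := w))"
  unfolding orthonormal_def
proof (intro conjI allI impI)
  show "(b(k := w)) i \<in> hdist M x" if "i < Suc k" for i
    using that w(1) orthonormalD(1)[OF o, of i] by simp
  show "g x ((b(k := w)) i) ((b(k := w)) j) = (if i = j then 1 else 0)" if "i < Suc k" "j < Suc k" for i j
    using that w(2) orthonormalD[OF o, of i] orthonormalD(2)[OF o, of i j] w(3)[of j] w(3)[of i]
      g_sym[OF _ w(1), of "b i"]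
    by (cases "i = k"; cases "j = k") simp_all
qed

lemma orthonormal_le:
  assumes "orthonormal k M \<theta> x b"
  shows "k \<le> 2*m"
proof -
  obtain c where c: "hdist M x = tv.span (c ` {..<2*m})" by (rule hdist_span)
  have "card (b ` {..<k}) \<le> card (c ` {..<2*m})"
    using tv.independent_span_bound[OF _ orthonormal_independent(2)[OF assms], of "c ` {..<2*m}"]
      c orthonormalD(1)[OF assms] by auto
  also have "\<dots> \<le> 2*m" using card_image_le[of "{..<2*m}" c] by simp
  finally show ?thesis using card_image[OF orthonormal_independent(1)[OF assms]] by simp
qed

text \<open>A horizontal vector outside the span would yield 2m+1 orthonormal vectors in a space
  spanned by 2m.\<close>

lemma orthonormal_expand:
  assumes o: "orthonormal (2*m) M \<theta> x b" and v: "v \<in> hdist M x"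
  shows "v = (\<Sum>i<2*m. tscale (g x v (b i)) (b i))"
proof -
  have "v \<in> tv.span (b ` {..<2*m})"
  proof (rule ccontr)
    assume "v \<notin> tv.span (b ` {..<2*m})"
    then obtain w where "w \<in> hdist M x" "g x w w = 1" "\<And>i. i < 2*m \<Longrightarrow> g x w (b i) = 0"
      using orthonormal_project[OF o v] by blast
    from orthonormal_le[OF orthonormal_insert[OF o this]] show False by simp
  qed
  also have "tv.span (b ` {..<2*m}) = range (\<lambda>f. \<Sum>v\<in>b ` {..<2*m}. tscale (f v) v)"
    by (rule tv.span_finite) simp
  finally obtain f where "v = (\<Sum>v\<in>b ` {..<2*m}. tscale (f v) v)" by blast
  then have f: "v = (\<Sum>i<2*m. tscale (f (b i)) (b i))"
    by (simp add: sum.reindex[OF orthonormal_independent(1)[OF o]])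
  have "g x v (b i) = f (b i)" if "i < 2*m" for i
    using orthonormal_lincomb[OF o that, of "\<lambda>i. f (b i)"] f by simp
  then have "(\<Sum>i<2*m. tscale (g x v (b i)) (b i)) = (\<Sum>i<2*m. tscale (f (b i)) (b i))"
    by (intro sum.cong) auto
  with f show ?thesis by simp
qed

lemma orthonormal_parseval:
  assumes o: "orthonormal (2*m) M \<theta> x b" and v: "v \<in> hdist M x" "w \<in> hdist M x"
  shows "g x v w = (\<Sum>i<2*m. g x v (b i) * g x w (b i))"
proof -
  have "g x v w = g x (\<Sum>i<2*m. tscale (g x v (b i)) (b i)) w"
    using orthonormal_expand[OF o v(1)] by simp
  also have "\<dots> = (\<Sum>i<2*m. g x v (b i) * g x w (b i))"
    using orthonormalD(1)[OF o] v by (subst g_sum) (auto simp: hdist_closed g_scale g_sym[OF v(2)])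
  finally show ?thesis .
qed

text \<open>Of the four kinds of products between e's and J e's two suffice, since J is an isometry
  and skew for the metric.\<close>

lemma unitary_iff:
  "unitary_frame k M \<theta> x e \<longleftrightarrow> (\<forall>a<k. e a \<in> hdist M x) \<and>
     (\<forall>a<k. \<forall>b<k. g x (e a) (e b) = (if a = b then 1 else 0) \<and> g x (e a) (J x (e b)) = 0)"
proof
  assume u: "unitary_frame k M \<theta> x e"
  note o = orthonormalD[OF u[unfolded unitary_frame_def]]
  have h: "e a \<in> hdist M x" if "a < k" for a using o(1)[of "2*a"] that by simp
  have "g x (e a) (e b) = (if a = b then 1 else 0)" "g x (e a) (J x (e b)) = 0" if "a < k" "b < k" for a b
    using o(2)[of "2*a" "2*b"] o(2)[of "2*a" "2*b + 1"] that by (simp_all split: if_splits)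
  with h show "(\<forall>a<k. e a \<in> hdist M x) \<and>
     (\<forall>a<k. \<forall>b<k. g x (e a) (e b) = (if a = b then 1 else 0) \<and> g x (e a) (J x (e b)) = 0)" by blast
next
  assume a: "(\<forall>a<k. e a \<in> hdist M x) \<and>
     (\<forall>a<k. \<forall>b<k. g x (e a) (e b) = (if a = b then 1 else 0) \<and> g x (e a) (J x (e b)) = 0)"
  define u where "u i = (if even i then e (i div 2) else J x (e (i div 2)))" for i
  have "g x (u i) (u j) = (if i = j then 1 else 0)" if ij: "i < 2*k" "j < 2*k" for i j
  proof -
    have lt: "i div 2 < k" "j div 2 < k" using ij by auto
    have eq: "i = j \<longleftrightarrow> i div 2 = j div 2 \<and> (even i \<longleftrightarrow> even j)"
      by (metis dvd_mult_div_cancel odd_two_times_div_two_succ)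
    have h: "e (i div 2) \<in> hdist M x" "e (j div 2) \<in> hdist M x" using a lt by auto
    show ?thesis
      unfolding eq using a lt h by (auto simp: u_def g_JJ g_J_left)
  qed
  moreover have "u i \<in> hdist M x" if "i < 2*k" for i
    using a that by (auto simp: u_def J_hdist)
  ultimately show "unitary_frame k M \<theta> x e"
    by (simp add: unitary_frame_def orthonormal_def u_def)
qed

lemma unitary_parseval:
  assumes e: "unitary_frame m M \<theta> x e" and v: "v \<in> hdist M x" "w \<in> hdist M x"
  shows "g x v w = (\<Sum>a<m. g x v (e a) * g x w (e a) + g x v (J x (e a)) * g x w (J x (e a)))"
  using orthonormal_parseval[OF e[unfolded unitary_frame_def] v] by (simp add: sum_even_odd)

lemma unitary_expand:
  assumes e: "unitary_frame m M \<theta> x e" and v: "v \<in> hdist M x"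
  shows "v = (\<Sum>a<m. tscale (g x v (e a)) (e a) + tscale (g x v (J x (e a))) (J x (e a)))"
  using orthonormal_expand[OF e[unfolded unitary_frame_def] v] by (simp add: sum_even_odd)

lemma ex_orthonormal: "\<exists>s. orthonormal (2*m) M \<theta> x s"
  using ex_frame[of x] eventually_nhds_x_imp_x by fast

text \<open>Complex Gram-Schmidt at one point. The span of the e's and J e's found so far is
  J-invariant, so for a unit vector w orthogonal to it J w is orthogonal to it as well, and J w is
  orthogonal to w by skewness. Such a w exists as long as fewer than m vectors are chosen, by
  comparison with 2m orthonormal vectors.\<close>

lemma ex_unitary: "\<exists>e. unitary_frame m M \<theta> x e"
proof -
  obtain s where s: "orthonormal (2*m) M \<theta> x s" using ex_orthonormal by blast
  have "\<exists>e. unitary_frame k M \<theta> x e" if "k \<le> m" for k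
    using that
  proof (induction k)
    case 0
    then show ?case by (simp add: unitary_iff)
  next
    case (Suc k)
    then obtain e where e: "unitary_frame k M \<theta> x e" by auto
    define u where "u i = (if even i then e (i div 2) else J x (e (i div 2)))" for i
    have o: "orthonormal (2*k) M \<theta> x u" using e by (simp add: unitary_frame_def u_def[abs_def])
    have "\<not> s ` {..<2*m} \<subseteq> tv.span (u ` {..<2*k})"
    proof
      assume "s ` {..<2*m} \<subseteq> tv.span (u ` {..<2*k})"
      from tv.independent_span_bound[OF _ orthonormal_independent(2)[OF s] this]
      have "card (s ` {..<2*m}) \<le> card (u ` {..<2*k})" by simp
      also have "\<dots> \<le> 2*k" using card_image_le[of "{..<2*k}" u] by simp
      finally show False using card_image[OF orthonormal_independent(1)[OF s]] Suc.prems by simp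
    qed
    then obtain v where "v \<in> hdist M x" "v \<notin> tv.span (u ` {..<2*k})"
      using orthonormalD(1)[OF s] by auto
    then obtain w where w: "w \<in> hdist M x" "g x w w = 1" "\<And>i. i < 2*k \<Longrightarrow> g x w (u i) = 0"
      using orthonormal_project[OF o] by blast
    have w0: "g x w (e a) = 0" "g x w (J x (e a)) = 0" if "a < k" for a
      using w(3)[of "2*a"] w(3)[of "2*a + 1"] that by (auto simp: u_def)
    have h: "e a \<in> hdist M x" if "a < k" for a using e that by (simp add: unitary_iff)
    have "g x (e a) w = 0" "g x (e a) (J x w) = 0" if "a < k" for a
      using w0[OF that] g_sym[OF h[OF that] w(1)] g_J_left[OF h[OF that] w(1)]
        g_sym[OF J_hdist[OF h[OF that]] w(1)] by simp_all
    then have "unitary_frame (Suc k) M \<theta> x (e(k := w))"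
      using e w w0 h g_J_self(1)[OF w(1)] unfolding unitary_iff by (simp add: less_Suc_eq)
    then show ?case by blast
  qed
  then show ?thesis by blast
qed


subsection \<open>The Reeb field\<close>

text \<open>\<open>reeb\<close> is a pointwise description and says nothing about smoothness; the
  explicit formula built here from smooth ingredients does, once uniqueness identifies the
  two.\<close>

lemma reeb_local:
  obtains R where "vec_germ M x R"
    "\<forall>\<^sub>F y in nhds x. R y \<in> tangent M y \<and> \<theta> y (R y) = 1 \<and> (\<forall>w\<in>tangent M y. d y (R y) w = 0)"
proof -
  obtain W where W: "vec_germ M x W" "W x \<notin> hdist M x" by (rule tangent_not_horizontal)
  have tx: "\<theta> x (W x) \<noteq> 0" using W theta_hdist_iff vec_germ_tangent by blast
  obtain s where s: "\<And>k. k < 2*m \<Longrightarrow> hor_germ M x (\<lambda>y. s y k)"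
    and o: "\<forall>\<^sub>F y in nhds x. orthonormal (2*m) M \<theta> y (s y)"
    using ex_frame by blast
  define N where "N y = tscale (inverse (\<theta> y (W y))) (W y)" for y
  have N: "vec_germ M x N"
    unfolding N_def[abs_def] by (intro vec_germ_scale smooth_germ_inverse theta_smooth W tx)
  \<comment> \<open>The correction S must satisfy d\<theta>(N + S, J s_k) = 0. Since d\<theta>(S, J
    s_k) = 2 g(S, s_k) is twice the k-th coefficient of S, this fixes the coefficients.\<close>
  define c where "c k y = - (1/2) * d y (N y) (apply_J M (\<lambda>y. s y k) y)" for k y
  define R where "R y = N y + (\<Sum>k<2*m. tscale (c k y) (s y k))" for y
  have c: "smooth_germ M x (c k)" if "k < 2*m" for k
    unfolding c_def[abs_def]
    by (intro smooth_germ_mult smooth_germ_const d_smooth N hor_germ_vec hor_germ_J s that)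
  have "vec_germ M x R"
    unfolding R_def[abs_def] by (intro vec_germ_add vec_germ_sum vec_germ_scale N c hor_germ_vec s) auto
  moreover have "\<forall>\<^sub>F y in nhds x. R y \<in> tangent M y \<and> \<theta> y (R y) = 1 \<and> (\<forall>w\<in>tangent M y. d y (R y) w = 0)"
    using o vec_germ_eventually[OF W(1)] smooth_germ_nonzero[OF theta_smooth[OF W(1)] tx]
  proof eventually_elim
    case (elim y)
    note oy = orthonormalD[OF elim(1)]
    have Wt: "W y \<in> tangent M y" using elim by (simp add: vec_germ_tangent)
    then have Nt: "N y \<in> tangent M y" and N1: "\<theta> y (N y) = 1"
      using elim by (simp_all add: N_def tangent_closed theta_lin)
    define S where "S = (\<Sum>k<2*m. tscale (c k y) (s y k))"
    have S: "S \<in> hdist M y" unfolding S_def by (intro hdist_closed oy) auto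
    have R: "R y = N y + S" by (simp add: R_def S_def)
    have Rt: "R y \<in> tangent M y" and R1: "\<theta> y (R y) = 1"
      using Nt N1 hdist_tangent[OF S] theta_hdist[OF S] by (simp_all add: R theta_lin tangent_closed)
    have hor0: "d y (R y) w = 0" if w: "w \<in> hdist M y" for w
    proof -
      have 1: "d y (R y) (J y (s y k)) = 0" if k: "k < 2*m" for k
      proof -
        have "d y S (J y (s y k)) = 2 * g y S (s y k)" by (simp add: metric_def)
        also have "\<dots> = 2 * c k y" unfolding S_def using orthonormal_lincomb[OF elim(1) k, of "\<lambda>k. c k y"] by simp
        finally show ?thesis
          using Nt S oy(1)[OF k]
          by (simp add: R d_add hdist_tangent J_hdist c_def apply_J_def)
      qed
      have Jw: "- J y w \<in> hdist M y" using w by (simp add: hdist_closed J_hdist)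
      have "w = J y (- J y w)" using w by (simp add: cplx_minus J_J J_hdist)
      also have "\<dots> = J y (\<Sum>k<2*m. tscale (g y (- J y w) (s y k)) (s y k))"
        using orthonormal_expand[OF elim(1) Jw] by simp
      also have "\<dots> = (\<Sum>k<2*m. tscale (g y (- J y w) (s y k)) (J y (s y k)))"
        by (rule J_sum[OF oy(1)]) auto
      finally have "w = (\<Sum>k<2*m. tscale (g y (- J y w) (s y k)) (J y (s y k)))" .
      moreover have "d y (R y) (\<Sum>k<2*m. tscale (a k) (J y (s y k))) = 0" for a
        using 1 oy(1) Rt by (subst d_sum) (auto simp: d_scale hdist_tangent J_hdist tangent_closed)
      ultimately show ?thesis by metis
    qed
    \<comment> \<open>Splitting off the multiple \<theta>(w) R leaves a horizontal vector, and
      d\<theta>(R, R) = 0.\<close>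
    have "d y (R y) w = 0" if w: "w \<in> tangent M y" for w
    proof -
      have "w - tscale (\<theta> y w) (R y) \<in> hdist M y"
        using w Rt R1 by (subst theta_hdist_iff[symmetric]) (auto simp: theta_lin tangent_closed)
      then have z: "d y (R y) (w - tscale (\<theta> y w) (R y)) = 0" by (rule hor0)
      have RR: "d y (R y) (R y) = 0" using d_swap[OF Rt Rt] by simp
      have "w = (w - tscale (\<theta> y w) (R y)) + tscale (\<theta> y w) (R y)" by simp
      then have "d y (R y) w = d y (R y) (w - tscale (\<theta> y w) (R y)) + d y (R y) (tscale (\<theta> y w) (R y))"
        using w Rt by (metis d_add(2) tangent_closed(3,4))
      with z RR Rt show ?thesis by (simp add: d_scale)
    qed
    with Rt R1 show ?case by blast
  qed
  ultimately show thesis by (rule that)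
qed

text \<open>The difference u of two candidates is horizontal and annihilated by d\<theta>; then
  g(u,u), half of d\<theta>(u, J u), vanishes and positivity gives u = 0.\<close>

lemma reeb_unique:
  assumes "v \<in> tangent M x" "\<theta> x v = 1" "\<forall>w\<in>tangent M x. d x v w = 0"
  shows "T x = v"
  unfolding reeb_def
proof (rule the_equality)
  show "v \<in> tangent M x \<and> \<theta> x v = 1 \<and> (\<forall>w\<in>tangent M x. d x v w = 0)" using assms by blast
  fix u assume u: "u \<in> tangent M x \<and> \<theta> x u = 1 \<and> (\<forall>w\<in>tangent M x. d x u w = 0)"
  have h: "u - v \<in> hdist M x"
    using u assms by (subst theta_hdist_iff[symmetric]) (auto simp: theta_lin tangent_closed)
  have Jh: "J x (u - v) \<in> hdist M x" by (rule J_hdist[OF h])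
  have "d x (u - v) (J x (u - v)) = d x u (J x (u - v)) + d x (- v) (J x (u - v))"
    using d_add(1)[of u x "- v" "J x (u - v)"] u assms Jh by (simp add: tangent_closed hdist_tangent)
  also have "\<dots> = 0" using u assms Jh by (simp add: d_minus hdist_tangent)
  finally have "g x (u - v) (u - v) = 0" by (simp add: metric_def)
  then show "u = v" using g_pos[OF h] by fastforce
qed

lemma vec_germ_reeb: "vec_germ M x T"
  and reeb: "T x \<in> tangent M x" "\<theta> x (T x) = 1" "w \<in> tangent M x \<Longrightarrow> d x (T x) w = 0"
proof -
  obtain R where R: "vec_germ M x R" and ev:
    "\<forall>\<^sub>F y in nhds x. R y \<in> tangent M y \<and> \<theta> y (R y) = 1 \<and> (\<forall>w\<in>tangent M y. d y (R y) w = 0)"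
    by (rule reeb_local)
  from ev have eq: "\<forall>\<^sub>F y in nhds x. R y = T y"
    by eventually_elim (rule reeb_unique[symmetric], blast+)
  show "vec_germ M x T" by (rule vec_germ_cong[OF R eq])
  show "T x \<in> tangent M x" "\<theta> x (T x) = 1" "w \<in> tangent M x \<Longrightarrow> d x (T x) w = 0"
    using eventually_nhds_x_imp_x[OF ev] eventually_nhds_x_imp_x[OF eq] by auto
qed

end


section \<open>Clifford algebra\<close>

lemma matrix_add_rdistrib: "(A + B) ** C = A ** C + B ** C"
  by (vector matrix_matrix_mult_def sum.distrib[symmetric] field_simps)

lemma matrix_mult_sum_left: "(\<Sum>i\<in>I. A i) ** B = (\<Sum>i\<in>I. A i ** B)"
  by (induction I rule: infinite_finite_induct) (simp_all add: matrix_add_rdistrib)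

lemma matrix_mult_sum_right: "B ** (\<Sum>i\<in>I. A i) = (\<Sum>i\<in>I. B ** A i)"
  by (induction I rule: infinite_finite_induct) (simp_all add: matrix_add_ldistrib)

lemma matrix_mult_diff: "(A - B) ** C = A ** C - B ** C" "C ** (A - B) = C ** A - C ** B"
  for A B C :: "complex^'a^'a"
  by (simp_all add: vec_eq_iff matrix_matrix_mult_def sum_subtractf algebra_simps)

lemma matrix_mult_scaleR_left: "(c *\<^sub>R A) ** B = c *\<^sub>R (A ** B)"
  for A :: "complex^'a^'b" and B :: "complex^'c^'a"
  by (simp add: vec_eq_iff matrix_matrix_mult_def scaleR_sum_right)

lemma matrix_mult_scaleR_right: "A ** (c *\<^sub>R B) = c *\<^sub>R (A ** B)"
  for A :: "complex^'a^'b" and B :: "complex^'c^'a"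
  by (simp add: vec_eq_iff matrix_matrix_mult_def scaleR_sum_right)

lemma matrix_mult_minus: "(- A) ** B = - (A ** B)" "A ** (- B) = - (A ** B)"
  for A :: "complex^'a^'b" and B :: "complex^'c^'a"
  using matrix_mult_scaleR_left[of "-1" A B] matrix_mult_scaleR_right[of A "-1" B] by simp_all

lemmas matrix_mult_linear = matrix_mult_sum_left matrix_mult_sum_right matrix_mult_scaleR_left
  matrix_mult_scaleR_right matrix_mult_minus matrix_mult_diff matrix_add_ldistrib matrix_add_rdistrib

lemma mat_of_real: "(mat (of_real r) :: complex^'a^'a) = r *\<^sub>R mat 1"
  by (simp add: vec_eq_iff mat_def of_real_def)

locale clifford_rep =
  fixes m :: nat and \<gamma> :: "nat \<Rightarrow> complex^'s^'s"
  assumes module: "clifford_module m \<gamma>"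
begin

definition cl :: "(nat \<Rightarrow> real) \<Rightarrow> complex^'s^'s" where
  "cl x = (\<Sum>i<2*m. x i *\<^sub>R \<gamma> i)"

text \<open>For skew \<open>c\<close> these are the elements of the Lie algebra of Spin. Each pair
  of indices is counted twice and every commutator of generators brings a factor 2: hence the 4 in
  \<open>quad_commutator\<close> and the 1/4 in the lift.\<close>

definition quad :: "(nat \<Rightarrow> nat \<Rightarrow> real) \<Rightarrow> complex^'s^'s" where
  "quad c = (\<Sum>a<2*m. \<Sum>b<2*m. c a b *\<^sub>R (\<gamma> a ** \<gamma> b))"

lemma gamma_anticomm:
  assumes "i < 2*m" "j < 2*m"
  shows "\<gamma> i ** \<gamma> j = - (\<gamma> j ** \<gamma> i) - (if i = j then 2 else 0) *\<^sub>R mat 1"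
proof -
  have "\<gamma> i ** \<gamma> j + \<gamma> j ** \<gamma> i = (if i = j then mat (-2) else 0)"
    using module assms by (auto simp: clifford_module_def)
  also have "\<dots> = - ((if i = j then 2 else 0) *\<^sub>R mat 1)"
    using mat_of_real[of "-2", where 'a = 's] by simp
  finally have "\<gamma> i ** \<gamma> j + \<gamma> j ** \<gamma> i = - ((if i = j then 2 else 0) *\<^sub>R mat 1)" .
  then have "\<gamma> i ** \<gamma> j = - ((if i = j then 2 else 0) *\<^sub>R mat 1) - \<gamma> j ** \<gamma> i"
    by (metis add_diff_cancel_right')
  then show ?thesis by (simp only: minus_diff_commute)
qed

lemma gamma_square:
  assumes "i < 2*m"
  shows "\<gamma> i ** \<gamma> i = - mat 1"
proof -
  have "2 *\<^sub>R (\<gamma> i ** \<gamma> i) = mat (-2)"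
    using module assms by (auto simp: clifford_module_def scaleR_2)
  also have "\<dots> = 2 *\<^sub>R (- mat 1)" using mat_of_real[of "-2", where 'a = 's] by simp
  finally show ?thesis by (rule scaleR_left_imp_eq[rotated]) simp
qed

lemma cl_gamma:
  assumes "j < 2*m"
  shows "cl x ** \<gamma> j = - (\<gamma> j ** cl x) - (2 * x j) *\<^sub>R mat 1"
proof -
  have "cl x ** \<gamma> j = (\<Sum>i<2*m. x i *\<^sub>R (\<gamma> i ** \<gamma> j))" by (simp add: cl_def matrix_mult_linear)
  also have "\<dots> = (\<Sum>i<2*m. - (x i *\<^sub>R (\<gamma> j ** \<gamma> i)) - (if i = j then (2 * x j) *\<^sub>R mat 1 else 0))"
    using assms by (intro sum.cong) (auto simp: gamma_anticomm[of _ j] scaleR_diff_right)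
  also have "\<dots> = - (\<gamma> j ** cl x) - (2 * x j) *\<^sub>R mat 1"
    using assms by (simp add: sum_subtractf sum_negf cl_def matrix_mult_linear)
  finally show ?thesis .
qed

lemma mat_1_nonzero: "(mat 1 :: complex^'s^'s) \<noteq> 0"
  by (simp add: vec_eq_iff mat_def)

text \<open>The anticommutator of \<open>cl x\<close> with the j-th generator is the scalar -2 x_j,
  so the coefficients can be read off: the generators are linearly independent.\<close>

lemma cl_eq_0D:
  assumes "cl x = 0" "j < 2*m"
  shows "x j = 0"
  using cl_gamma[OF assms(2), of x] mat_1_nonzero by (simp add: assms(1))

lemma cl_diff: "cl (\<lambda>i. x i - y i) = cl x - cl y"
  by (simp add: cl_def scaleR_diff_left sum_subtractf)

lemma quad_cong: "(\<And>i j. i < 2*m \<Longrightarrow> j < 2*m \<Longrightarrow> c i j = e i j) \<Longrightarrow> quad c = quad e"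
  by (simp add: quad_def)

lemma quad_add: "quad (\<lambda>i j. c i j + e i j) = quad c + quad e"
  and quad_scale: "quad (\<lambda>i j. r * c i j) = r *\<^sub>R quad c"
  by (simp_all add: quad_def scaleR_add_left scaleR_diff_left sum.distrib sum_subtractf scaleR_sum_right)

lemma gamma_commutator:
  assumes "a < 2*m" "b < 2*m" "j < 2*m"
  shows "(\<gamma> a ** \<gamma> b) ** \<gamma> j - \<gamma> j ** (\<gamma> a ** \<gamma> b) =
    (if a = j then 2 else 0) *\<^sub>R \<gamma> b - (if b = j then 2 else 0) *\<^sub>R \<gamma> a"
proof -
  have "(\<gamma> a ** \<gamma> b) ** \<gamma> j = \<gamma> a ** (\<gamma> b ** \<gamma> j)" by (simp add: matrix_mul_assoc)
  also have "\<dots> = - ((\<gamma> a ** \<gamma> j) ** \<gamma> b) - (if b = j then 2 else 0) *\<^sub>R \<gamma> a"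
    by (subst gamma_anticomm[OF assms(2,3)])
      (simp add: matrix_mult_linear matrix_mul_assoc)
  also have "(\<gamma> a ** \<gamma> j) ** \<gamma> b = - (\<gamma> j ** (\<gamma> a ** \<gamma> b)) - (if a = j then 2 else 0) *\<^sub>R \<gamma> b"
    by (subst gamma_anticomm[OF assms(1,3)])
      (simp add: matrix_mult_linear matrix_mul_assoc)
  finally show ?thesis by simp
qed

lemma quad_commutator:
  assumes skew: "\<And>i k. i < 2*m \<Longrightarrow> k < 2*m \<Longrightarrow> c i k = - c k i" and j: "j < 2*m"
  shows "quad c ** \<gamma> j - \<gamma> j ** quad c = cl (\<lambda>k. - 4 * c k j)"
proof -
  have "quad c ** \<gamma> j - \<gamma> j ** quad c =
      (\<Sum>a<2*m. \<Sum>b<2*m. c a b *\<^sub>R ((\<gamma> a ** \<gamma> b) ** \<gamma> j - \<gamma> j ** (\<gamma> a ** \<gamma> b)))"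
    by (simp add: quad_def matrix_mult_linear sum_subtractf scaleR_diff_right)
  also have "\<dots> = (\<Sum>a<2*m. \<Sum>b<2*m. (if a = j then (2 * c j b) *\<^sub>R \<gamma> b else 0) - (if b = j then (2 * c a j) *\<^sub>R \<gamma> a else 0))"
    using j by (intro sum.cong refl) (auto simp: gamma_commutator scaleR_diff_right)
  also have "\<dots> = (\<Sum>b<2*m. (2 * c j b) *\<^sub>R \<gamma> b) - (\<Sum>a<2*m. (2 * c a j) *\<^sub>R \<gamma> a)"
  proof -
    have "(\<Sum>a<2*m. \<Sum>b<2*m. (if a = j then (2 * c j b) *\<^sub>R \<gamma> b else 0)) =
        (\<Sum>a<2*m. if a = j then (\<Sum>b<2*m. (2 * c j b) *\<^sub>R \<gamma> b) else 0)"
      by (intro sum.cong) auto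
    then show ?thesis using j by (simp add: sum_subtractf)
  qed
  also have "\<dots> = cl (\<lambda>k. - 4 * c k j)"
    unfolding cl_def sum_subtractf[symmetric]
  proof (rule sum.cong)
    fix k assume "k \<in> {..<2*m}"
    then have "2 * c j k - 2 * c k j = - 4 * c k j" using skew[of j k] j by simp
    then show "(2 * c j k) *\<^sub>R \<gamma> k - (2 * c k j) *\<^sub>R \<gamma> k = (- 4 * c k j) *\<^sub>R \<gamma> k"
      by (simp only: scaleR_diff_left[symmetric])
  qed simp
  finally show ?thesis .
qed

lemma span_quad:
  assumes "S \<in> span {\<gamma> i ** \<gamma> j | i j. i < 2*m \<and> j < 2*m \<and> i \<noteq> j}"
  shows "\<exists>c. (\<forall>i<2*m. \<forall>k<2*m. c i k = - c k i) \<and> S = quad c"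
  using assms
proof (induction S rule: span_induct_alt)
  case base
  show ?case by (rule exI[of _ "\<lambda>i j. 0"]) (simp add: quad_def)
next
  case (step r Q S)
  then obtain i j c where ij: "i < 2*m" "j < 2*m" "i \<noteq> j" "Q = \<gamma> i ** \<gamma> j"
    and c: "\<And>i k. i < 2*m \<Longrightarrow> k < 2*m \<Longrightarrow> c i k = - c k i" "S = quad c" by blast
  \<comment> \<open>Distinct generators anticommute, so \<open>r *\<^sub>R Q\<close> may be shared
    equally between the positions (i,j) and (j,i), with opposite signs; this keeps the coefficients
    skew.\<close>
  define e where "e a b = (if a = i \<and> b = j then r / 2 else if a = j \<and> b = i then - r / 2 else 0)" for a b
  have "quad e = (\<Sum>a<2*m. \<Sum>b<2*m. (if a = i \<and> b = j then (r / 2) *\<^sub>R Q else 0) + (if a = j \<and> b = i then (r / 2) *\<^sub>R Q else 0))"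
    unfolding quad_def
  proof (intro sum.cong refl)
    fix a b
    show "e a b *\<^sub>R (\<gamma> a ** \<gamma> b) = (if a = i \<and> b = j then (r / 2) *\<^sub>R Q else 0) + (if a = j \<and> b = i then (r / 2) *\<^sub>R Q else 0)"
      using ij gamma_anticomm[of j i] by (auto simp: e_def)
  qed
  also have "\<dots> = (\<Sum>a<2*m. (if a = i then (r / 2) *\<^sub>R Q else 0) + (if a = j then (r / 2) *\<^sub>R Q else 0))"
  proof (rule sum.cong[OF refl])
    fix a :: nat
    have s: "(\<Sum>b<2*m. if a = i' \<and> b = j' then (r / 2) *\<^sub>R Q else 0) = (if a = i' then (r / 2) *\<^sub>R Q else 0)"
      if "j' < 2*m" for i' j' :: nat using that by (cases "a = i'") simp_all
    show "(\<Sum>b<2*m. (if a = i \<and> b = j then (r / 2) *\<^sub>R Q else 0) + (if a = j \<and> b = i then (r / 2) *\<^sub>R Q else 0)) =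
        (if a = i then (r / 2) *\<^sub>R Q else 0) + (if a = j then (r / 2) *\<^sub>R Q else 0)"
      unfolding sum.distrib s[OF ij(1)] s[OF ij(2)] ..
  qed
  also have "\<dots> = r *\<^sub>R Q" using ij by (simp add: sum.distrib scaleR_add_left[symmetric])
  finally have "r *\<^sub>R Q + S = quad (\<lambda>a b. e a b + c a b)" by (simp add: quad_add c)
  moreover have "e a b + c a b = - (e b a + c b a)" if "a < 2*m" "b < 2*m" for a b
    using c(1)[OF that] ij by (auto simp: e_def)
  ultimately show ?case by (intro exI[of _ "\<lambda>a b. e a b + c a b"] conjI allI impI)
qed

text \<open>Makes the description in \<open>spinc_lift\<close> explicit: -4 c = \<omega> is solved
  by c = -\<omega>/4. The solution is unique because commutators with all generators recover a skew
  coefficient matrix.\<close>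

lemma spinc_lift_eq:
  assumes skew: "\<And>i k. i < 2*m \<Longrightarrow> k < 2*m \<Longrightarrow> \<omega> i k = - \<omega> k i"
  shows "spinc_lift m \<gamma> \<omega> a = quad (\<lambda>i k. - (1/4) * \<omega> i k) + mat (a / 2)"
  unfolding spinc_lift_def
proof (rule the_equality)
  let ?B = "{\<gamma> i ** \<gamma> j | i j. i < 2*m \<and> j < 2*m \<and> i \<noteq> j}"
  let ?S = "quad (\<lambda>i k. - (1/4) * \<omega> i k)"
  have com: "?S ** \<gamma> j - \<gamma> j ** ?S = (\<Sum>k<2*m. \<omega> k j *\<^sub>R \<gamma> k)" if "j < 2*m" for j
  proof -
    have "- (1/4) * \<omega> i k = - (- (1/4) * \<omega> k i)" if "i < 2*m" "k < 2*m" for i k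
      using skew[OF that] by simp
    from quad_commutator[OF this \<open>j < 2*m\<close>] show ?thesis by (simp add: cl_def)
  qed
  have "?S \<in> span ?B"
    unfolding quad_def
  proof (intro span_sum)
    fix i k assume ik: "i \<in> {..<2*m}" "k \<in> {..<2*m}"
    show "(- (1/4) * \<omega> i k) *\<^sub>R (\<gamma> i ** \<gamma> k) \<in> span ?B"
    proof (cases "i = k")
      case True
      then have "\<omega> i k = 0" using skew[of i k] ik by simp
      then show ?thesis by (simp add: span_zero)
    next
      case False
      then show ?thesis using ik by (intro span_scale span_base) auto
    qed
  qed
  with com show "\<exists>S\<in>span ?B. ?S + mat (a / 2) = S + mat (a / 2) \<and>
      (\<forall>j<2*m. S ** \<gamma> j - \<gamma> j ** S = (\<Sum>k<2*m. \<omega> k j *\<^sub>R \<gamma> k))" by blast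
  fix Z
  assume "\<exists>S\<in>span ?B. Z = S + mat (a / 2) \<and> (\<forall>j<2*m. S ** \<gamma> j - \<gamma> j ** S = (\<Sum>k<2*m. \<omega> k j *\<^sub>R \<gamma> k))"
  then obtain S where S: "S \<in> span ?B" "Z = S + mat (a / 2)"
    "\<And>j. j < 2*m \<Longrightarrow> S ** \<gamma> j - \<gamma> j ** S = (\<Sum>k<2*m. \<omega> k j *\<^sub>R \<gamma> k)" by blast
  obtain c where c: "\<And>i k. i < 2*m \<Longrightarrow> k < 2*m \<Longrightarrow> c i k = - c k i" "S = quad c"
    using span_quad[OF S(1)] by blast
  have "c k j = - (1/4) * \<omega> k j" if "k < 2*m" "j < 2*m" for k j
  proof -
    have "cl (\<lambda>k. - 4 * c k j) = cl (\<lambda>k. \<omega> k j)"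
      using S(3)[OF that(2)] quad_commutator[of c, OF c(1) that(2)] c(2) by (simp add: cl_def)
    then have "cl (\<lambda>k. - 4 * c k j - \<omega> k j) = 0" by (simp only: cl_diff diff_self)
    from cl_eq_0D[OF this that(1)] show ?thesis by simp
  qed
  then show "Z = ?S + mat (a / 2)" unfolding S(2) c(2) by (simp cong: quad_cong)
qed

lemma sum_gamma_quad:
  "(\<Sum>i<2*m. \<gamma> i ** quad (b i)) =
    (\<Sum>i<2*m. \<Sum>j<2*m. \<Sum>k<2*m. b i j k *\<^sub>R (\<gamma> i ** \<gamma> j ** \<gamma> k))"
  by (simp add: quad_def matrix_mult_linear matrix_mul_assoc)

text \<open>
  The terms of \<open>b\<close> are those of the difference of two Webster--Tanaka connections, in an orthonormal
  frame; \<open>I\<close> is the matrix of the complex structure, \<open>v\<close> the horizontal change of the Reeb field.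
\<close>

lemma dirac_identity:
  fixes I :: "nat \<Rightarrow> nat \<Rightarrow> real" and v f :: "nat \<Rightarrow> real"
  assumes skew: "\<And>i k. i < 2*m \<Longrightarrow> k < 2*m \<Longrightarrow> I i k = - I k i"
    and f: "\<And>i. i < 2*m \<Longrightarrow> f i = (\<Sum>k<2*m. I k i * v k)"
  defines "b \<equiv> \<lambda>i j k. I i j * v k - I j k * v i + I k i * v j
      + (if i = k then f j else 0) - (if i = j then f k else 0)"
  shows "(\<Sum>i<2*m. \<gamma> i ** quad (b i)) = (4 * (real m + 1)) *\<^sub>R cl f + cl v ** quad I"
proof -
  let ?S = "\<lambda>b. \<Sum>i<2*m. \<gamma> i ** quad (b i)"
  have A1: "?S (\<lambda>i j k. I i j * v k) = quad I ** cl v"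
    unfolding sum_gamma_quad quad_def matrix_mult_sum_left matrix_mult_scaleR_left cl_def
    by (simp add: matrix_mult_linear scaleR_sum_right matrix_mul_assoc)
  have A2: "?S (\<lambda>i j k. I j k * v i) = cl v ** quad I"
    unfolding sum_gamma_quad cl_def matrix_mult_sum_left matrix_mult_scaleR_left quad_def
    by (simp add: matrix_mult_linear scaleR_sum_right matrix_mul_assoc mult.commute)
  \<comment> \<open>The last generator has to move left past \<open>cl v\<close>; this costs -2 v_k,
    and contracting that cost with I_ki gives f_i.\<close>
  have A3: "?S (\<lambda>i j k. I k i * v j) = quad I ** cl v - 2 *\<^sub>R cl f"
  proof -
    have "?S (\<lambda>i j k. I k i * v j) = (\<Sum>i<2*m. \<Sum>k<2*m. I k i *\<^sub>R (\<gamma> i ** (cl v ** \<gamma> k)))"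
      unfolding sum_gamma_quad
      by (rule sum.cong[OF refl], subst sum.swap)
        (simp add: cl_def matrix_mult_linear scaleR_sum_right matrix_mul_assoc)
    also have "\<dots> = (\<Sum>i<2*m. \<Sum>k<2*m. I i k *\<^sub>R (\<gamma> i ** \<gamma> k ** cl v) - (2 * (I k i * v k)) *\<^sub>R \<gamma> i)"
    proof (intro sum.cong refl)
      fix i k assume ik: "i \<in> {..<2*m}" "k \<in> {..<2*m}"
      have "I k i *\<^sub>R (\<gamma> i ** (cl v ** \<gamma> k)) = I k i *\<^sub>R (- (\<gamma> i ** \<gamma> k ** cl v) - (2 * v k) *\<^sub>R \<gamma> i)"
        using ik by (simp add: cl_gamma matrix_mult_linear matrix_mul_assoc)
      then show "I k i *\<^sub>R (\<gamma> i ** (cl v ** \<gamma> k)) = I i k *\<^sub>R (\<gamma> i ** \<gamma> k ** cl v) - (2 * (I k i * v k)) *\<^sub>R \<gamma> i"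
        using skew[of i k] ik by (simp add: scaleR_diff_right mult.left_commute)
    qed
    also have "\<dots> = quad I ** cl v - (\<Sum>i<2*m. (2 * (\<Sum>k<2*m. I k i * v k)) *\<^sub>R \<gamma> i)"
      by (simp add: sum_subtractf quad_def matrix_mult_linear scaleR_sum_left sum_distrib_left)
    also have "(\<Sum>i<2*m. (2 * (\<Sum>k<2*m. I k i * v k)) *\<^sub>R \<gamma> i) = 2 *\<^sub>R cl f"
      unfolding cl_def scaleR_sum_right by (intro sum.cong) (simp_all add: f)
    finally show ?thesis .
  qed
  \<comment> \<open>Each sandwich of \<open>cl f\<close> between two copies of the i-th generator is
    cl f - 2 f_i times that generator; 2m copies of the first minus twice \<open>cl f\<close> give
    2m - 2.\<close>
  have A4: "?S (\<lambda>i j k. if i = k then f j else 0) = (2 * real m - 2) *\<^sub>R cl f"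
  proof -
    have "?S (\<lambda>i j k. if i = k then f j else 0) = (\<Sum>i<2*m. \<gamma> i ** (cl f ** \<gamma> i))"
      unfolding sum_gamma_quad
    proof (rule sum.cong[OF refl])
      fix i assume i: "i \<in> {..<2*m}"
      have "(\<Sum>j<2*m. \<Sum>k<2*m. (if i = k then f j else 0) *\<^sub>R (\<gamma> i ** \<gamma> j ** \<gamma> k)) =
         (\<Sum>j<2*m. \<Sum>k<2*m. if i = k then f j *\<^sub>R (\<gamma> i ** \<gamma> j ** \<gamma> i) else 0)"
        by (intro sum.cong) auto
      then show "(\<Sum>j<2*m. \<Sum>k<2*m. (if i = k then f j else 0) *\<^sub>R (\<gamma> i ** \<gamma> j ** \<gamma> k)) = \<gamma> i ** (cl f ** \<gamma> i)"
        using i by (simp add: cl_def matrix_mult_linear matrix_mul_assoc)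
    qed
    also have "\<dots> = (\<Sum>i<2*m. cl f - 2 *\<^sub>R (f i *\<^sub>R \<gamma> i))"
      by (intro sum.cong refl)
        (simp add: cl_gamma matrix_mult_linear matrix_mul_assoc gamma_square)
    also have "\<dots> = (2 * real m - 2) *\<^sub>R cl f"
      unfolding sum_subtractf scaleR_sum_right[symmetric] cl_def[symmetric] sum_constant_scaleR scaleR_diff_left
      by simp
    finally show ?thesis .
  qed
  have A5: "?S (\<lambda>i j k. if i = j then f k else 0) = (- 2 * real m) *\<^sub>R cl f"
  proof -
    have "?S (\<lambda>i j k. if i = j then f k else 0) = (\<Sum>i<2*m. - cl f)"
      unfolding sum_gamma_quad
    proof (rule sum.cong[OF refl])
      fix i assume i: "i \<in> {..<2*m}"
      have "(\<Sum>j<2*m. \<Sum>k<2*m. (if i = j then f k else 0) *\<^sub>R (\<gamma> i ** \<gamma> j ** \<gamma> k)) =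
         (\<Sum>j<2*m. if i = j then \<Sum>k<2*m. f k *\<^sub>R (\<gamma> i ** \<gamma> i ** \<gamma> k) else 0)"
        by (intro sum.cong) auto
      then show "(\<Sum>j<2*m. \<Sum>k<2*m. (if i = j then f k else 0) *\<^sub>R (\<gamma> i ** \<gamma> j ** \<gamma> k)) = - cl f"
        using i by (simp add: cl_def matrix_mult_linear gamma_square sum_negf)
    qed
    then show ?thesis unfolding sum_constant_scaleR by simp
  qed
  \<comment> \<open>Commutation with \<open>quad I\<close> acts on vectors as -4 times the matrix I;
    as I is skew and f is its transpose applied to v, the result is 4 f.\<close>
  have C: "quad I ** cl v - cl v ** quad I = 4 *\<^sub>R cl f"
  proof -
    have "quad I ** cl v - cl v ** quad I = (\<Sum>j<2*m. v j *\<^sub>R (quad I ** \<gamma> j - \<gamma> j ** quad I))"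
      by (simp add: cl_def matrix_mult_linear sum_subtractf scaleR_diff_right)
    also have "\<dots> = (\<Sum>j<2*m. \<Sum>k<2*m. (4 * (I j k * v j)) *\<^sub>R \<gamma> k)"
    proof (rule sum.cong[OF refl])
      fix j assume j: "j \<in> {..<2*m}"
      have "v j *\<^sub>R cl (\<lambda>k. - 4 * I k j) = (\<Sum>k<2*m. (4 * (I j k * v j)) *\<^sub>R \<gamma> k)"
        unfolding cl_def scaleR_sum_right
      proof (rule sum.cong[OF refl])
        fix k assume "k \<in> {..<2*m}"
        then have "v j * (- 4 * I k j) = 4 * (I j k * v j)" using skew[of j k] j by simp
        then show "v j *\<^sub>R (- 4 * I k j) *\<^sub>R \<gamma> k = (4 * (I j k * v j)) *\<^sub>R \<gamma> k" by (simp only: scaleR_scaleR)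
      qed
      then show "v j *\<^sub>R (quad I ** \<gamma> j - \<gamma> j ** quad I) = (\<Sum>k<2*m. (4 * (I j k * v j)) *\<^sub>R \<gamma> k)"
        using quad_commutator[of I j, OF skew] j by simp
    qed
    also have "\<dots> = (\<Sum>k<2*m. (4 * f k) *\<^sub>R \<gamma> k)"
      by (subst sum.swap) (simp add: f scaleR_sum_left sum_distrib_left)
    finally show ?thesis by (simp add: cl_def scaleR_sum_right)
  qed
  have "?S b = ?S (\<lambda>i j k. I i j * v k) - ?S (\<lambda>i j k. I j k * v i) + ?S (\<lambda>i j k. I k i * v j)
      + ?S (\<lambda>i j k. if i = k then f j else 0) - ?S (\<lambda>i j k. if i = j then f k else 0)"
    unfolding b_def sum_gamma_quad
    by (simp add: scaleR_add_left scaleR_diff_left sum.distrib sum_subtractf)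
  \<comment> \<open>\<open>quad I\<close> is moved to the right of \<open>cl v\<close>, where it
    meets the spinor first and can be replaced by its eigenvalue. The two commutators give 8, the
    other terms -2 + (2m - 2) + 2m.\<close>
  also have "\<dots> = (quad I ** cl v - cl v ** quad I) + (quad I ** cl v - cl v ** quad I) + cl v ** quad I
      + (4 * real m - 4) *\<^sub>R cl f"
  proof -
    have "x - y + (x - a) + b - c = (x - y) + (x - y) + y + (- a + b - c)" for x y a b c :: "complex^'s^'s"
      by simp
    moreover have "(4 * real m - 4) *\<^sub>R cl f = - (2 *\<^sub>R cl f) + (2 * real m - 2) *\<^sub>R cl f - (- 2 * real m) *\<^sub>R cl f"
      unfolding scaleR_minus_left[symmetric] scaleR_add_left[symmetric] scaleR_diff_left[symmetric]
      by (rule arg_cong[where f = "\<lambda>r. r *\<^sub>R cl f"]) simp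
    ultimately show ?thesis unfolding A1 A2 A3 A4 A5 by (simp only:)
  qed
  also have "\<dots> = (4 * (real m + 1)) *\<^sub>R cl f + cl v ** quad I"
  proof -
    have "4 *\<^sub>R cl f + 4 *\<^sub>R cl f + (4 * real m - 4) *\<^sub>R cl f = (4 * (real m + 1)) *\<^sub>R cl f"
      unfolding scaleR_add_left[symmetric] by (rule arg_cong[where f = "\<lambda>r. r *\<^sub>R cl f"]) simp
    moreover have "x + x + y + z = (x + x + z) + y" for x y z :: "complex^'s^'s" by simp
    ultimately show ?thesis unfolding C by metis
  qed
  finally show ?thesis .
qed

end


section \<open>Forms of type (m+1,0)\<close>

lemma fun_upd_swap:
  assumes "i \<noteq> j"
  shows "Y \<circ> Transposition.transpose i j = Y(i := Y j, j := Y i)"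
  using assms by (auto simp: fun_eq_iff Transposition.transpose_def)

context ph_mfd
begin

text \<open>The conditions on \<open>canonical_fibre\<close>, except for the normalisation off the tangent space.\<close>

definition cform :: "'p \<Rightarrow> ((nat \<Rightarrow> 'p tvec) \<Rightarrow> complex) \<Rightarrow> bool" where
  "cform x \<zeta> \<longleftrightarrow> (\<forall>Y Z. (\<forall>i\<le>m. Y i = Z i) \<longrightarrow> \<zeta> Y = \<zeta> Z) \<and>
     (\<forall>Y. (\<forall>i\<le>m. Y i \<in> tangent M x) \<longrightarrow>
        (\<forall>i\<le>m. \<forall>v\<in>tangent M x.
           (\<forall>w\<in>tangent M x. \<zeta> (Y(i := v + w)) = \<zeta> (Y(i := v)) + \<zeta> (Y(i := w))) \<and>
           (\<forall>c. \<zeta> (Y(i := tscale c v)) = of_real c * \<zeta> (Y(i := v)))) \<and>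
        (\<forall>i\<le>m. \<forall>j\<le>m. i \<noteq> j \<and> Y i = Y j \<longrightarrow> \<zeta> Y = 0) \<and>
        (\<forall>v\<in>hdist M x. \<zeta> (Y(0 := v)) + \<i> * \<zeta> (Y(0 := J x v)) = 0))"

definition tans :: "'p \<Rightarrow> (nat \<Rightarrow> 'p tvec) \<Rightarrow> bool" where
  "tans x Y \<longleftrightarrow> (\<forall>i\<le>m. Y i \<in> tangent M x)"

lemma tans_upd: "tans x Y \<Longrightarrow> v \<in> tangent M x \<Longrightarrow> tans x (Y(i := v))"
  by (simp add: tans_def)

lemma canonical_cform: "\<eta> \<in> canonical_fibre m M x \<Longrightarrow> cform x \<eta>"
  unfolding canonical_fibre_def cform_def mem_Collect_eq by (elim conjE, intro conjI; assumption)

lemma cformD: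
  assumes "cform x \<zeta>"
  shows "(\<And>i. i \<le> m \<Longrightarrow> Y i = Z i) \<Longrightarrow> \<zeta> Y = \<zeta> Z"
    "tans x Y \<Longrightarrow> i \<le> m \<Longrightarrow> v \<in> tangent M x \<Longrightarrow> w \<in> tangent M x \<Longrightarrow> \<zeta> (Y(i := v + w)) = \<zeta> (Y(i := v)) + \<zeta> (Y(i := w))"
    "tans x Y \<Longrightarrow> i \<le> m \<Longrightarrow> v \<in> tangent M x \<Longrightarrow> \<zeta> (Y(i := tscale c v)) = of_real c * \<zeta> (Y(i := v))"
    "tans x Y \<Longrightarrow> i \<le> m \<Longrightarrow> j \<le> m \<Longrightarrow> i \<noteq> j \<Longrightarrow> Y i = Y j \<Longrightarrow> \<zeta> Y = 0"
    "tans x Y \<Longrightarrow> v \<in> hdist M x \<Longrightarrow> \<zeta> (Y(0 := v)) + \<i> * \<zeta> (Y(0 := J x v)) = 0"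
proof -
  have a: "\<forall>Y Z. (\<forall>i\<le>m. Y i = Z i) \<longrightarrow> \<zeta> Y = \<zeta> Z"
    and b: "\<forall>Y. (\<forall>i\<le>m. Y i \<in> tangent M x) \<longrightarrow>
        (\<forall>i\<le>m. \<forall>v\<in>tangent M x.
           (\<forall>w\<in>tangent M x. \<zeta> (Y(i := v + w)) = \<zeta> (Y(i := v)) + \<zeta> (Y(i := w))) \<and>
           (\<forall>c. \<zeta> (Y(i := tscale c v)) = of_real c * \<zeta> (Y(i := v)))) \<and>
        (\<forall>i\<le>m. \<forall>j\<le>m. i \<noteq> j \<and> Y i = Y j \<longrightarrow> \<zeta> Y = 0) \<and>
        (\<forall>v\<in>hdist M x. \<zeta> (Y(0 := v)) + \<i> * \<zeta> (Y(0 := J x v)) = 0)"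
    using assms unfolding cform_def by simp_all
  show "(\<And>i. i \<le> m \<Longrightarrow> Y i = Z i) \<Longrightarrow> \<zeta> Y = \<zeta> Z" using a by simp
  show "tans x Y \<Longrightarrow> i \<le> m \<Longrightarrow> v \<in> tangent M x \<Longrightarrow> w \<in> tangent M x \<Longrightarrow> \<zeta> (Y(i := v + w)) = \<zeta> (Y(i := v)) + \<zeta> (Y(i := w))"
    "tans x Y \<Longrightarrow> i \<le> m \<Longrightarrow> v \<in> tangent M x \<Longrightarrow> \<zeta> (Y(i := tscale c v)) = of_real c * \<zeta> (Y(i := v))"
    "tans x Y \<Longrightarrow> i \<le> m \<Longrightarrow> j \<le> m \<Longrightarrow> i \<noteq> j \<Longrightarrow> Y i = Y j \<Longrightarrow> \<zeta> Y = 0"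
    "tans x Y \<Longrightarrow> v \<in> hdist M x \<Longrightarrow> \<zeta> (Y(0 := v)) + \<i> * \<zeta> (Y(0 := J x v)) = 0"
    using b[rule_format, of Y] unfolding tans_def by blast+
qed

lemma cformI:
  assumes "\<And>Y Z. (\<And>i. i \<le> m \<Longrightarrow> Y i = Z i) \<Longrightarrow> \<zeta> Y = \<zeta> Z"
    "\<And>Y i v w. tans x Y \<Longrightarrow> i \<le> m \<Longrightarrow> v \<in> tangent M x \<Longrightarrow> w \<in> tangent M x \<Longrightarrow> \<zeta> (Y(i := v + w)) = \<zeta> (Y(i := v)) + \<zeta> (Y(i := w))"
    "\<And>Y i v c. tans x Y \<Longrightarrow> i \<le> m \<Longrightarrow> v \<in> tangent M x \<Longrightarrow> \<zeta> (Y(i := tscale c v)) = of_real c * \<zeta> (Y(i := v))"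
    "\<And>Y i j. tans x Y \<Longrightarrow> i \<le> m \<Longrightarrow> j \<le> m \<Longrightarrow> i \<noteq> j \<Longrightarrow> Y i = Y j \<Longrightarrow> \<zeta> Y = 0"
    "\<And>Y v. tans x Y \<Longrightarrow> v \<in> hdist M x \<Longrightarrow> \<zeta> (Y(0 := v)) + \<i> * \<zeta> (Y(0 := J x v)) = 0"
  shows "cform x \<zeta>"
  unfolding cform_def
proof (intro conjI allI impI ballI)
  show "\<zeta> Y = \<zeta> Z" if "\<forall>i\<le>m. Y i = Z i" for Y Z using that by (intro assms(1)) simp
next
  fix Y assume t: "\<forall>i\<le>m. Y i \<in> tangent M x"
  then have Y: "tans x Y" by (simp add: tans_def)
  show "\<zeta> (Y(i := v + w)) = \<zeta> (Y(i := v)) + \<zeta> (Y(i := w))"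
    if "i \<le> m" "v \<in> tangent M x" "w \<in> tangent M x" for i v w using assms(2)[OF Y that] .
  show "\<zeta> (Y(i := tscale c v)) = of_real c * \<zeta> (Y(i := v))" if "i \<le> m" "v \<in> tangent M x" for i v c
    using assms(3)[OF Y that] .
  show "\<zeta> Y = 0" if "i \<le> m" "j \<le> m" "i \<noteq> j \<and> Y i = Y j" for i j
    using assms(4)[OF Y that(1,2)] that(3) by simp
  show "\<zeta> (Y(0 := v)) + \<i> * \<zeta> (Y(0 := J x v)) = 0" if "v \<in> hdist M x" for v using assms(5)[OF Y that] .
qed

lemma cform_lincomb:
  assumes z: "cform x \<zeta>" and e: "cform x \<eta>"
  shows "cform x (\<lambda>Y. a * \<zeta> Y + b * \<eta> Y)"
proof (rule cformI)
  show "a * \<zeta> Y + b * \<eta> Y = a * \<zeta> Z + b * \<eta> Z" if "\<And>i. i \<le> m \<Longrightarrow> Y i = Z i" for Y Z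
    using cformD(1)[OF z that] cformD(1)[OF e that] by simp
  show "a * \<zeta> (Y(0 := v)) + b * \<eta> (Y(0 := v)) + \<i> * (a * \<zeta> (Y(0 := J x v)) + b * \<eta> (Y(0 := J x v))) = 0"
    if "tans x Y" "v \<in> hdist M x" for Y v
  proof -
    have "a * \<zeta> (Y(0 := v)) + b * \<eta> (Y(0 := v)) + \<i> * (a * \<zeta> (Y(0 := J x v)) + b * \<eta> (Y(0 := J x v))) =
      a * (\<zeta> (Y(0 := v)) + \<i> * \<zeta> (Y(0 := J x v))) + b * (\<eta> (Y(0 := v)) + \<i> * \<eta> (Y(0 := J x v)))"
      by (simp add: algebra_simps)
    then show ?thesis using cformD(5)[OF z that] cformD(5)[OF e that] by simp
  qed
qed (simp_all add: cformD(2,3)[OF z] cformD(2,3)[OF e] cformD(4)[OF z] cformD(4)[OF e] algebra_simps)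

text \<open>Polarisation: the form vanishes when both slots hold v + w.\<close>

lemma cform_swap:
  assumes z: "cform x \<zeta>" and Y: "tans x Y" and ij: "i \<le> m" "j \<le> m" "i \<noteq> j"
    and v: "v \<in> tangent M x" "w \<in> tangent M x"
  shows "\<zeta> (Y(i := v, j := w)) = - \<zeta> (Y(i := w, j := v))"
proof -
  have t: "tans x (Y(i := u))" "tans x (Y(j := u))" if "u \<in> tangent M x" for u using Y that by (simp_all add: tans_upd)
  have tw: "Y(i := a, j := b) = Y(j := b, i := a)" for a b using ij(3) by (rule fun_upd_twist)
  have s: "v + w \<in> tangent M x" using v by (rule tangent_closed)
  have z0: "\<zeta> (Y(i := u, j := u)) = 0" if "u \<in> tangent M x" for u
    by (rule cformD(4)[OF z _ ij]) (use that Y ij in \<open>simp_all add: tans_upd\<close>)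
  have "0 = \<zeta> (Y(i := v + w, j := v + w))" using z0[OF s] by simp
  also have "\<dots> = \<zeta> (Y(i := v + w, j := v)) + \<zeta> (Y(i := v + w, j := w))"
    by (rule cformD(2)[OF z t(1)[OF s] ij(2) v])
  also have "\<zeta> (Y(i := v + w, j := v)) = \<zeta> (Y(i := v, j := v)) + \<zeta> (Y(i := w, j := v))"
    unfolding tw by (rule cformD(2)[OF z t(2)[OF v(1)] ij(1) v])
  also have "\<zeta> (Y(i := v + w, j := w)) = \<zeta> (Y(i := v, j := w)) + \<zeta> (Y(i := w, j := w))"
    unfolding tw by (rule cformD(2)[OF z t(2)[OF v(2)] ij(1) v])
  finally have eq: "0 = \<zeta> (Y(i := v, j := v)) + \<zeta> (Y(i := w, j := v)) + (\<zeta> (Y(i := v, j := w)) + \<zeta> (Y(i := w, j := w)))" .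
  have "a = - b" if "0 = p + b + (a + q)" "p = 0" "q = 0" for a b p q :: complex
    using that by (simp add: eq_neg_iff_add_eq_0 add.commute)
  from this[OF eq z0[OF v(1)] z0[OF v(2)]] show ?thesis .
qed

text \<open>The type condition is imposed on slot 0 only; antisymmetry transports it to every
  slot.\<close>

lemma cform_J:
  assumes z: "cform x \<zeta>" and Y: "tans x Y" and i: "i \<le> m" and v: "v \<in> hdist M x"
  shows "\<zeta> (Y(i := J x v)) = \<i> * \<zeta> (Y(i := v))"
proof -
  have 0: "\<zeta> (Z(0 := J x v)) = \<i> * \<zeta> (Z(0 := v))" if "tans x Z" for Z
  proof -
    have "\<i> * (\<zeta> (Z(0 := v)) + \<i> * \<zeta> (Z(0 := J x v))) = 0" using cformD(5)[OF z that v] by simp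
    then show ?thesis by (simp add: algebra_simps)
  qed
  show ?thesis
  proof (cases "i = 0")
    case True
    with 0[OF Y] show ?thesis by simp
  next
    case False
    have Y0: "Y 0 \<in> tangent M x" using Y by (simp add: tans_def)
    have sw: "\<zeta> (Y(i := u)) = - \<zeta> (Y(i := Y 0, 0 := u))" if "u \<in> tangent M x" for u
    proof -
      have "Y(i := u) = Y(i := u, 0 := Y 0)" using False by (auto simp: fun_eq_iff)
      then show ?thesis using cform_swap[OF z Y i le0 False that Y0] by simp
    qed
    show ?thesis
      using sw[of v] sw[of "J x v"] 0[OF tans_upd[OF Y Y0]] v by (simp add: hdist_tangent J_hdist)
  qed
qed

section \<open>Unitary frames and their dual coframes\<close>

definition cframe :: "'p \<Rightarrow> (nat \<Rightarrow> 'p tvec) \<Rightarrow> nat \<Rightarrow> 'p tvec" where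
  "cframe x e = case_nat (T x) e"

text \<open>The coframe dual to \<open>cframe\<close>: \<theta> in position 0, then the (1,0)-forms
  dual to the unitary frame. The sign of the imaginary part is the one for which J acts as
  multiplication by i.\<close>

definition coord :: "'p \<Rightarrow> (nat \<Rightarrow> 'p tvec) \<Rightarrow> nat \<Rightarrow> 'p tvec \<Rightarrow> complex" where
  "coord x e j v = (case j of 0 \<Rightarrow> of_real (\<theta> x v) | Suc a \<Rightarrow> Complex (g x v (e a)) (g x v (J x (e a))))"

lemma cframe_simps [simp]: "cframe x e 0 = T x" "cframe x e (Suc a) = e a"
  by (simp_all add: cframe_def)

lemma unitaryD:
  assumes "unitary_frame m M \<theta> x e" "a < m"
  shows "e a \<in> hdist M x" "b < m \<Longrightarrow> g x (e a) (e b) = (if a = b then 1 else 0)"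
    "b < m \<Longrightarrow> g x (e a) (J x (e b)) = 0"
  using assms unfolding unitary_iff by blast+

lemma tans_cframe:
  assumes "unitary_frame m M \<theta> x e"
  shows "tans x (cframe x e)"
  using unitaryD(1)[OF assms] reeb(1)
  by (auto simp: tans_def cframe_def hdist_tangent split: nat.split)

text \<open>Lets a property of one slot of a form be checked on T, e_a and J e_a, without expanding
  a vector and distributing the form over the sum.\<close>

lemma tangent_unitary_induct:
  assumes e: "unitary_frame m M \<theta> x e" and v: "v \<in> tangent M x"
    and add: "\<And>v w. v \<in> tangent M x \<Longrightarrow> w \<in> tangent M x \<Longrightarrow> Q v \<Longrightarrow> Q w \<Longrightarrow> Q (v + w)"
    and scale: "\<And>v c. v \<in> tangent M x \<Longrightarrow> Q v \<Longrightarrow> Q (tscale c v)"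
    and W: "\<And>j. j \<le> m \<Longrightarrow> Q (cframe x e j)" and JW: "\<And>a. a < m \<Longrightarrow> Q (J x (e a))"
  shows "Q v"
proof -
  have sub: "tv.subspace {v \<in> tangent M x. Q v}"
  proof (rule tv.subspaceI)
    show "0 \<in> {v \<in> tangent M x. Q v}" using scale[OF reeb(1)[of x], of 0] W[of 0] by (simp add: tangent_closed)
  qed (auto simp: tangent_closed intro: add scale)
  have T: "T x \<in> {v \<in> tangent M x. Q v}" using W[of 0] reeb(1) by simp
  have eS: "e a \<in> {v \<in> tangent M x. Q v}" if "a < m" for a
    using W[of "Suc a"] that unitaryD(1)[OF e that] by (simp add: hdist_tangent)
  have JS: "J x (e a) \<in> {v \<in> tangent M x. Q v}" if "a < m" for a
    using JW[OF that] that unitaryD(1)[OF e that] by (simp add: hdist_tangent J_hdist)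
  define h where "h = v - tscale (\<theta> x v) (T x)"
  have "h \<in> hdist M x"
    using v reeb(1,2) by (subst theta_hdist_iff[symmetric]) (auto simp: h_def theta_lin tangent_closed)
  from unitary_expand[OF e this]
  have "h \<in> {v \<in> tangent M x. Q v}"
    by (rule ssubst) (intro tv.subspace_sum[OF sub] tv.subspace_add[OF sub] tv.subspace_scale[OF sub] eS JS, auto)
  then have "h + tscale (\<theta> x v) (T x) \<in> {v \<in> tangent M x. Q v}"
    by (intro tv.subspace_add[OF sub] tv.subspace_scale[OF sub] T)
  then show ?thesis by (simp add: h_def)
qed

lemma coord_lin:
  assumes e: "unitary_frame m M \<theta> x e" and j: "j \<le> m" and v: "v \<in> tangent M x"
  shows "w \<in> tangent M x \<Longrightarrow> coord x e j (v + w) = coord x e j v + coord x e j w"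
    "coord x e j (tscale c v) = of_real c * coord x e j v"
    "v \<in> hdist M x \<Longrightarrow> coord x e j (J x v) = \<i> * coord x e j v"
proof -
  have a: "e a \<in> hdist M x" "J x (e a) \<in> hdist M x" if "a < m" for a
    using unitaryD(1)[OF e that] by (simp_all add: J_hdist)
  have g1: "g x (v + w) u = g x v u + g x w u" if "w \<in> tangent M x" "u \<in> hdist M x" for u w
    using that v by (simp add: metric_def d_add hdist_tangent J_hdist)
  have g2: "g x (tscale c v) u = c * g x v u" if "u \<in> hdist M x" for u
    using that v by (simp add: metric_def d_scale hdist_tangent J_hdist)
  show "coord x e j (v + w) = coord x e j v + coord x e j w" if "w \<in> tangent M x"
    using v that j a
    by (cases j) (simp_all add: coord_def theta_lin g1 complex_eq_iff)
  show "coord x e j (tscale c v) = of_real c * coord x e j v"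
    using v j a by (cases j) (simp_all add: coord_def theta_lin g2 complex_eq_iff)
  show "coord x e j (J x v) = \<i> * coord x e j v" if "v \<in> hdist M x"
    using that j a by (cases j) (simp_all add: coord_def theta_hdist J_hdist g_J_left J_J g_minus complex_eq_iff)
qed

lemma coord_cframe:
  assumes e: "unitary_frame m M \<theta> x e" and "i \<le> m" "j \<le> m"
  shows "coord x e j (cframe x e i) = (if i = j then 1 else 0)"
proof -
  have T0: "g x (T x) u = 0" if "u \<in> hdist M x" for u
    using that by (simp add: metric_def reeb(3) hdist_tangent J_hdist)
  show ?thesis
    using assms unitaryD[OF e] T0
    by (cases i; cases j) (auto simp: coord_def reeb(2) theta_hdist J_hdist complex_eq_iff)
qed

text \<open>Any other frame vector in slot \<open>k\<close> repeats an argument and gives 0, and J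
  e_a gives i times the value on e_a, in step with the complex linearity of
  \<open>coord\<close>.\<close>

lemma cform_slot:
  assumes z: "cform x \<zeta>" and e: "unitary_frame m M \<theta> x e" and k: "k \<le> m" and v: "v \<in> tangent M x"
  shows "\<zeta> ((cframe x e)(k := v)) = coord x e k v * \<zeta> (cframe x e)"
proof (rule tangent_unitary_induct[OF e v])
  note W = tans_cframe[OF e]
  show j: "\<zeta> ((cframe x e)(k := cframe x e j)) = coord x e k (cframe x e j) * \<zeta> (cframe x e)" if "j \<le> m" for j
  proof (cases "j = k")
    case True
    then show ?thesis using coord_cframe[OF e k k] by simp
  next
    case False
    have "tans x ((cframe x e)(k := cframe x e j))" using W that by (intro tans_upd) (simp_all add: tans_def)
    from cformD(4)[OF z this that k False] False show ?thesis
      using coord_cframe[OF e that k] by simp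
  qed
  show "\<zeta> ((cframe x e)(k := J x (e a))) = coord x e k (J x (e a)) * \<zeta> (cframe x e)" if "a < m" for a
    using j[of "Suc a"] that cform_J[OF z W k unitaryD(1)[OF e that]]
      coord_lin(3)[OF e k hdist_tangent[OF unitaryD(1)[OF e that]] unitaryD(1)[OF e that]] by simp
  show "\<zeta> ((cframe x e)(k := v + w)) = coord x e k (v + w) * \<zeta> (cframe x e)"
    if "v \<in> tangent M x" "w \<in> tangent M x" "\<zeta> ((cframe x e)(k := v)) = coord x e k v * \<zeta> (cframe x e)"
      "\<zeta> ((cframe x e)(k := w)) = coord x e k w * \<zeta> (cframe x e)" for v w
    by (simp only: cformD(2)[OF z W k that(1,2)] that coord_lin(1)[OF e k that(1,2)] distrib_right)
  show "\<zeta> ((cframe x e)(k := tscale c v)) = coord x e k (tscale c v) * \<zeta> (cframe x e)"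
    if "v \<in> tangent M x" "\<zeta> ((cframe x e)(k := v)) = coord x e k v * \<zeta> (cframe x e)" for v c
    by (simp only: cformD(3)[OF z W k that(1)] that coord_lin(2)[OF e k that(1)] mult.assoc)
qed

section \<open>The canonical fibre is a complex line\<close>

lemma cform_perm:
  assumes z: "cform x \<zeta>" and Y: "tans x Y" and p: "p permutes {..m}"
  shows "\<zeta> (Y \<circ> p) = of_int (sign p) * \<zeta> Y"
  using finite_atMost p
proof (induction p rule: permutes_rev_induct)
  case (swap a b p)
  have Yp: "tans x (Y \<circ> p)" using Y permutes_in_image[OF swap.hyps(4)] by (auto simp: tans_def)
  have ab: "(Y \<circ> p) a \<in> tangent M x" "(Y \<circ> p) b \<in> tangent M x" using Yp swap.hyps by (auto simp: tans_def)
  have "Y \<circ> (p \<circ> Transposition.transpose a b) = (Y \<circ> p) \<circ> Transposition.transpose a b" by (simp add: o_assoc)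
  also have "\<dots> = (Y \<circ> p)(a := (Y \<circ> p) b, b := (Y \<circ> p) a)" by (rule fun_upd_swap[OF swap.hyps(3)])
  finally have "\<zeta> (Y \<circ> (p \<circ> Transposition.transpose a b)) = - \<zeta> ((Y \<circ> p)(a := (Y \<circ> p) a, b := (Y \<circ> p) b))"
    using cform_swap[OF z Yp _ _ swap.hyps(3) ab(2,1)] swap.hyps by (simp only: atMost_iff)
  also have "\<dots> = - of_int (sign p) * \<zeta> Y" by (simp only: fun_upd_triv swap.IH mult_minus_left)
  also have "- of_int (sign p) = (of_int (sign (p \<circ> Transposition.transpose a b)) :: complex)"
    using swap.hyps permutes_imp_permutation[OF finite_atMost swap.hyps(4)]
    by (simp add: sign_compose permutation_swap_id sign_swap_id)
  finally show ?case .
qed simp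

text \<open>Multilinearity and the type condition reduce every slot to frame vectors. A tuple of
  frame vectors either repeats one of them or is a permutation of the frame.\<close>

lemma cform_zero:
  assumes z: "cform x \<zeta>" and e: "unitary_frame m M \<theta> x e" and 0: "\<zeta> (cframe x e) = 0" and Y: "tans x Y"
  shows "\<zeta> Y = 0"
proof -
  let ?W = "cframe x e"
  note W = tans_cframe[OF e]
  have base: "\<zeta> Y = 0" if Y: "\<And>i. i \<le> m \<Longrightarrow> \<phi> i \<le> m \<and> Y i = ?W (\<phi> i)" for Y \<phi>
  proof (cases "inj_on \<phi> {..m}")
    case True
    define p where "p i = (if i \<le> m then \<phi> i else i)" for i
    have "\<phi> ` {..m} = {..m}" using Y by (intro endo_inj_surj True) auto
    then have "bij_betw p {..m} {..m}"
      using True by (auto simp: bij_betw_def p_def inj_on_def image_def)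
    then have p: "p permutes {..m}" by (rule bij_imp_permutes) (simp add: p_def)
    have "\<zeta> Y = \<zeta> (?W \<circ> p)" by (rule cformD(1)[OF z]) (use Y in \<open>simp add: p_def\<close>)
    then show ?thesis using cform_perm[OF z W p] 0 by simp
  next
    case False
    then obtain i j where ij: "i \<le> m" "j \<le> m" "i \<noteq> j" "\<phi> i = \<phi> j" by (auto simp: inj_on_def)
    have "tans x Y" using Y W by (auto simp: tans_def)
    from cformD(4)[OF z this ij(1-3)] show ?thesis using ij Y by simp
  qed
  \<comment> \<open>\<open>k\<close> counts the slots that are still arbitrary; from slot
    \<open>k\<close> on they hold frame vectors, and \<phi> records which ones.\<close>
  have claim: "\<zeta> Y = 0" if "k \<le> Suc m" "tans x Y" "\<And>i. k \<le> i \<Longrightarrow> i \<le> m \<Longrightarrow> \<phi> i \<le> m \<and> Y i = ?W (\<phi> i)" for k Y \<phi>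
    using that
  proof (induction k arbitrary: Y \<phi>)
    case 0
    then show ?case by (intro base[of \<phi>]) auto
  next
    case (Suc k)
    have k: "k \<le> m" using Suc.prems by simp
    have WW: "\<zeta> (Y(k := ?W j)) = 0" if "j \<le> m" for j
    proof (rule Suc.IH[of _ "\<phi>(k := j)"])
      show "tans x (Y(k := ?W j))" using W that by (intro tans_upd Suc.prems) (auto simp: tans_def)
      show "(\<phi>(k := j)) i \<le> m \<and> (Y(k := ?W j)) i = ?W ((\<phi>(k := j)) i)" if "k \<le> i" "i \<le> m" for i
        using Suc.prems(3)[of i] that \<open>j \<le> m\<close> by auto
    qed (use k in simp)
    have "\<zeta> (Y(k := Y k)) = 0"
    proof (rule tangent_unitary_induct[OF e, where Q = "\<lambda>v. \<zeta> (Y(k := v)) = 0"])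
      show "Y k \<in> tangent M x" using Suc.prems k by (simp add: tans_def)
      show "\<zeta> (Y(k := J x (e a))) = 0" if "a < m" for a
        using WW[of "Suc a"] that cform_J[OF z Suc.prems(2) k unitaryD(1)[OF e that]] by simp
    qed (simp_all add: cformD(2,3)[OF z Suc.prems(2) k] WW)
    then show ?case by simp
  qed
  show ?thesis by (rule claim[of "Suc m"]) (use Y in auto)
qed

text \<open>The wedge product of the coframe, written as the determinant of the coordinate matrix of
  \<open>Y\<close>.\<close>

definition Delta :: "'p \<Rightarrow> (nat \<Rightarrow> 'p tvec) \<Rightarrow> (nat \<Rightarrow> 'p tvec) \<Rightarrow> complex" where
  "Delta x e Y = (\<Sum>p | p permutes {..m}. of_int (sign p) * (\<Prod>i\<le>m. coord x e (p i) (Y i)))"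

lemma Delta_upd:
  assumes "i \<le> m"
  shows "Delta x e (Y(i := v)) =
    (\<Sum>p | p permutes {..m}. of_int (sign p) * (\<Prod>l\<in>{..m} - {i}. coord x e (p l) (Y l)) * coord x e (p i) v)"
  unfolding Delta_def
proof (rule sum.cong[OF refl])
  fix p
  have "(\<Prod>l\<le>m. coord x e (p l) ((Y(i := v)) l)) =
      coord x e (p i) v * (\<Prod>l\<in>{..m} - {i}. coord x e (p l) ((Y(i := v)) l))"
    using assms by (subst prod.remove[of _ i]) simp_all
  also have "(\<Prod>l\<in>{..m} - {i}. coord x e (p l) ((Y(i := v)) l)) = (\<Prod>l\<in>{..m} - {i}. coord x e (p l) (Y l))"
    by (rule prod.cong) simp_all
  finally show "of_int (sign p) * (\<Prod>l\<le>m. coord x e (p l) ((Y(i := v)) l)) =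
      of_int (sign p) * (\<Prod>l\<in>{..m} - {i}. coord x e (p l) (Y l)) * coord x e (p i) v"
    by (simp add: ac_simps)
qed

lemma cform_Delta:
  assumes e: "unitary_frame m M \<theta> x e"
  shows "cform x (Delta x e)"
proof (rule cformI)
  show "Delta x e Y = Delta x e Z" if "\<And>i. i \<le> m \<Longrightarrow> Y i = Z i" for Y Z
    unfolding Delta_def using that by (intro sum.cong prod.cong arg_cong2[of _ _ _ _ times]) auto
  have pm: "p i \<le> m" if "p permutes {..m}" "i \<le> m" for p i
    using permutes_in_image[OF that(1), of i] that(2) by simp
  show "Delta x e (Y(i := v + w)) = Delta x e (Y(i := v)) + Delta x e (Y(i := w))"
    if "i \<le> m" "v \<in> tangent M x" "w \<in> tangent M x" for Y i v w
    unfolding Delta_upd[OF that(1)] sum.distrib[symmetric]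
    using that pm by (intro sum.cong refl) (simp add: coord_lin[OF e] algebra_simps)
  show "Delta x e (Y(i := tscale c v)) = of_real c * Delta x e (Y(i := v))"
    if "i \<le> m" "v \<in> tangent M x" for Y i v c
    unfolding Delta_upd[OF that(1)] sum_distrib_left
    using that pm by (intro sum.cong refl) (simp add: coord_lin[OF e] algebra_simps)
  show "Delta x e (Y(0 := v)) + \<i> * Delta x e (Y(0 := J x v)) = 0" if "v \<in> hdist M x" for Y v
    unfolding Delta_upd[OF le0] sum_distrib_left sum.distrib[symmetric]
    using that pm by (intro sum.neutral ballI) (simp add: coord_lin[OF e] hdist_tangent algebra_simps)
  show "Delta x e Y = 0" if ij: "i \<le> m" "j \<le> m" "i \<noteq> j" "Y i = Y j" for Y i j
  proof -
    let ?t = "Transposition.transpose i j"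
    have t: "?t permutes {..m}" using ij by (intro permutes_swap_id) auto
    have Yt: "Y (?t l) = Y l" for l using ij by (auto simp: Transposition.transpose_def)
    \<comment> \<open>Composing each permutation with the transposition of the two equal arguments
      flips its sign and leaves the product unchanged, so the sum equals its negative.\<close>
    have "Delta x e Y = (\<Sum>p | p permutes {..m}. of_int (sign (p \<circ> ?t)) * (\<Prod>l\<le>m. coord x e ((p \<circ> ?t) l) (Y l)))"
      unfolding Delta_def by (rule sum_permutations_compose_right[OF t])
    also have "\<dots> = (\<Sum>p | p permutes {..m}. - (of_int (sign p) * (\<Prod>l\<le>m. coord x e (p l) (Y l))))"
    proof (rule sum.cong[OF refl])
      fix p assume "p \<in> {p. p permutes {..m}}"
      then have p: "permutation p" by (auto intro: permutes_imp_permutation)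
      have "(\<Prod>l\<le>m. coord x e ((p \<circ> ?t) l) (Y l)) = (\<Prod>l\<le>m. coord x e (p l) (Y l))"
        by (subst (2) prod.permute[OF t]) (simp add: Yt)
      then show "of_int (sign (p \<circ> ?t)) * (\<Prod>l\<le>m. coord x e ((p \<circ> ?t) l) (Y l)) =
          - (of_int (sign p) * (\<Prod>l\<le>m. coord x e (p l) (Y l)))"
        using ij by (simp add: sign_compose[OF p permutation_swap_id] sign_swap_id)
    qed
    also have "\<dots> = - Delta x e Y" by (simp add: Delta_def sum_negf)
    finally show ?thesis by simp
  qed
qed

lemma Delta_frame:
  assumes e: "unitary_frame m M \<theta> x e"
  shows "Delta x e (cframe x e) = 1"
proof -
  have "of_int (sign p) * (\<Prod>i\<le>m. coord x e (p i) (cframe x e i)) = (if p = id then 1 else 0)"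
    if p: "p permutes {..m}" for p
  proof -
    have c: "coord x e (p i) (cframe x e i) = (if p i = i then 1 else 0)" if "i \<le> m" for i
      using coord_cframe[OF e that, of "p i"] permutes_in_image[OF p, of i] that by auto
    show ?thesis
    proof (cases "p = id")
      case True
      then show ?thesis using c by simp
    next
      case False
      then obtain i where i: "p i \<noteq> i" by (auto simp: fun_eq_iff)
      then have "i \<le> m" using permutes_not_in[OF p] by auto
      then have "(\<Prod>i\<le>m. coord x e (p i) (cframe x e i)) = 0" using i c by (intro prod_zero) auto
      then show ?thesis using False by simp
    qed
  qed
  then have "Delta x e (cframe x e) = (\<Sum>p | p permutes {..m}. if p = id then 1 else 0)"
    unfolding Delta_def by (intro sum.cong) auto
  then show ?thesis by (simp add: finite_permutations permutes_id)
qed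

text \<open>The difference of the two sides is a form that vanishes on the frame, so
  \<open>cform_zero\<close> applies: a form is determined by one complex number.\<close>

lemma cform_det:
  assumes z: "cform x \<zeta>" and e: "unitary_frame m M \<theta> x e" and Y: "tans x Y"
  shows "\<zeta> Y = Delta x e Y * \<zeta> (cframe x e)"
proof -
  have "1 * \<zeta> Y + (- \<zeta> (cframe x e)) * Delta x e Y = 0"
    by (rule cform_zero[OF cform_lincomb[OF z cform_Delta[OF e]] e _ Y]) (simp add: Delta_frame[OF e])
  then show ?thesis by (simp add: algebra_simps)
qed

text \<open>On horizontal vectors the entries are values of the Hermitian product g(u,w) + i g(u, J
  w), which is conjugate symmetric.\<close>

lemma coord_unitary:
  assumes e: "unitary_frame m M \<theta> x e" and e': "unitary_frame m M \<theta> x e'" and "i \<le> m" "j \<le> m"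
  shows "coord x e' j (cframe x e i) = cnj (coord x e i (cframe x e' j))"
proof -
  have T0: "g x (T x) u = 0" if "u \<in> hdist M x" for u
    using that by (simp add: metric_def reeb(3) hdist_tangent J_hdist)
  show ?thesis
  proof (cases i; cases j)
    fix a b assume ij: "i = Suc a" "j = Suc b"
    then have h: "e a \<in> hdist M x" "e' b \<in> hdist M x"
      using assms unitaryD(1)[OF e, of a] unitaryD(1)[OF e', of b] by auto
    have "g x (e' b) (J x (e a)) = - g x (e a) (J x (e' b))"
      using g_J_left[OF h] g_sym[OF J_hdist[OF h(1)] h(2)] by simp
    then show ?thesis using ij g_sym[OF h] by (simp add: coord_def complex_eq_iff)
  qed (use assms unitaryD(1)[OF e] unitaryD(1)[OF e'] T0 in
      \<open>auto simp: coord_def reeb(2) theta_hdist J_hdist complex_eq_iff\<close>)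
qed

text \<open>The coordinate matrices of two unitary frames are inverse and conjugate transposed to each other.\<close>

lemma Delta_unit:
  assumes e: "unitary_frame m M \<theta> x e" and e': "unitary_frame m M \<theta> x e'"
  shows "cmod (Delta x e (cframe x e')) = 1"
proof -
  have "Delta x e' (cframe x e) = (\<Sum>p | p permutes {..m}. of_int (sign (inv p)) * (\<Prod>i\<le>m. coord x e' (inv p i) (cframe x e i)))"
    unfolding Delta_def by (rule sum_permutations_inverse)
  also have "\<dots> = (\<Sum>p | p permutes {..m}. cnj (of_int (sign p) * (\<Prod>i\<le>m. coord x e (p i) (cframe x e' i))))"
  proof (rule sum.cong[OF refl])
    fix p assume "p \<in> {p. p permutes {..m}}"
    then have p: "p permutes {..m}" by simp
    have "(\<Prod>i\<le>m. coord x e' (inv p i) (cframe x e i)) = (\<Prod>i\<le>m. coord x e' (inv p (p i)) (cframe x e (p i)))"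
      by (subst prod.permute[OF p]) simp
    also have "\<dots> = (\<Prod>i\<le>m. cnj (coord x e (p i) (cframe x e' i)))"
      using permutes_in_image[OF p]
      by (intro prod.cong refl) (simp add: permutes_inverses[OF p] coord_unitary[OF e e'])
    finally show "of_int (sign (inv p)) * (\<Prod>i\<le>m. coord x e' (inv p i) (cframe x e i)) =
        cnj (of_int (sign p) * (\<Prod>i\<le>m. coord x e (p i) (cframe x e' i)))"
      using sign_inverse[OF permutes_imp_permutation[OF finite_atMost p]] by simp
  qed
  also have "\<dots> = cnj (Delta x e (cframe x e'))" by (simp add: Delta_def)
  finally have "Delta x e' (cframe x e) = cnj (Delta x e (cframe x e'))" .
  \<comment> \<open>\<open>cform_det\<close>, applied to the form \<open>Delta x e'\<close>, takes
    the place of the product rule for determinants.\<close>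
  moreover have "1 = Delta x e (cframe x e') * Delta x e' (cframe x e)"
    using cform_det[OF cform_Delta[OF e'] e tans_cframe[OF e']] Delta_frame[OF e'] by simp
  moreover have "complex_of_real ((cmod (Delta x e (cframe x e')))\<^sup>2) =
      Delta x e (cframe x e') * cnj (Delta x e (cframe x e'))"
    by (rule complex_norm_square)
  ultimately have "complex_of_real ((cmod (Delta x e (cframe x e')))\<^sup>2) = 1" by metis
  then have "(cmod (Delta x e (cframe x e')))\<^sup>2 = 1" using of_real_eq_1_iff by blast
  then show ?thesis by (simp add: power2_eq_1_iff) (smt (verit) norm_ge_zero)
qed

text \<open>Another unitary frame multiplies the value by a determinant of modulus 1, so the
  description in \<open>canonical_norm\<close> singles out one number.\<close>

lemma canonical_norm_eq:
  assumes n: "\<eta> \<in> canonical_fibre m M x" and e: "unitary_frame m M \<theta> x e"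
  shows "canonical_norm m M \<theta> x \<eta> = cmod (\<eta> (cframe x e))"
  unfolding canonical_norm_def
proof (rule the_equality)
  show "\<exists>e'. unitary_frame m M \<theta> x e' \<and> cmod (\<eta> (cframe x e)) = cmod (\<eta> (case_nat (T x) e'))"
    using e by (auto simp: cframe_def)
  fix r assume "\<exists>e'. unitary_frame m M \<theta> x e' \<and> r = cmod (\<eta> (case_nat (T x) e'))"
  then obtain e' where e': "unitary_frame m M \<theta> x e'" "r = cmod (\<eta> (cframe x e'))" by (auto simp: cframe_def)
  show "r = cmod (\<eta> (cframe x e))"
    using e'(2) cform_det[OF canonical_cform[OF n] e tans_cframe[OF e'(1)]] Delta_unit[OF e e'(1)]
    by (simp add: norm_mult)
qed

text \<open>Vanishing on the frame means vanishing on all tangent arguments; on other arguments the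
  normalisation in \<open>canonical_fibre\<close> gives 0 anyway.\<close>

lemma canonical_nonzero:
  assumes n: "\<eta> \<in> canonical_fibre m M x" "\<eta> \<noteq> 0" and e: "unitary_frame m M \<theta> x e"
  shows "\<eta> (cframe x e) \<noteq> 0"
proof
  assume "\<eta> (cframe x e) = 0"
  then have t: "\<eta> Y = 0" if "tans x Y" for Y using cform_zero[OF canonical_cform[OF n(1)] e _ that] by blast
  have "\<eta> Y = 0" if "\<not> tans x Y" for Y using that n(1) unfolding canonical_fibre_def tans_def by blast
  with t have "\<eta> = 0" by (auto simp: fun_eq_iff zero_fun_apply)
  with n(2) show False by simp
qed

end


section \<open>Derivatives of complex functions and bundles\<close>

context smooth_manifold
begin

lemma dir_deriv_cong:
  assumes "v \<in> tangent M x" "\<forall>\<^sub>F y in nhds x. F y = G y"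
  shows "dir_deriv v F = dir_deriv v G"
  unfolding dir_deriv_def complex_eq_iff
  using tangent_cong[OF assms(1)] assms(2) by (auto intro!: tangent_cong[OF assms(1)] elim: eventually_mono)

lemma smooth_germ_Re_Im:
  fixes F :: "'p \<Rightarrow> complex"
  assumes "smooth_germ M x F"
  shows "smooth_germ M x (\<lambda>y. Re (F y))" "smooth_germ M x (\<lambda>y. Im (F y))"
  by (rule smooth_germ_linear[OF bounded_linear_Re assms], rule smooth_germ_linear[OF bounded_linear_Im assms])

lemma dir_deriv_const: "v \<in> tangent M x \<Longrightarrow> dir_deriv v (\<lambda>y. c) = 0"
  by (simp add: dir_deriv_def tangent_const complex_eq_iff)

lemma dir_deriv_zero:
  assumes "v \<in> tangent M x" "\<forall>\<^sub>F y in nhds x. F y = 0"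
  shows "dir_deriv v F = 0"
  unfolding dir_deriv_cong[OF assms] by (rule dir_deriv_const[OF assms(1)])

lemma dir_deriv_add:
  assumes v: "v \<in> tangent M x" and F: "smooth_germ M x F" and G: "smooth_germ M x G"
  shows "dir_deriv v (\<lambda>y. F y + G y) = dir_deriv v F + dir_deriv v G"
  by (simp add: dir_deriv_def complex_eq_iff tangentD(1)[OF v] smooth_germ_Re_Im[OF F] smooth_germ_Re_Im[OF G])

lemma dir_deriv_cmult:
  assumes v: "v \<in> tangent M x" and F: "smooth_germ M x F"
  shows "dir_deriv v (\<lambda>y. c * F y) = c * dir_deriv v F"
proof -
  note s = smooth_germ_Re_Im[OF F]
  have c: "smooth_germ M x (\<lambda>y. a * Re (F y))" "smooth_germ M x (\<lambda>y. a * Im (F y))" for a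
    by (intro smooth_germ_mult smooth_germ_const s)+
  show ?thesis
    by (simp add: dir_deriv_def complex_eq_iff tangent_diff[OF v c(1) c(2)] tangentD(1)[OF v c(2) c(1)]
      tangentD(1)[OF v c(1) c(2)] tangentD(3)[OF v s(1)] tangentD(3)[OF v s(2)])
qed

lemma dir_deriv_rmult:
  assumes v: "v \<in> tangent M x" and h: "smooth_germ M x h" and F: "smooth_germ M x F"
  shows "dir_deriv v (\<lambda>y. of_real (h y) * F y) = of_real (v h) * F x + of_real (h x) * dir_deriv v F"
  by (simp add: dir_deriv_def complex_eq_iff tangentD(2)[OF v h] smooth_germ_Re_Im[OF F])

lemma dir_deriv_vec_mult:
  fixes F :: "'p \<Rightarrow> complex^'s"
  assumes v: "v \<in> tangent M x" and h: "smooth_germ M x h" and F: "smooth_germ M x F"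
  shows "dir_deriv_vec v (\<lambda>y. h y *\<^sub>R F y) = v h *\<^sub>R F x + h x *\<^sub>R dir_deriv_vec v F"
proof -
  have "smooth_germ M x (\<lambda>y. F y $ a)" for a by (rule smooth_germ_linear[OF bounded_linear_vec_nth F])
  from dir_deriv_rmult[OF v h this] show ?thesis
    by (simp add: dir_deriv_vec_def vec_eq_iff scaleR_conv_of_real[where 'a = complex])
qed

lemma dir_deriv_vec_cong:
  assumes "v \<in> tangent M x" "\<forall>\<^sub>F y in nhds x. F y = G y"
  shows "dir_deriv_vec v F = dir_deriv_vec v G"
  unfolding dir_deriv_vec_def vec_eq_iff
  using assms(2) by (auto intro!: dir_deriv_cong[OF assms(1)] elim: eventually_mono)

lemma dir_deriv_tscale: "dir_deriv (tscale c v) F = of_real c * dir_deriv v F"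
  by (simp add: dir_deriv_def complex_eq_iff tscale_simps(5))

lemma dir_deriv_vec_tscale: "dir_deriv_vec (tscale c v) F = c *\<^sub>R dir_deriv_vec v F"
  by (simp add: dir_deriv_vec_def vec_eq_iff dir_deriv_tscale) (simp add: scaleR_conv_of_real[where 'a = complex])

section \<open>Local sections of principal bundles and line bundles\<close>

lemma ex_local_section:
  assumes B: "fibre_bundle M B F G act" and act: "bounded_bilinear act"
  shows "\<exists>s. local_section M B (proj B q) s \<and> s (proj B q) = q"
proof -
  have cov: "(\<Union>(U, \<tau>)\<in>triv B. U) = UNIV"
    and tr: "\<And>U \<tau>. (U, \<tau>) \<in> triv B \<Longrightarrow> open U \<and> (\<forall>x\<in>U. bij_betw \<tau> {\<xi>. proj B \<xi> = x} F)"
    and ch: "\<And>U \<tau> V \<sigma>. (U, \<tau>) \<in> triv B \<Longrightarrow> (V, \<sigma>) \<in> triv B \<Longrightarrow> \<exists>g.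
        smooth_fun M (U \<inter> V) g \<and> g ` (U \<inter> V) \<subseteq> G \<and>
        (\<forall>\<xi>. proj B \<xi> \<in> U \<inter> V \<longrightarrow> \<sigma> \<xi> = act (g (proj B \<xi>)) (\<tau> \<xi>))"
    using B unfolding fibre_bundle_def by (simp, fast, fast)
  have "proj B q \<in> (\<Union>(U, \<tau>)\<in>triv B. U)" unfolding cov by simp
  then obtain U \<tau> where U: "(U, \<tau>) \<in> triv B" "proj B q \<in> U" by auto
  note bij = tr[OF U(1), THEN conjunct2, rule_format]
  \<comment> \<open>The section with constant fibre component in one trivialisation. In any other
    one it is the smooth transition function acting on a constant, and bilinearity of the action
    keeps it smooth.\<close>
  define s where "s y = inv_into {\<xi>. proj B \<xi> = y} \<tau> (\<tau> q)" for y
  have F: "\<tau> q \<in> F" using bij[OF U(2)] by (auto simp: bij_betw_def)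
  have s: "proj B (s y) = y" "\<tau> (s y) = \<tau> q" if "y \<in> U" for y
  proof -
    have im: "\<tau> q \<in> \<tau> ` {\<xi>. proj B \<xi> = y}" using bij[OF that] F by (simp add: bij_betw_def)
    show "proj B (s y) = y" using inv_into_into[OF im] by (simp add: s_def)
    show "\<tau> (s y) = \<tau> q" using f_inv_into_f[OF im] by (simp add: s_def)
  qed
  have sq: "s (proj B q) = q"
    unfolding s_def using bij[OF U(2)] by (intro inv_into_f_f) (auto simp: bij_betw_def)
  have sm: "smooth_fun M (U \<inter> V) (\<sigma> \<circ> s)" if V: "(V, \<sigma>) \<in> triv B" for V \<sigma>
  proof -
    obtain g where g: "smooth_fun M (U \<inter> V) g"
      "\<And>\<xi>. proj B \<xi> \<in> U \<inter> V \<Longrightarrow> \<sigma> \<xi> = act (g (proj B \<xi>)) (\<tau> \<xi>)"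
      using ch[OF U(1) V] by blast
    show ?thesis
    proof (rule smooth_fun_cong)
      show "smooth_fun M (U \<inter> V) (\<lambda>y. act (g y) (\<tau> q))"
        by (rule smooth_fun_bilinear[OF act g(1) smooth_fun_const[OF smooth_fun_open[OF g(1)]]])
      show "act (g y) (\<tau> q) = (\<sigma> \<circ> s) y" if "y \<in> U \<inter> V" for y
        using g(2)[of "s y"] s[of y] that by simp
    qed
  qed
  have "local_section M B (proj B q) s"
    unfolding local_section_def
    using tr[OF U(1)] U(2) s(1) sm by (intro exI[of _ U]) auto
  with sq show ?thesis by blast
qed

lemma local_section_proj:
  "local_section M B x s \<Longrightarrow> \<forall>\<^sub>F y in nhds x. proj B (s y) = y"
  by (auto simp: local_section_def eventually_nhds)

lemma line_bundle_props:
  assumes "line_bundle M E"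
  shows "\<exists>U \<tau>. (U, \<tau>) \<in> triv E \<and> x \<in> U"
    and "(U, \<tau>) \<in> triv E \<Longrightarrow> x \<in> U \<Longrightarrow> bij_betw \<tau> {\<xi>. proj E \<xi> = x} UNIV"
    and "(U, \<tau>) \<in> triv E \<Longrightarrow> proj E \<xi> \<in> U \<Longrightarrow> \<tau> \<xi> \<noteq> 0 \<Longrightarrow> nonzero E \<xi>"
    and "(U, \<tau>) \<in> triv E \<Longrightarrow> open U"
proof -
  have cov: "(\<Union>(U, \<tau>)\<in>triv E. U) = UNIV"
    and tr: "\<And>U \<tau>. (U, \<tau>) \<in> triv E \<Longrightarrow> open U \<and> (\<forall>x\<in>U. bij_betw \<tau> {\<xi>. proj E \<xi> = x} UNIV)"
    and ch: "\<And>U \<tau> V \<sigma>. (U, \<tau>) \<in> triv E \<Longrightarrow> (V, \<sigma>) \<in> triv E \<Longrightarrow> \<exists>g :: 'p \<Rightarrow> complex.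
        smooth_fun M (U \<inter> V) g \<and> g ` (U \<inter> V) \<subseteq> UNIV - {0} \<and>
        (\<forall>\<xi>. proj E \<xi> \<in> U \<inter> V \<longrightarrow> \<sigma> \<xi> = g (proj E \<xi>) * \<tau> \<xi>)"
    using assms unfolding fibre_bundle_def line_bundle_def by (simp, fast, fast)
  have "x \<in> (\<Union>(U, \<tau>)\<in>triv E. U)" unfolding cov by simp
  then show "\<exists>U \<tau>. (U, \<tau>) \<in> triv E \<and> x \<in> U" by auto
  show "(U, \<tau>) \<in> triv E \<Longrightarrow> x \<in> U \<Longrightarrow> bij_betw \<tau> {\<xi>. proj E \<xi> = x} UNIV"
    and "(U, \<tau>) \<in> triv E \<Longrightarrow> open U" using tr by blast+
  assume U: "(U, \<tau>) \<in> triv E" "proj E \<xi> \<in> U" "\<tau> \<xi> \<noteq> 0"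
  have "\<sigma> \<xi> \<noteq> 0" if V: "(V, \<sigma>) \<in> triv E" "proj E \<xi> \<in> V" for V \<sigma>
  proof -
    obtain g :: "'p \<Rightarrow> complex" where g: "g ` (U \<inter> V) \<subseteq> UNIV - {0}" "\<sigma> \<xi> = g (proj E \<xi>) * \<tau> \<xi>"
      using ch[OF U(1) V(1)] U(2) V(2) by blast
    moreover have "g (proj E \<xi>) \<noteq> 0" using g(1) U(2) V(2) by blast
    ultimately show ?thesis using U(3) by simp
  qed
  then show "nonzero E \<xi>" by (auto simp: nonzero_def)
qed

lemma ex_nonzero_section:
  assumes "line_bundle M E"
  shows "\<exists>e. local_section M E x e \<and> nonzero E (e x)"
proof -
  obtain U \<tau> where U: "(U, \<tau>) \<in> triv E" "x \<in> U" using line_bundle_props(1)[OF assms] by blast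
  have "1 \<in> \<tau> ` {\<xi>. proj E \<xi> = x}" using line_bundle_props(2)[OF assms U] by (simp add: bij_betw_def)
  then obtain \<xi> where \<xi>: "proj E \<xi> = x" "\<tau> \<xi> = 1" by auto
  obtain e where "local_section M E x e" "e x = \<xi>"
    using ex_local_section[OF assms[unfolded line_bundle_def] bounded_bilinear_mult, of \<xi>] \<xi>(1) by blast
  then show ?thesis using line_bundle_props(3)[OF assms U(1), of \<xi>] \<xi> U(2) by auto
qed

lemma nonzero_section_eventually:
  assumes E: "line_bundle M E" and e: "local_section M E x e" and nz: "nonzero E (e x)"
  shows "\<forall>\<^sub>F y in nhds x. nonzero E (e y)"
proof -
  obtain U \<tau> where U: "(U, \<tau>) \<in> triv E" "x \<in> U" using line_bundle_props(1)[OF E] by blast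
  obtain W where W: "open W" "x \<in> W" "\<forall>y\<in>W. proj E (e y) = y" "smooth_fun M (W \<inter> U) (\<tau> \<circ> e)"
    using e U(1) unfolding local_section_def by fast
  have "smooth_germ M x (\<tau> \<circ> e)" by (rule smooth_germ_fun[OF W(4)]) (use U W in auto)
  moreover have "(\<tau> \<circ> e) x \<noteq> 0" using nz U W by (auto simp: nonzero_def)
  ultimately have "\<forall>\<^sub>F y in nhds x. (\<tau> \<circ> e) y \<noteq> 0" by (rule smooth_germ_nonzero)
  moreover have "\<forall>\<^sub>F y in nhds x. y \<in> U" using line_bundle_props(4)[OF E U(1)] U(2) eventually_nhds by blast
  ultimately show ?thesis using local_section_proj[OF e]
    by eventually_elim (use line_bundle_props(3)[OF E U(1)] in auto)
qed

end


section \<open>The Webster--Tanaka connection\<close>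

locale wt_mfd = ph_mfd M m \<theta>
  for M :: "('p::{t2_space, second_countable_topology}, 'n::finite) cr_struct" and m :: nat
    and \<theta> :: "'p \<Rightarrow> 'p tvec \<Rightarrow> real" +
  fixes nab :: "'p \<Rightarrow> 'p tvec \<Rightarrow> ('p \<Rightarrow> 'p tvec) \<Rightarrow> 'p tvec"
  assumes wt: "webster_tanaka M \<theta> nab"
begin

lemma nabD:
  assumes "v \<in> tangent M x" "vec_germ M x Y"
  shows "nab x v Y \<in> tangent M x" "nab x (tscale c v) Y = tscale c (nab x v Y)"
    "vec_germ M x Z \<Longrightarrow> nab x v (\<lambda>y. Y y + Z y) = nab x v Y + nab x v Z"
    "smooth_germ M x h \<Longrightarrow> nab x v (\<lambda>y. tscale (h y) (Y y)) = tscale (v h) (Y x) + tscale (h x) (nab x v Y)"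
proof -
  have "connection M nab" using wt by (simp add: webster_tanaka_def)
  then have *: "\<forall>x. \<forall>v\<in>tangent M x. \<forall>Y. vec_germ M x Y \<longrightarrow>
        nab x v Y \<in> tangent M x \<and>
        (\<forall>w\<in>tangent M x. nab x (v + w) Y = nab x v Y + nab x w Y) \<and>
        (\<forall>c. nab x (tscale c v) Y = tscale c (nab x v Y)) \<and>
        (\<forall>Z. vec_germ M x Z \<longrightarrow> nab x v (\<lambda>y. Y y + Z y) = nab x v Y + nab x v Z) \<and>
        (\<forall>h. smooth_germ M x h \<longrightarrow>
           nab x v (\<lambda>y. tscale (h y) (Y y)) = tscale (v h) (Y x) + tscale (h x) (nab x v Y))"
    unfolding connection_def by (elim conjE)
  note ** = *[rule_format, OF assms]
  show "nab x v Y \<in> tangent M x" "nab x (tscale c v) Y = tscale c (nab x v Y)"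
    "vec_germ M x Z \<Longrightarrow> nab x v (\<lambda>y. Y y + Z y) = nab x v Y + nab x v Z"
    "smooth_germ M x h \<Longrightarrow> nab x v (\<lambda>y. tscale (h y) (Y y)) = tscale (v h) (Y x) + tscale (h x) (nab x v Y)"
    using ** by simp_all
qed

text \<open>Multiplication by the indicator of a neighbourhood makes the two fields equal
  everywhere; the extra Leibniz term vanishes because the indicator is constant near
  \<open>x\<close>.\<close>

lemma nab_cong:
  assumes v: "v \<in> tangent M x" and Y: "vec_germ M x Y" and ev: "\<forall>\<^sub>F y in nhds x. Y y = Z y"
  shows "nab x v Y = nab x v Z"
proof -
  obtain W where W: "open W" "x \<in> W" "\<And>y. y \<in> W \<Longrightarrow> Y y = Z y"
    using ev by (auto simp: eventually_nhds)
  define b where "b = (\<lambda>y. if y \<in> W then 1 else (0::real))"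
  have evb: "\<forall>\<^sub>F y in nhds x. 1 = b y" using W by (auto simp: eventually_nhds b_def)
  then have sm: "smooth_germ M x b" by (rule smooth_germ_cong[OF smooth_germ_const])
  have vb: "v b = 0" using tangent_cong[OF v evb] tangent_const[OF v] by simp
  have bx: "b x = 1" using W by (simp add: b_def)
  have "(\<lambda>y. tscale (b y) (Y y)) = (\<lambda>y. tscale (b y) (Z y))" using W by (auto simp: b_def)
  then show ?thesis
    using nabD(4)[OF v Y sm] nabD(4)[OF v vec_germ_cong[OF Y ev] sm] by (simp add: vb bx)
qed

lemma nab_reeb: "v \<in> tangent M x \<Longrightarrow> nab x v T = 0"
  and nab_hor: "v \<in> tangent M x \<Longrightarrow> hor_germ M x Y \<Longrightarrow> nab x v Y \<in> hdist M x"
  and nab_J: "v \<in> tangent M x \<Longrightarrow> hor_germ M x Y \<Longrightarrow> nab x v (apply_J M Y) = J x (nab x v Y)"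
  and nab_metric: "v \<in> tangent M x \<Longrightarrow> hor_germ M x Y \<Longrightarrow> hor_germ M x Z \<Longrightarrow>
     v (\<lambda>y. g y (Y y) (Z y)) = g x (nab x v Y) (Z x) + g x (Y x) (nab x v Z)"
  and nab_torsion: "hor_germ M x X \<Longrightarrow> hor_germ M x Y \<Longrightarrow>
     nab x (X x) Y - nab x (Y x) X - lie M X Y x = tscale (d x (X x) (Y x)) (T x)"
  using wt unfolding webster_tanaka_def by simp_all

section \<open>Covariant derivatives of (m+1,0)-forms\<close>

definition form_field :: "'p \<Rightarrow> ('p \<Rightarrow> (nat \<Rightarrow> 'p tvec) \<Rightarrow> complex) \<Rightarrow> bool" where
  "form_field x K \<longleftrightarrow> (\<forall>\<^sub>F y in nhds x. K y \<in> canonical_fibre m M y) \<and>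
     (\<forall>Y. (\<forall>i\<le>m. vec_germ M x (Y i)) \<longrightarrow> smooth_germ M x (\<lambda>y. K y (\<lambda>i. Y i y)))"

text \<open>\<open>canonical_deriv\<close> along arbitrary fields instead of the chosen extensions,
  so that T and horizontal fields can be inserted when the trace is computed.\<close>

definition cderiv :: "'p \<Rightarrow> 'p tvec \<Rightarrow> ('p \<Rightarrow> (nat \<Rightarrow> 'p tvec) \<Rightarrow> complex) \<Rightarrow> (nat \<Rightarrow> 'p \<Rightarrow> 'p tvec) \<Rightarrow> complex" where
  "cderiv x v K Y = dir_deriv v (\<lambda>y. K y (\<lambda>i. Y i y)) - (\<Sum>i\<le>m. K x ((\<lambda>i. Y i x)(i := nab x v (Y i))))"

lemma form_fieldD:
  assumes "form_field x K"
  shows "\<forall>\<^sub>F y in nhds x. cform y (K y)" "cform x (K x)" "K x \<in> canonical_fibre m M x"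
    "(\<And>i. i \<le> m \<Longrightarrow> vec_germ M x (Y i)) \<Longrightarrow> smooth_germ M x (\<lambda>y. K y (\<lambda>i. Y i y))"
proof -
  have ev: "\<forall>\<^sub>F y in nhds x. K y \<in> canonical_fibre m M y" using assms by (simp add: form_field_def)
  then show 1: "\<forall>\<^sub>F y in nhds x. cform y (K y)" by eventually_elim (rule canonical_cform)
  show "cform x (K x)" by (rule eventually_nhds_x_imp_x[OF 1])
  show "K x \<in> canonical_fibre m M x" by (rule eventually_nhds_x_imp_x[OF ev])
  show "(\<And>i. i \<le> m \<Longrightarrow> vec_germ M x (Y i)) \<Longrightarrow> smooth_germ M x (\<lambda>y. K y (\<lambda>i. Y i y))"
    using assms by (simp add: form_field_def)
qed

lemma eval_upd: "(\<lambda>j. (Y(i := X)) j y) = (\<lambda>j. Y j y)(i := X y)"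
  by auto

text \<open>Separates the one term in which the field of slot \<open>i\<close> is differentiated by
  the connection; in the remaining sum only its value at \<open>x\<close> enters.\<close>

lemma cderiv_upd:
  assumes "i \<le> m"
  shows "cderiv x v K (Y(i := X)) = dir_deriv v (\<lambda>y. K y ((\<lambda>j. Y j y)(i := X y))) -
     (K x ((\<lambda>j. Y j x)(i := nab x v X)) + (\<Sum>k\<in>{..m} - {i}. K x ((\<lambda>j. Y j x)(k := nab x v (Y k), i := X x))))"
proof -
  have "(\<Sum>k\<le>m. K x ((\<lambda>j. (Y(i := X)) j x)(k := nab x v ((Y(i := X)) k)))) =
     K x ((\<lambda>j. (Y(i := X)) j x)(i := nab x v ((Y(i := X)) i))) +
     (\<Sum>k\<in>{..m} - {i}. K x ((\<lambda>j. (Y(i := X)) j x)(k := nab x v ((Y(i := X)) k))))"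
    using assms by (intro sum.remove) auto
  also have "(\<lambda>j. (Y(i := X)) j x)(i := nab x v ((Y(i := X)) i)) = (\<lambda>j. Y j x)(i := nab x v X)"
    by auto
  also have "(\<Sum>k\<in>{..m} - {i}. K x ((\<lambda>j. (Y(i := X)) j x)(k := nab x v ((Y(i := X)) k)))) =
      (\<Sum>k\<in>{..m} - {i}. K x ((\<lambda>j. Y j x)(k := nab x v (Y k), i := X x)))"
    by (intro sum.cong refl arg_cong[where f = "K x"]) auto
  finally have S: "(\<Sum>k\<le>m. K x ((\<lambda>j. (Y(i := X)) j x)(k := nab x v ((Y(i := X)) k)))) =
      K x ((\<lambda>j. Y j x)(i := nab x v X)) + (\<Sum>k\<in>{..m} - {i}. K x ((\<lambda>j. Y j x)(k := nab x v (Y k), i := X x)))" .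
  show ?thesis unfolding cderiv_def S by (simp only: eval_upd)
qed

lemma tans_eval: "(\<And>i. i \<le> m \<Longrightarrow> vec_germ M x (Y i)) \<Longrightarrow> tans x (\<lambda>i. Y i x)"
  by (simp add: tans_def vec_germ_tangent)

lemma tans_eval_eventually:
  assumes "\<And>i. i \<le> m \<Longrightarrow> vec_germ M x (Y i)"
  shows "\<forall>\<^sub>F y in nhds x. tans y (\<lambda>i. Y i y)"
proof -
  have "\<forall>\<^sub>F y in nhds x. \<forall>i\<in>{..m}. vec_germ M y (Y i)"
    using assms vec_germ_eventually by (intro eventually_ball_finite) auto
  then show ?thesis by eventually_elim (rule tans_eval, simp)
qed

lemma form_field_upd_smooth:
  assumes "form_field x K" "\<And>i. i \<le> m \<Longrightarrow> vec_germ M x (Y i)" "vec_germ M x X"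
  shows "smooth_germ M x (\<lambda>y. K y ((\<lambda>j. Y j y)(i := X y)))"
proof -
  have "vec_germ M x ((Y(i := X)) k)" if "k \<le> m" for k using assms(2,3) that by simp
  from form_fieldD(4)[OF assms(1), of "Y(i := X)", OF this] show ?thesis by (simp only: eval_upd)
qed

lemma cderiv_add:
  assumes v: "v \<in> tangent M x" and K: "form_field x K" and Y: "\<And>i. i \<le> m \<Longrightarrow> vec_germ M x (Y i)"
    and i: "i \<le> m" and X: "vec_germ M x X" "vec_germ M x X'"
  shows "cderiv x v K (Y(i := \<lambda>y. X y + X' y)) = cderiv x v K (Y(i := X)) + cderiv x v K (Y(i := X'))"
proof -
  note z = form_fieldD(2)[OF K]
  have te: "\<forall>\<^sub>F y in nhds x. tans y (\<lambda>i. Y i y)" by (rule tans_eval_eventually) (rule Y)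
  have "\<forall>\<^sub>F y in nhds x. K y ((\<lambda>j. Y j y)(i := X y + X' y)) = K y ((\<lambda>j. Y j y)(i := X y)) + K y ((\<lambda>j. Y j y)(i := X' y))"
    using form_fieldD(1)[OF K] te vec_germ_eventually[OF X(1)] vec_germ_eventually[OF X(2)]
    by eventually_elim (rule cformD(2)[OF _ _ i vec_germ_tangent[where X = X] vec_germ_tangent[where X = X']])
  from dir_deriv_cong[OF v this]
  have 1: "dir_deriv v (\<lambda>y. K y ((\<lambda>j. Y j y)(i := X y + X' y))) =
      dir_deriv v (\<lambda>y. K y ((\<lambda>j. Y j y)(i := X y))) + dir_deriv v (\<lambda>y. K y ((\<lambda>j. Y j y)(i := X' y)))"
    by (simp add: dir_deriv_add[OF v form_field_upd_smooth[OF K Y X(1)] form_field_upd_smooth[OF K Y X(2)]])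
  have 2: "K x ((\<lambda>j. Y j x)(k := nab x v (Y k), i := X x + X' x)) =
      K x ((\<lambda>j. Y j x)(k := nab x v (Y k), i := X x)) + K x ((\<lambda>j. Y j x)(k := nab x v (Y k), i := X' x))"
    if "k \<in> {..m} - {i}" for k
    using that by (intro cformD(2)[OF z] tans_upd tans_eval Y i vec_germ_tangent X nabD(1) v) auto
  have 3: "K x ((\<lambda>j. Y j x)(i := nab x v X + nab x v X')) = K x ((\<lambda>j. Y j x)(i := nab x v X)) + K x ((\<lambda>j. Y j x)(i := nab x v X'))"
    by (intro cformD(2)[OF z] tans_eval Y i X nabD(1) v)
  show ?thesis
    unfolding cderiv_upd[OF i] 1 nabD(3)[OF v X] 3 using 2 by (simp add: sum.distrib)
qed

text \<open>The derivative of \<open>h\<close> appears twice, from differentiating the function and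
  from the Leibniz rule of the connection, with opposite signs.\<close>

lemma cderiv_scale:
  assumes v: "v \<in> tangent M x" and K: "form_field x K" and Y: "\<And>i. i \<le> m \<Longrightarrow> vec_germ M x (Y i)"
    and i: "i \<le> m" and X: "vec_germ M x X" and h: "smooth_germ M x h"
  shows "cderiv x v K (Y(i := \<lambda>y. tscale (h y) (X y))) = of_real (h x) * cderiv x v K (Y(i := X))"
proof -
  note z = form_fieldD(2)[OF K]
  have te: "\<forall>\<^sub>F y in nhds x. tans y (\<lambda>i. Y i y)" by (rule tans_eval_eventually) (rule Y)
  have "\<forall>\<^sub>F y in nhds x. K y ((\<lambda>j. Y j y)(i := tscale (h y) (X y))) = of_real (h y) * K y ((\<lambda>j. Y j y)(i := X y))"
    using form_fieldD(1)[OF K] te vec_germ_eventually[OF X]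
    by eventually_elim (rule cformD(3)[OF _ _ i vec_germ_tangent[where X = X]])
  from dir_deriv_cong[OF v this]
  have 1: "dir_deriv v (\<lambda>y. K y ((\<lambda>j. Y j y)(i := tscale (h y) (X y)))) =
      of_real (v h) * K x ((\<lambda>j. Y j x)(i := X x)) + of_real (h x) * dir_deriv v (\<lambda>y. K y ((\<lambda>j. Y j y)(i := X y)))"
    by (simp add: dir_deriv_rmult[OF v h form_field_upd_smooth[OF K Y X]])
  have 2: "K x ((\<lambda>j. Y j x)(k := nab x v (Y k), i := tscale (h x) (X x))) =
      of_real (h x) * K x ((\<lambda>j. Y j x)(k := nab x v (Y k), i := X x))"
    if "k \<in> {..m} - {i}" for k
    using that by (intro cformD(3)[OF z] tans_upd tans_eval Y i vec_germ_tangent X nabD(1) v) auto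
  have "K x ((\<lambda>j. Y j x)(i := tscale (v h) (X x) + tscale (h x) (nab x v X))) =
      K x ((\<lambda>j. Y j x)(i := tscale (v h) (X x))) + K x ((\<lambda>j. Y j x)(i := tscale (h x) (nab x v X)))"
    by (intro cformD(2)[OF z] tans_eval Y i X nabD(1) v tangent_closed vec_germ_tangent)
  also have "K x ((\<lambda>j. Y j x)(i := tscale (v h) (X x))) = of_real (v h) * K x ((\<lambda>j. Y j x)(i := X x))"
    by (intro cformD(3)[OF z] tans_eval Y i X vec_germ_tangent)
  also have "K x ((\<lambda>j. Y j x)(i := tscale (h x) (nab x v X))) = of_real (h x) * K x ((\<lambda>j. Y j x)(i := nab x v X))"
    by (intro cformD(3)[OF z] tans_eval Y i X nabD(1) v)
  finally show ?thesis
    unfolding cderiv_upd[OF i] 1 nabD(4)[OF v X h] using 2 by (simp add: sum_distrib_left algebra_simps del: fun_upd_apply)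
qed

lemma cderiv_le:
  assumes v: "v \<in> tangent M x" and K: "form_field x K" and YZ: "\<And>i. i \<le> m \<Longrightarrow> Y i = Z i"
  shows "cderiv x v K Y = cderiv x v K Z"
proof -
  have "\<forall>\<^sub>F y in nhds x. K y (\<lambda>i. Y i y) = K y (\<lambda>i. Z i y)"
    using form_fieldD(1)[OF K] by eventually_elim (erule cformD(1), simp add: YZ)
  then have "dir_deriv v (\<lambda>y. K y (\<lambda>i. Y i y)) = dir_deriv v (\<lambda>y. K y (\<lambda>i. Z i y))"
    by (rule dir_deriv_cong[OF v])
  moreover have "K x ((\<lambda>i. Y i x)(k := nab x v (Y k))) = K x ((\<lambda>i. Z i x)(k := nab x v (Z k)))" if "k \<le> m" for k
    by (rule cformD(1)[OF form_fieldD(2)[OF K]]) (simp add: YZ that)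
  ultimately show ?thesis unfolding cderiv_def by simp
qed

lemma cderiv_tensorial:
  assumes v: "v \<in> tangent M x" and K: "form_field x K"
    and Y: "\<And>i. i \<le> m \<Longrightarrow> vec_germ M x (Y i)" and Z: "\<And>i. i \<le> m \<Longrightarrow> vec_germ M x (Z i)"
    and eq: "\<And>i. i \<le> m \<Longrightarrow> Y i x = Z i x"
  shows "cderiv x v K Y = cderiv x v K Z"
proof -
  \<comment> \<open>The fields are exchanged one slot at a time, so that \<open>tensorial\<close>
    always acts on a single slot.\<close>
  define H where "H n i = (if i < n then Z i else Y i)" for n i
  have H: "vec_germ M x (H n i)" if "i \<le> m" for n i using Y Z that by (simp add: H_def)
  have "cderiv x v K Y = cderiv x v K (H n)" if "n \<le> Suc m" for n
    using that
  proof (induction n)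
    case 0
    then show ?case by (simp add: H_def[abs_def])
  next
    case (Suc n)
    then have n: "n \<le> m" by simp
    have "cderiv x v K ((H n)(n := Y n)) = cderiv x v K ((H n)(n := Z n))"
      by (rule tensorial[of x "\<lambda>X. cderiv x v K ((H n)(n := X))"])
        (simp_all add: cderiv_add[OF v K H n] cderiv_scale[OF v K H n] Y Z n eq scaleR_conv_of_real del: fun_upd_apply)
    moreover have "(H n)(n := Y n) = H n" "(H n)(n := Z n) = H (Suc n)" by (auto simp: H_def fun_eq_iff less_Suc_eq)
    ultimately show ?case using Suc by simp
  qed
  from this[of "Suc m"] show ?thesis
    using cderiv_le[OF v K, of "H (Suc m)" Z] by (simp add: H_def)
qed

lemma canonical_deriv_field:
  assumes v: "v \<in> tangent M x" and K: "form_field x K"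
    and Y: "\<And>i. i \<le> m \<Longrightarrow> vec_germ M x (Y i)" and Z: "\<And>i. i \<le> m \<Longrightarrow> Y i x = Z i"
  shows "canonical_deriv m M nab x v K Z = cderiv x v K Y"
proof -
  have Zt: "Z i \<in> tangent M x" if "i \<le> m" for i using vec_germ_tangent[OF Y[OF that]] Z[OF that] by simp
  have "canonical_deriv m M nab x v K Z = cderiv x v K (\<lambda>i. extension M x (Z i))"
  proof -
    have "K x (Z(k := w)) = K x ((\<lambda>i. extension M x (Z i) x)(k := w))" for k w
      by (rule cformD(1)[OF form_fieldD(2)[OF K]]) (simp add: extension(2) Zt)
    then show ?thesis unfolding canonical_deriv_def cderiv_def by simp
  qed
  also have "\<dots> = cderiv x v K Y"
    by (rule cderiv_tensorial[OF v K]) (simp_all add: extension Zt Y Z)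
  finally show ?thesis .
qed

text \<open>For \<open>canonical_form\<close> to exist the derivative must lie in the same complex
  line as the form itself. The type (m+1,0) survives because the connection preserves H(M) and
  commutes with J.\<close>

lemma cform_canonical_deriv:
  assumes v: "v \<in> tangent M x" and K: "form_field x K"
  shows "cform x (canonical_deriv m M nab x v K)"
proof (rule cformI)
  note z = form_fieldD(2)[OF K]
  show "canonical_deriv m M nab x v K Y = canonical_deriv m M nab x v K Z" if YZ: "\<And>i. i \<le> m \<Longrightarrow> Y i = Z i" for Y Z
  proof -
    have "\<forall>\<^sub>F y in nhds x. K y (\<lambda>i. extension M x (Y i) y) = K y (\<lambda>i. extension M x (Z i) y)"
      using form_fieldD(1)[OF K] by eventually_elim (erule cformD(1), simp add: YZ)
    then have "dir_deriv v (\<lambda>y. K y (\<lambda>i. extension M x (Y i) y)) = dir_deriv v (\<lambda>y. K y (\<lambda>i. extension M x (Z i) y))"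
      by (rule dir_deriv_cong[OF v])
    moreover have "K x (Y(k := nab x v (extension M x (Y k)))) = K x (Z(k := nab x v (extension M x (Z k))))" if "k \<le> m" for k
      by (rule cformD(1)[OF z]) (simp add: YZ that)
    ultimately show ?thesis unfolding canonical_deriv_def by simp
  qed
  let ?E = "\<lambda>Y i. extension M x (Y i)"
  have E: "vec_germ M x (?E Y i)" "?E Y i x = Y i" if "tans x Y" "i \<le> m" for Y i
    using that extension by (simp_all add: tans_def)
  have te: "\<forall>\<^sub>F y in nhds x. tans y (\<lambda>i. ?E Y i y)" if "tans x Y" for Y
    by (rule tans_eval_eventually) (rule E(1)[OF that])
  have upd: "canonical_deriv m M nab x v K (Y(i := X x)) = cderiv x v K ((?E Y)(i := X))"
    if "tans x Y" "vec_germ M x X" for Y i X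
    by (rule canonical_deriv_field[OF v K]) (use E[OF that(1)] that(2) in auto)
  show "canonical_deriv m M nab x v K (Y(i := a + b)) = canonical_deriv m M nab x v K (Y(i := a)) + canonical_deriv m M nab x v K (Y(i := b))"
    if "tans x Y" "i \<le> m" "a \<in> tangent M x" "b \<in> tangent M x" for Y i a b
    using upd[OF that(1) extension(1)[OF that(3)], of i] upd[OF that(1) extension(1)[OF that(4)], of i]
      upd[OF that(1) vec_germ_add[OF extension(1)[OF that(3)] extension(1)[OF that(4)]], of i]
      cderiv_add[OF v K E(1)[OF that(1)] that(2) extension(1)[OF that(3)] extension(1)[OF that(4)]]
    by (simp add: extension(2) that del: fun_upd_apply)
  show "canonical_deriv m M nab x v K (Y(i := tscale c a)) = of_real c * canonical_deriv m M nab x v K (Y(i := a))"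
    if "tans x Y" "i \<le> m" "a \<in> tangent M x" for Y i a c
    using upd[OF that(1) extension(1)[OF that(3)], of i]
      upd[OF that(1) vec_germ_scale[OF smooth_germ_const[of x c] extension(1)[OF that(3)]], of i]
      cderiv_scale[OF v K E(1)[OF that(1)] that(2) extension(1)[OF that(3)] smooth_germ_const[of x c]]
    by (simp add: extension(2) that del: fun_upd_apply)
  show "canonical_deriv m M nab x v K Y = 0" if Y: "tans x Y" and ij: "i \<le> m" "j \<le> m" "i \<noteq> j" "Y i = Y j" for Y i j
  proof -
    have "\<forall>\<^sub>F y in nhds x. K y (\<lambda>i. ?E Y i y) = 0"
      using form_fieldD(1)[OF K] te[OF Y]
    proof eventually_elim
      case (elim y)
      from cformD(4)[OF elim ij(1-3)] show ?case by (simp only: ij(4))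
    qed
    then have 1: "dir_deriv v (\<lambda>y. K y (\<lambda>i. ?E Y i y)) = 0"
      by (rule dir_deriv_zero[OF v])
    have nt: "nab x v (?E Y k) \<in> tangent M x" if "k \<le> m" for k using E(1)[OF Y that] v by (intro nabD(1))
    let ?F = "\<lambda>k. K x (Y(k := nab x v (?E Y k)))"
    have "?F k = 0" if "k \<in> {..m} - {i} - {j}" for k
      by (rule cformD(4)[OF z _ ij(1-3)]) (use that ij Y nt in \<open>auto intro!: tans_upd\<close>)
    \<comment> \<open>In every other term the two equal arguments are untouched; the two terms left
      are exchanged by a transposition and cancel.\<close>
    then have "(\<Sum>k\<le>m. ?F k) = ?F i + ?F j"
      using ij by (simp add: sum.remove[of "{..m}" i] sum.remove[of "{..m} - {i}" j])
    moreover have "?F i = - ?F j"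
    proof -
      have Yi: "Y i \<in> tangent M x" using Y ij by (simp add: tans_def)
      have "K x (Y(i := nab x v (?E Y i), j := Y i)) = - K x (Y(i := Y i, j := nab x v (?E Y i)))"
        by (rule cform_swap[OF z Y ij(1-3) nt[OF ij(1)] Yi])
      moreover have "Y(i := nab x v (?E Y i), j := Y i) = Y(i := nab x v (?E Y i))"
        by (rule ext) (simp add: ij(3,4))
      moreover have "Y(i := Y i, j := nab x v (?E Y i)) = Y(j := nab x v (?E Y j))"
        by (simp add: ij(4)[symmetric])
      ultimately show ?thesis by metis
    qed
    ultimately show ?thesis unfolding canonical_deriv_def 1 by simp
  qed
  show "canonical_deriv m M nab x v K (Y(0 := a)) + \<i> * canonical_deriv m M nab x v K (Y(0 := J x a)) = 0"
    if Y: "tans x Y" and a: "a \<in> hdist M x" for Y a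
  proof -
    obtain X where X: "hor_germ M x X" "X x = a" using ex_hor_germ[OF a] by blast
    have JX: "hor_germ M x (apply_J M X)" "apply_J M X x = J x a" using hor_germ_J[OF X(1)] X(2) by (simp_all add: apply_J_def)
    let ?F = "\<lambda>X y. K y ((\<lambda>j. ?E Y j y)(0 := X y))"
    have s: "smooth_germ M x (?F X)" "smooth_germ M x (?F (apply_J M X))"
      by (rule form_field_upd_smooth[OF K E(1)[OF Y] hor_germ_vec[OF X(1)]]; assumption)
        (rule form_field_upd_smooth[OF K E(1)[OF Y] hor_germ_vec[OF JX(1)]]; assumption)
    have "\<forall>\<^sub>F y in nhds x. ?F X y + \<i> * ?F (apply_J M X) y = 0"
      using form_fieldD(1)[OF K] te[OF Y] hor_germ_eventually[OF X(1)]
      unfolding apply_J_def by eventually_elim (intro cformD(5) hor_germ_hdist)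
    then have "dir_deriv v (\<lambda>y. ?F X y + \<i> * ?F (apply_J M X) y) = 0"
      by (rule dir_deriv_zero[OF v])
    then have 1: "dir_deriv v (?F X) + \<i> * dir_deriv v (?F (apply_J M X)) = 0"
      using dir_deriv_add[OF v s(1) smooth_germ_mult[OF smooth_germ_const s(2)]] dir_deriv_cmult[OF v s(2)] by simp
    have t: "tans x (\<lambda>j. ?E Y j x)" using E(1)[OF Y] by (rule tans_eval)
    have 2: "K x ((\<lambda>j. ?E Y j x)(0 := nab x v X)) + \<i> * K x ((\<lambda>j. ?E Y j x)(0 := nab x v (apply_J M X))) = 0"
      unfolding nab_J[OF v X(1)] by (rule cformD(5)[OF z t nab_hor[OF v X(1)]])
    have 3: "K x ((\<lambda>j. ?E Y j x)(k := nab x v (?E Y k), 0 := X x)) + \<i> * K x ((\<lambda>j. ?E Y j x)(k := nab x v (?E Y k), 0 := apply_J M X x)) = 0"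
      if "k \<in> {..m} - {0}" for k
      unfolding JX(2) X(2) using that by (intro cformD(5)[OF z] tans_upd t a nabD(1) v E(1)[OF Y]) auto
    have 4: "(\<Sum>k\<in>{..m} - {0}. K x ((\<lambda>j. ?E Y j x)(k := nab x v (?E Y k), 0 := X x))) +
        \<i> * (\<Sum>k\<in>{..m} - {0}. K x ((\<lambda>j. ?E Y j x)(k := nab x v (?E Y k), 0 := apply_J M X x))) = 0"
      unfolding sum_distrib_left sum.distrib[symmetric] using 3 by (intro sum.neutral ballI)
    have alg: "A - (B + C) + \<i> * (A' - (B' + C')) = 0"
      if "A + \<i> * A' = 0" "B + \<i> * B' = 0" "C + \<i> * C' = 0" for A B C A' B' C' :: complex
    proof -
      have "A - (B + C) + \<i> * (A' - (B' + C')) = (A + \<i> * A') - (B + \<i> * B') - (C + \<i> * C')"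
        by (simp add: algebra_simps)
      then show ?thesis using that by simp
    qed
    have "cderiv x v K ((?E Y)(0 := X)) + \<i> * cderiv x v K ((?E Y)(0 := apply_J M X)) = 0"
      unfolding cderiv_upd[OF le0] by (rule alg[OF 1 2 4])
    then show ?thesis
      using upd[OF Y hor_germ_vec[OF X(1)], of 0] upd[OF Y hor_germ_vec[OF JX(1)], of 0] X(2) JX(2)
      by (simp del: fun_upd_apply)
  qed
qed

text \<open>The derivative and the form lie in one complex line, so their ratio may be read off on
  any unitary frame.\<close>

lemma canonical_form_eq:
  assumes v: "v \<in> tangent M x" and K: "form_field x K" "K x \<noteq> 0" and e: "unitary_frame m M \<theta> x e"
  shows "canonical_form m M nab x v K = canonical_deriv m M nab x v K (cframe x e) / K x (cframe x e)"
  unfolding canonical_form_def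
proof (rule the_equality)
  let ?D = "canonical_deriv m M nab x v K" and ?W = "cframe x e"
  note z = form_fieldD(2,3)[OF K(1)]
  have nz: "K x ?W \<noteq> 0" by (rule canonical_nonzero[OF z(2) K(2) e])
  show "\<forall>Y. (\<forall>i\<le>m. Y i \<in> tangent M x) \<longrightarrow> ?D Y = ?D ?W / K x ?W * K x Y"
  proof (intro allI impI)
    fix Y assume "\<forall>i\<le>m. Y i \<in> tangent M x"
    then have Y: "tans x Y" by (simp add: tans_def)
    show "?D Y = ?D ?W / K x ?W * K x Y"
      using cform_det[OF cform_canonical_deriv[OF v K(1)] e Y] cform_det[OF z(1) e Y] nz by simp
  qed
  show "c = ?D ?W / K x ?W" if "\<forall>Y. (\<forall>i\<le>m. Y i \<in> tangent M x) \<longrightarrow> ?D Y = c * K x Y" for c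
    using that tans_cframe[OF e] nz by (simp add: tans_def)
qed

lemma canonical_form_tscale:
  assumes v: "v \<in> tangent M x" and K: "form_field x K" "K x \<noteq> 0"
  shows "canonical_form m M nab x (tscale c v) K = of_real c * canonical_form m M nab x v K"
proof -
  obtain e where e: "unitary_frame m M \<theta> x e" using ex_unitary by blast
  note W = tans_cframe[OF e]
  have "K x ((cframe x e)(k := nab x (tscale c v) (extension M x (cframe x e k)))) =
      of_real c * K x ((cframe x e)(k := nab x v (extension M x (cframe x e k))))" if "k \<le> m" for k
    using W that v by (simp add: nabD(1,2) extension(1) tans_def cformD(3)[OF form_fieldD(2)[OF K(1)] W] del: fun_upd_apply)
  then have "canonical_deriv m M nab x (tscale c v) K (cframe x e) = of_real c * canonical_deriv m M nab x v K (cframe x e)"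
    by (simp add: canonical_deriv_def dir_deriv_tscale sum_distrib_left algebra_simps del: fun_upd_apply)
  then show ?thesis
    using canonical_form_eq[OF _ K e] v by (simp add: tangent_closed)
qed

end


section \<open>Conformal change\<close>

locale conformal_mfd = ph_mfd M m \<theta>
  for M :: "('p::{t2_space, second_countable_topology}, 'n::finite) cr_struct" and m :: nat
    and \<theta> :: "'p \<Rightarrow> 'p tvec \<Rightarrow> real" +
  fixes f :: "'p \<Rightarrow> real"
  assumes smooth_f: "smooth_fun M UNIV f"
begin

abbreviation "\<theta>' \<equiv> \<lambda>x v. exp (2 * f x) * \<theta> x v"

lemma smooth_exp: "smooth_germ M x (\<lambda>y. exp (c * f y))"
  by (intro smooth_germ_exp smooth_germ_mult smooth_germ_const smooth_germ_fun[OF smooth_f UNIV_I])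

lemma tangent_exp_f:
  assumes "v \<in> tangent M x"
  shows "v (\<lambda>y. exp (c * f y)) = c * v f * exp (c * f x)"
proof -
  have f: "smooth_germ M x f" by (rule smooth_germ_fun[OF smooth_f UNIV_I])
  show ?thesis
    using tangent_exp[OF assms smooth_germ_mult[OF smooth_germ_const[of x c] f]] tangentD(3)[OF assms f, of c] by simp
qed

text \<open>The rule d(h \<theta>) = h d\<theta> + dh wedge \<theta> for h = exp (2 f).
  \<open>extension\<close> depends on the vector but not on the form, so both sides use the same
  fields.\<close>

lemma ext_deriv_conformal:
  assumes v: "v \<in> tangent M x" and w: "w \<in> tangent M x"
  shows "ext_deriv M \<theta>' x v w = exp (2 * f x) * (d x v w + 2 * (v f * \<theta> x w - w f * \<theta> x v))"
proof -
  note e = extension[OF v] extension[OF w]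
  have 1: "v (\<lambda>y. exp (2 * f y) * \<theta> y (extension M x w y)) =
      2 * v f * exp (2 * f x) * \<theta> x w + exp (2 * f x) * v (\<lambda>y. \<theta> y (extension M x w y))"
    using tangentD(2)[OF v smooth_exp theta_smooth[OF e(3)]] tangent_exp_f[OF v, of 2] e(4) by simp
  have 2: "w (\<lambda>y. exp (2 * f y) * \<theta> y (extension M x v y)) =
      2 * w f * exp (2 * f x) * \<theta> x v + exp (2 * f x) * w (\<lambda>y. \<theta> y (extension M x v y))"
    using tangentD(2)[OF w smooth_exp theta_smooth[OF e(1)]] tangent_exp_f[OF w, of 2] e(2) by simp
  show ?thesis unfolding ext_deriv_def Let_def 1 2 by (simp add: algebra_simps)
qed

lemma metric_conformal:
  assumes "v \<in> hdist M x" "w \<in> hdist M x"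
  shows "metric M \<theta>' x v w = exp (2 * f x) * g x v w"
  using assms by (simp add: metric_def ext_deriv_conformal hdist_tangent J_hdist theta_hdist)

lemma exp_double: "exp (2 * a) * (exp (- a) * (exp (- a) * b)) = (b :: real)"
proof -
  have "exp (2 * a) * (exp (- a) * (exp (- a) * b)) = exp (2 * a + - a + - a) * b"
    unfolding exp_add by simp
  then show ?thesis by simp
qed

lemma orthonormal_conformal:
  assumes o: "orthonormal k M \<theta> x b"
  shows "orthonormal k M \<theta>' x (\<lambda>i. tscale (exp (- f x)) (b i))"
  unfolding orthonormal_def
proof (intro conjI allI impI)
  note oD = orthonormalD[OF o]
  show "tscale (exp (- f x)) (b i) \<in> hdist M x" if "i < k" for i using oD(1)[OF that] by (rule hdist_closed)
  show "metric M \<theta>' x (tscale (exp (- f x)) (b i)) (tscale (exp (- f x)) (b j)) = (if i = j then 1 else 0)"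
    if ij: "i < k" "j < k" for i j
    using oD(1)[OF ij(1)] oD(1)[OF ij(2)] oD(2)[OF ij]
    by (simp add: metric_conformal hdist_closed g_scale exp_double del: mult_exp_exp)
qed

lemma pseudo_hermitian_conformal: "pseudo_hermitian M \<theta>'"
  unfolding pseudo_hermitian_def one_form_def
proof (intro conjI allI ballI impI)
  show "exp (2 * f x) * \<theta> x (v + w) = exp (2 * f x) * \<theta> x v + exp (2 * f x) * \<theta> x w"
    if "v \<in> tangent M x" "w \<in> tangent M x" for x v w using that by (simp add: theta_lin algebra_simps)
  show "exp (2 * f x) * \<theta> x (tscale c v) = c * (exp (2 * f x) * \<theta> x v)"
    if "v \<in> tangent M x" for x v c using that by (simp add: theta_lin)
  show "smooth_fun M U (\<lambda>y. exp (2 * f y) * \<theta> y (X y))" if X: "vec_field M U X" for U X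
  proof -
    have U: "open U" using X by (simp add: vec_field_def)
    have "\<forall>U X. vec_field M U X \<longrightarrow> smooth_fun M U (\<lambda>y. \<theta> y (X y))"
      using ph unfolding pseudo_hermitian_def one_form_def by (elim conjE)
    then have "smooth_fun M U (\<lambda>y. \<theta> y (X y))" using X by blast
    moreover have "smooth_fun M U (\<lambda>y. exp (2 * f y))"
      by (intro smooth_fun_exp smooth_fun_bilinear[OF bounded_bilinear_mult] smooth_fun_const U
          smooth_fun_subset[OF smooth_f]) simp
    ultimately show ?thesis by (intro smooth_fun_bilinear[OF bounded_bilinear_mult])
  qed
  show "exp (2 * f x) * \<theta> x v = 0 \<longleftrightarrow> v \<in> hdist M x" if "v \<in> tangent M x" for x v
    using theta_hdist_iff[OF that] by simp
  show "metric M \<theta>' x v v > 0" if "v \<in> hdist M x" "v \<noteq> 0" for x v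
    using that by (simp add: metric_conformal g_pos)
qed

sublocale c: ph_mfd M m \<theta>'
proof
  show "pseudo_hermitian M \<theta>'" by (rule pseudo_hermitian_conformal)
  fix x
  obtain s where s: "\<And>k. k < 2*m \<Longrightarrow> hor_germ M x (\<lambda>y. s y k)"
    and o: "\<forall>\<^sub>F y in nhds x. orthonormal (2*m) M \<theta> y (s y)"
    using ex_frame by blast
  have "smooth_germ M x (\<lambda>y. exp (- f y))" using smooth_exp[of x "-1"] by simp
  then have "\<forall>k<2*m. hor_germ M x (\<lambda>y. tscale (exp (- f y)) (s y k))"
    using s by (auto intro: hor_germ_scale)
  moreover have "\<forall>\<^sub>F y in nhds x. orthonormal (2*m) M \<theta>' y (\<lambda>k. tscale (exp (- f y)) (s y k))"
    using o by eventually_elim (rule orthonormal_conformal)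
  ultimately show "\<exists>s. (\<forall>k<2*m. hor_germ M x (\<lambda>y. s y k)) \<and>
        (\<forall>\<^sub>F y in nhds x. orthonormal (2*m) M \<theta>' y (s y))"
    by (intro exI[of _ "\<lambda>y k. tscale (exp (- f y)) (s y k)"] conjI)
qed

text \<open>\<open>exp (2 f) T' = T + V\<close> with \<open>V\<close> horizontal.\<close>

definition V :: "'p \<Rightarrow> 'p tvec" where
  "V y = tscale (exp (2 * f y)) (reeb M \<theta>' y) - T y"

lemma theta_reeb': "\<theta> x (reeb M \<theta>' x) = exp (- (2 * f x))"
  using c.reeb(2)[of x] by (simp add: exp_minus field_simps)

lemma hor_germ_V: "hor_germ M x V"
  unfolding hor_germ_iff
proof
  show "vec_germ M x V"
    unfolding V_def[abs_def] by (intro vec_germ_diff vec_germ_scale smooth_exp c.vec_germ_reeb vec_germ_reeb)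
  have "V y \<in> hdist M y" for y
    using c.reeb(1)[of y] reeb(1,2)[of y]
    by (subst theta_hdist_iff[symmetric])
      (auto simp: V_def theta_lin tangent_closed theta_reeb' exp_minus)
  then show "\<forall>\<^sub>F y in nhds x. V y \<in> hdist M y" by simp
qed

lemma V_hdist: "V x \<in> hdist M x"
  by (rule hor_germ_hdist[OF hor_germ_V])

lemma reeb'_V: "tscale (exp (2 * f x)) (reeb M \<theta>' x) = T x + V x"
  by (simp add: V_def)

text \<open>T' is in the kernel of d\<theta>'. There the term 2 df wedge \<theta> contributes - 2 (v
  f) \<theta>(T'), and exp (2 f) \<theta>(T') = 1.\<close>

lemma df_V:
  assumes v: "v \<in> hdist M x"
  shows "v f = g x (J x (V x)) v"
proof -
  let ?R = "reeb M \<theta>' x"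
  have R: "?R \<in> tangent M x" by (rule c.reeb(1))
  have vt: "v \<in> tangent M x" using v by (rule hdist_tangent)
  have "d x ?R v = 2 * v f * \<theta> x ?R"
    using ext_deriv_conformal[OF R vt] c.reeb(3)[OF vt] theta_hdist[OF v] by simp
  then have "exp (2 * f x) * d x ?R v = 2 * v f"
    by (simp add: theta_reeb' exp_minus)
  moreover have "d x (T x + V x) v = exp (2 * f x) * d x ?R v"
    unfolding reeb'_V[symmetric] using R vt by (simp add: d_scale)
  moreover have "d x (T x + V x) v = d x (V x) v"
    using d_add(1)[OF reeb(1) hdist_tangent[OF V_hdist] vt] reeb(3)[OF vt] by simp
  ultimately show ?thesis using d_g[OF V_hdist v] by simp
qed

lemma unitary_conformal:
  assumes e: "unitary_frame k M \<theta> x e"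
  shows "unitary_frame k M \<theta>' x (\<lambda>a. tscale (exp (- f x)) (e a))"
proof -
  have h: "e a \<in> hdist M x" if "a < k" for a using e that by (simp add: unitary_iff)
  have eq: "g x (e a) (e b) = (if a = b then 1 else 0)" "g x (e a) (J x (e b)) = 0" if "a < k" "b < k" for a b
    using e that by (simp_all add: unitary_iff)
  show ?thesis
    unfolding c.unitary_iff
    using h eq by (simp add: hdist_closed almost_complexD metric_conformal g_scale J_hdist exp_double del: mult_exp_exp)
qed

section \<open>Rescaling of the norms on the canonical bundle and its powers\<close>

lemma cform_scale_all:
  assumes z: "cform x \<zeta>" and Y: "tans x Y"
  shows "\<zeta> (\<lambda>k. tscale (c k) (Y k)) = of_real (\<Prod>k\<le>m. c k) * \<zeta> Y"
proof -
  have "\<zeta> (\<lambda>k. if k < n then tscale (c k) (Y k) else Y k) = of_real (\<Prod>k<n. c k) * \<zeta> Y" if "n \<le> Suc m" for n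
    using that
  proof (induction n)
    case (Suc n)
    let ?Z = "\<lambda>k. if k < n then tscale (c k) (Y k) else Y k"
    have n: "n \<le> m" using Suc.prems by simp
    have Z: "tans x ?Z" using Y by (auto simp: tans_def tangent_closed)
    have "(\<lambda>k. if k < Suc n then tscale (c k) (Y k) else Y k) = ?Z(n := tscale (c n) (Y n))"
      by (rule ext) (auto simp: less_Suc_eq)
    then have "\<zeta> (\<lambda>k. if k < Suc n then tscale (c k) (Y k) else Y k) = of_real (c n) * \<zeta> (?Z(n := Y n))"
      using cformD(3)[OF z Z n, of "Y n" "c n"] Y n by (simp add: tans_def del: fun_upd_apply)
    also have "?Z(n := Y n) = ?Z" by (rule ext) simp
    finally show ?case using Suc by simp
  qed simp
  from this[of "Suc m"] have "\<zeta> (\<lambda>k. if k < Suc m then tscale (c k) (Y k) else Y k) = of_real (\<Prod>k\<le>m. c k) * \<zeta> Y"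
    by (simp add: lessThan_Suc_atMost)
  moreover have "\<zeta> (\<lambda>k. tscale (c k) (Y k)) = \<zeta> (\<lambda>k. if k < Suc m then tscale (c k) (Y k) else Y k)"
    by (rule cformD(1)[OF z]) simp
  ultimately show ?thesis by simp
qed

text \<open>The new frame is exp (- 2 f) (T + V) together with exp (- f) e_a. Slot 0 sees only the
  \<theta>-component, so V does not contribute, and the exponents add up to -(2 + m).\<close>

lemma canonical_norm_conformal:
  assumes \<eta>: "\<eta> \<in> canonical_fibre m M x"
  shows "canonical_norm m M \<theta>' x \<eta> = exp (- (real m + 2) * f x) * canonical_norm m M \<theta> x \<eta>"
proof -
  obtain e where e: "unitary_frame m M \<theta> x e" using ex_unitary by blast
  note z = canonical_cform[OF \<eta>] and W = tans_cframe[OF e]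
  let ?e' = "\<lambda>a. tscale (exp (- f x)) (e a)"
  have TV: "T x + V x \<in> tangent M x" by (intro tangent_closed reeb hdist_tangent V_hdist)
  define Y where "Y = (cframe x e)(0 := T x + V x)"
  have Y: "tans x Y" unfolding Y_def by (rule tans_upd[OF W TV])
  have "\<eta> Y = coord x e 0 (T x + V x) * \<eta> (cframe x e)"
    unfolding Y_def by (rule cform_slot[OF z e le0 TV])
  also have "coord x e 0 (T x + V x) = 1"
    using theta_lin(1)[OF reeb(1) hdist_tangent[OF V_hdist]] reeb(2) theta_hdist[OF V_hdist]
    by (simp add: coord_def)
  finally have eY: "\<eta> Y = \<eta> (cframe x e)" by simp
  define a where "a k = (case k of 0 \<Rightarrow> exp (- (2 * f x)) | Suc _ \<Rightarrow> exp (- f x))" for k :: nat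
  have R: "reeb M \<theta>' x = tscale (exp (- (2 * f x))) (T x + V x)"
    unfolding reeb'_V[symmetric] by (simp add: exp_add[symmetric] del: exp_minus)
  have "c.cframe x ?e' = (\<lambda>k. tscale (a k) (Y k))"
    by (rule ext) (simp add: c.cframe_def Y_def a_def R cframe_def split: nat.split)
  then have "\<eta> (c.cframe x ?e') = of_real (\<Prod>k\<le>m. a k) * \<eta> (cframe x e)"
    using cform_scale_all[OF z Y, of a] eY by simp
  moreover have "(\<Prod>k\<le>m. a k) = exp (- (real m + 2) * f x)"
  proof -
    have "(\<Prod>k\<le>m. a k) = exp (- (2 * f x)) * exp (- f x) ^ m"
      unfolding prod.atMost_shift by (simp add: a_def)
    also have "\<dots> = exp (- (2 * f x) + real m * (- f x))" by (simp only: exp_add exp_of_nat_mult)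
    finally show ?thesis by (simp add: algebra_simps)
  qed
  ultimately show ?thesis
    using canonical_norm_eq[OF \<eta> e] c.canonical_norm_eq[OF \<eta> unitary_conformal[OF e]]
    by (simp add: norm_mult)
qed

lemma root_norm_conformal:
  assumes "\<kappa> \<xi> \<in> canonical_fibre m M (proj E \<xi>)"
  shows "root_norm m M \<theta>' E \<kappa> \<xi> = exp (f (proj E \<xi>)) * root_norm m M \<theta> E \<kappa> \<xi>"
proof -
  have "exp (- (real m + 2) * f (proj E \<xi>)) powr (- 1 / (real m + 2)) = exp (f (proj E \<xi>))"
    by (simp add: powr_def field_simps)
  moreover have "canonical_norm m M \<theta> (proj E \<xi>) (\<kappa> \<xi>) \<ge> 0"
    using ex_unitary canonical_norm_eq[OF assms] by (metis norm_ge_zero)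
  ultimately show ?thesis
    unfolding root_norm_def canonical_norm_conformal[OF assms] by (simp add: powr_mult)
qed

text \<open>The positive factor between the two sections is forced by unit length in both norms: a
  exp (p f) = 1.\<close>

lemma unit_power_conformal:
  assumes "\<kappa> \<xi> \<in> canonical_fibre m M (proj E \<xi>)" "nonzero E \<xi>"
    and u: "unit_power m M \<theta> E \<kappa> p (proj E \<xi>) u" and u': "unit_power m M \<theta>' E \<kappa> p (proj E \<xi>) u'"
    and c: "a > 0" "\<And>\<xi>. u' \<xi> = of_real a * u \<xi>"
  shows "u' \<xi> = of_real (exp (- of_int p * f (proj E \<xi>))) * u \<xi>" "u \<xi> \<noteq> 0"
proof -
  let ?r = "root_norm m M \<theta> E \<kappa> \<xi> powi p" and ?f = "f (proj E \<xi>)"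
  have 1: "cmod (u \<xi>) * ?r = 1" using u assms(2) by (simp add: unit_power_def)
  then show "u \<xi> \<noteq> 0" by auto
  have "cmod (u' \<xi>) * root_norm m M \<theta>' E \<kappa> \<xi> powi p = 1"
    using u' assms(2) unfolding unit_power_def by blast
  then have "cmod (u' \<xi>) * (exp ?f * root_norm m M \<theta> E \<kappa> \<xi>) powi p = 1"
    unfolding root_norm_conformal[where E = E and \<kappa> = \<kappa> and \<xi> = \<xi>, OF assms(1)] .
  then have "a * exp ?f powi p * (cmod (u \<xi>) * ?r) = 1"
    using c by (simp add: norm_mult power_int_mult_distrib ac_simps)
  then have "a * exp (of_int p * ?f) = 1" by (simp add: 1 exp_power_int)
  then have "a = exp (- of_int p * ?f)" by (simp add: exp_minus field_simps)
  then show "u' \<xi> = of_real (exp (- of_int p * ?f)) * u \<xi>" by (simp add: c(2))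
qed

end

locale conformal_wt = conformal_mfd M m \<theta> f
  for M :: "('p::{t2_space, second_countable_topology}, 'n::finite) cr_struct" and m :: nat
    and \<theta> :: "'p \<Rightarrow> 'p tvec \<Rightarrow> real" and f :: "'p \<Rightarrow> real" +
  fixes nab nab' :: "'p \<Rightarrow> 'p tvec \<Rightarrow> ('p \<Rightarrow> 'p tvec) \<Rightarrow> 'p tvec"
  assumes wt1: "webster_tanaka M \<theta> nab" and wt2: "webster_tanaka M (\<lambda>x v. exp (2 * f x) * \<theta> x v) nab'"
begin

sublocale n: wt_mfd M m \<theta> nab
  by unfold_locales (rule wt1)

sublocale n': wt_mfd M m \<theta>' nab'
  by unfold_locales (rule wt2)

text \<open>
  Koszul's argument: the difference of the two connections is, up to its trace part, skew with
  respect to the metric, and its skew-symmetrisation is known from the torsions.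
\<close>

lemma connection_difference:
  assumes X: "hor_germ M x X" and Y: "hor_germ M x Y" and Z: "hor_germ M x Z"
  shows "g x (nab' x (X x) Y - nab x (X x) Y) (Z x) =
    X x f * g x (Y x) (Z x) + g x (J x (X x)) (Y x) * g x (V x) (Z x)
    - g x (J x (Y x)) (Z x) * g x (V x) (X x) + g x (J x (Z x)) (X x) * g x (V x) (Y x)
    + Y x f * g x (X x) (Z x) - Z x f * g x (X x) (Y x)"
proof -
  define a where "a X Y Z = g x (nab' x (X x) Y - nab x (X x) Y) (Z x)" for X Y Z
  have tg: "X x \<in> tangent M x" "X x \<in> hdist M x" if "hor_germ M x X" for X
    using hor_germ_hdist[OF that] by (simp_all add: hdist_tangent)
  have A: "nab' x (X x) Y - nab x (X x) Y \<in> hdist M x" if "hor_germ M x X" "hor_germ M x Y" for X Y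
    by (intro hdist_closed n'.nab_hor n.nab_hor tg that)
  \<comment> \<open>Both connections are metric, each for its own metric; the conformal factor is
    differentiated only once and leaves the term in X f.\<close>
  have sym: "a X Y Z + a X Z Y = 2 * X x f * g x (Y x) (Z x)"
    if X: "hor_germ M x X" and Y: "hor_germ M x Y" and Z: "hor_germ M x Z" for X Y Z
  proof -
    note XT = tg(1)[OF X]
    note h = n.nab_hor[OF XT Y] n'.nab_hor[OF XT Y] n.nab_hor[OF XT Z] n'.nab_hor[OF XT Z] tg(2)[OF Y] tg(2)[OF Z]
    have "\<forall>\<^sub>F y in nhds x. metric M \<theta>' y (Y y) (Z y) = exp (2 * f y) * g y (Y y) (Z y)"
      using hor_germ_eventually[OF Y] hor_germ_eventually[OF Z]
      by eventually_elim (simp add: metric_conformal hor_germ_hdist)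
    note ev = tangent_cong[OF XT this]
    have "X x (\<lambda>y. exp (2 * f y) * g y (Y y) (Z y)) = X x (\<lambda>y. metric M \<theta>' y (Y y) (Z y))"
      by (rule ev[symmetric])
    also have "\<dots> = metric M \<theta>' x (nab' x (X x) Y) (Z x) + metric M \<theta>' x (Y x) (nab' x (X x) Z)"
      by (rule n'.nab_metric[OF XT Y Z])
    also have "\<dots> = exp (2 * f x) * (g x (nab' x (X x) Y) (Z x) + g x (Y x) (nab' x (X x) Z))"
      by (simp only: metric_conformal[OF h(2,6)] metric_conformal[OF h(5,4)] distrib_left)
    finally have "X x (\<lambda>y. exp (2 * f y) * g y (Y y) (Z y)) =
        exp (2 * f x) * (g x (nab' x (X x) Y) (Z x) + g x (Y x) (nab' x (X x) Z))" .
    moreover have "X x (\<lambda>y. exp (2 * f y) * g y (Y y) (Z y)) =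
        2 * X x f * exp (2 * f x) * g x (Y x) (Z x) + exp (2 * f x) * X x (\<lambda>y. g y (Y y) (Z y))"
      using tangentD(2)[OF XT smooth_exp g_smooth[OF Y Z]] tangent_exp_f[OF XT, of 2] by simp
    ultimately have "exp (2 * f x) * (2 * X x f * g x (Y x) (Z x) + X x (\<lambda>y. g y (Y y) (Z y))) =
        exp (2 * f x) * (g x (nab' x (X x) Y) (Z x) + g x (Y x) (nab' x (X x) Z))"
      by (simp add: algebra_simps)
    then have "2 * X x f * g x (Y x) (Z x) + X x (\<lambda>y. g y (Y y) (Z y)) =
        g x (nab' x (X x) Y) (Z x) + g x (Y x) (nab' x (X x) Z)" by simp
    then show ?thesis
      using n.nab_metric[OF XT Y Z] g_sym[OF h(5,3)] g_sym[OF h(5,4)] h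
      by (simp add: a_def g_diff)
  qed
  \<comment> \<open>Subtracting the two torsion identities removes the bracket. Since d\<theta>' on
    H carries the factor exp (2 f), its torsion is d\<theta>(X,Y) (T + V), so T cancels as
    well.\<close>
  have tor: "a X Y Z - a Y X Z = 2 * g x (J x (X x)) (Y x) * g x (V x) (Z x)"
    if X: "hor_germ M x X" and Y: "hor_germ M x Y" and Z: "hor_germ M x Z" for X Y Z
  proof -
    let ?dXY = "d x (X x) (Y x)"
    have "tscale (ext_deriv M \<theta>' x (X x) (Y x)) (reeb M \<theta>' x) = tscale ?dXY (tscale (exp (2 * f x)) (reeb M \<theta>' x))"
    proof -
      have "ext_deriv M \<theta>' x (X x) (Y x) = exp (2 * f x) * ?dXY"
        using ext_deriv_conformal[OF tg(1)[OF X] tg(1)[OF Y]] theta_hdist[OF tg(2)[OF X]] theta_hdist[OF tg(2)[OF Y]]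
        by simp
      then show ?thesis by (simp only: tscale_simps(4) mult.commute)
    qed
    also have "\<dots> = tscale ?dXY (T x) + tscale ?dXY (V x)" unfolding reeb'_V by (rule tscale_add)
    finally have "nab' x (X x) Y - nab' x (Y x) X - lie M X Y x = tscale ?dXY (T x) + tscale ?dXY (V x)"
      using n'.nab_torsion[OF X Y] by simp
    then have "(nab' x (X x) Y - nab x (X x) Y) - (nab' x (Y x) X - nab x (Y x) X) = tscale ?dXY (V x)"
      using n.nab_torsion[OF X Y] by (simp add: algebra_simps)
    then have "g x ((nab' x (X x) Y - nab x (X x) Y) - (nab' x (Y x) X - nab x (Y x) X)) (Z x) = ?dXY * g x (V x) (Z x)"
      using g_scale(1)[OF V_hdist tg(2)[OF Z]] by simp
    then show ?thesis
      using g_diff(1)[OF A[OF X Y] A[OF Y X] tg(2)[OF Z]] d_g[OF tg(2)[OF X] tg(2)[OF Y]] by (simp add: a_def)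
  qed
  \<comment> \<open>Three instances of each relation, for the arrangements of X, Y, Z, form a linear
    system for the values of \<open>a\<close>, as in the derivation of the Levi-Civita
    connection.\<close>
  have "a X Y Z = X x f * g x (Y x) (Z x) + g x (J x (X x)) (Y x) * g x (V x) (Z x)
    - g x (J x (Y x)) (Z x) * g x (V x) (X x) + g x (J x (Z x)) (X x) * g x (V x) (Y x)
    + Y x f * g x (X x) (Z x) - Z x f * g x (X x) (Y x)"
    using sym[OF X Y Z] sym[OF Y X Z] sym[OF Z X Y] tor[OF X Y Z] tor[OF Y Z X] tor[OF Z X Y] by linarith
  then show ?thesis by (simp add: a_def)
qed

text \<open>A form changes by minus the complex trace of the connection difference over T, e_1, ...,
  e_m. T contributes 2 v f and each e_a contributes v f. The imaginary parts give - m g(V,v)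
  directly and - 2 g(V,v) through Parseval, hence the common factor m+2.\<close>

lemma canonical_form_conformal:
  assumes v: "v \<in> hdist M x" and K: "n.form_field x K" "K x \<noteq> 0"
  shows "canonical_form m M nab' x v K - canonical_form m M nab x v K =
    - of_real (real m + 2) * Complex (v f) (- g x (V x) v)"
proof -
  obtain e where e: "unitary_frame m M \<theta> x e" using ex_unitary by blast
  note W = tans_cframe[OF e] and vt = hdist_tangent[OF v]
  note z = n.form_fieldD(2)[OF K(1)]
  have nz: "K x (cframe x e) \<noteq> 0" by (rule canonical_nonzero[OF n.form_fieldD(3)[OF K(1)] K(2) e])
  have K': "n'.form_field x K" using K(1) by (simp add: n.form_field_def n'.form_field_def)
  obtain X where X: "hor_germ M x X" "X x = v" using ex_hor_germ[OF v] by blast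
  have "\<exists>F. hor_germ M x F \<and> F x = e a" if "a < m" for a using ex_hor_germ unitaryD(1)[OF e that] by blast
  then obtain F where F: "\<And>a. a < m \<Longrightarrow> hor_germ M x (F a)" "\<And>a. a < m \<Longrightarrow> F a x = e a" by metis
  define Y where "Y = case_nat T F"
  have Y: "vec_germ M x (Y i)" "Y i x = cframe x e i" if "i \<le> m" for i
    using that F vec_germ_reeb by (auto simp: Y_def cframe_def hor_germ_vec split: nat.split)
  have nt: "nab x v (Y i) \<in> tangent M x" "nab' x v (Y i) \<in> tangent M x" if "i \<le> m" for i
    using n.nabD(1)[OF vt Y(1)[OF that]] n'.nabD(1)[OF vt Y(1)[OF that]] by auto
  have slot: "K x ((\<lambda>i. Y i x)(k := w)) = coord x e k w * K x (cframe x e)" if "k \<le> m" "w \<in> tangent M x" for k w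
  proof -
    have "K x ((\<lambda>i. Y i x)(k := w)) = K x ((cframe x e)(k := w))" by (rule cformD(1)[OF z]) (simp add: Y(2))
    then show ?thesis using cform_slot[OF z e that] by simp
  qed
  define D where "D = dir_deriv v (\<lambda>y. K y (\<lambda>i. Y i y))"
  have 1: "canonical_deriv m M nab x v K (cframe x e) = D - (\<Sum>k\<le>m. coord x e k (nab x v (Y k))) * K x (cframe x e)"
    using n.canonical_deriv_field[OF vt K(1) Y] slot nt(1)
    by (simp add: n.cderiv_def D_def sum_distrib_right del: fun_upd_apply)
  have 2: "canonical_deriv m M nab' x v K (cframe x e) = D - (\<Sum>k\<le>m. coord x e k (nab' x v (Y k))) * K x (cframe x e)"
    using n'.canonical_deriv_field[OF vt K' Y] slot nt(2)
    by (simp add: n'.cderiv_def D_def sum_distrib_right del: fun_upd_apply)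
  obtain e2 where e2: "unitary_frame m M \<theta>' x e2" using c.ex_unitary by blast
  \<comment> \<open>The formula for \<theta>' refers to a frame that is unitary for \<theta>'. Since
    the derivative is a multiple of the form, the ratio is the same on the frame of
    \<theta>.\<close>
  have 3: "canonical_form m M nab' x v K = canonical_deriv m M nab' x v K (cframe x e) / K x (cframe x e)"
  proof -
    let ?D = "canonical_deriv m M nab' x v K"
    have W': "c.tans x (cframe x e)" using W by (simp add: c.tans_def tans_def)
    have nz2: "K x (c.cframe x e2) \<noteq> 0" by (rule c.canonical_nonzero[OF n'.form_fieldD(3)[OF K'] K(2) e2])
    have "?D (cframe x e) * K x (c.cframe x e2) = ?D (c.cframe x e2) * K x (cframe x e)"
      using c.cform_det[OF n'.cform_canonical_deriv[OF vt K'] e2 W'] c.cform_det[OF n'.form_fieldD(2)[OF K'] e2 W']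
      by simp
    then show ?thesis
      unfolding n'.canonical_form_eq[OF vt K' K(2) e2] using nz nz2 by (simp add: field_simps)
  qed
  have "canonical_form m M nab' x v K - canonical_form m M nab x v K =
      - (\<Sum>k\<le>m. coord x e k (nab' x v (Y k)) - coord x e k (nab x v (Y k)))"
    unfolding 3 n.canonical_form_eq[OF vt K e] 1 2 using nz by (simp add: field_simps sum_subtractf)
  also have "(\<Sum>k\<le>m. coord x e k (nab' x v (Y k)) - coord x e k (nab x v (Y k))) =
      of_real (2 * v f) + (\<Sum>a<m. Complex (v f) (- g x (V x) v - 2 * (g x (V x) (e a) * g x v (e a) +
        g x (V x) (J x (e a)) * g x v (J x (e a)))))"
    unfolding sum.atMost_shift
  proof (intro arg_cong2[where f = "(+)"] sum.cong refl)
    \<comment> \<open>T is not parallel for the second connection. In T = exp (2 f) T' - V the field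
      T' is, and the derivative of V is horizontal, so \<theta> detects only the derivative of the
      factor.\<close>
    have TV: "nab' x v T = nab' x v (\<lambda>y. tscale (exp (2 * f y)) (reeb M \<theta>' y) + - V y)"
      by (simp add: V_def)
    have hV: "hor_germ M x (\<lambda>y. - V y)" using hor_germ_scale[OF smooth_germ_const[of x "-1"] hor_germ_V] by (simp add: tscale_minus)
    have "nab' x v T = tscale (v (\<lambda>y. exp (2 * f y))) (reeb M \<theta>' x) + nab' x v (\<lambda>y. - V y)"
      unfolding TV n'.nabD(3)[OF vt vec_germ_scale[OF smooth_exp c.vec_germ_reeb] hor_germ_vec[OF hV]]
        n'.nabD(4)[OF vt c.vec_germ_reeb smooth_exp] n'.nab_reeb[OF vt] by simp
    then have "\<theta> x (nab' x v T) = v (\<lambda>y. exp (2 * f y)) * \<theta> x (reeb M \<theta>' x)"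
      using n'.nab_hor[OF vt hV] c.reeb(1)[of x]
      by (simp add: theta_lin tangent_closed hdist_tangent theta_hdist)
    also have "\<dots> = 2 * v f" by (simp add: theta_reeb' tangent_exp_f[OF vt] exp_minus)
    finally show "coord x e 0 (nab' x v (Y 0)) - coord x e 0 (nab x v (Y 0)) = of_real (2 * v f)"
      using theta_lin(2)[OF tangent_closed(1), of x 0] by (simp add: Y_def n.nab_reeb[OF vt] coord_def theta_hdist hdist_closed)
  next
    fix a assume "a \<in> {..<m}"
    then have a: "a < m" by simp
    note ea = unitaryD(1)[OF e a]
    have JF: "hor_germ M x (apply_J M (F a))" "apply_J M (F a) x = J x (e a)"
      using hor_germ_J[OF F(1)[OF a]] F(2)[OF a] by (simp_all add: apply_J_def)
    note h = n.nab_hor[OF vt F(1)[OF a]] n'.nab_hor[OF vt F(1)[OF a]]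
    have "coord x e (Suc a) (nab' x v (Y (Suc a))) - coord x e (Suc a) (nab x v (Y (Suc a))) =
        Complex (g x (nab' x v (F a) - nab x v (F a)) (e a)) (g x (nab' x v (F a) - nab x v (F a)) (J x (e a)))"
      using h ea by (simp add: coord_def Y_def complex_eq_iff g_diff J_hdist)
    also have "g x (nab' x v (F a) - nab x v (F a)) (e a) = v f"
      using connection_difference[OF X(1) F(1)[OF a] F(1)[OF a]] unitaryD(2)[OF e a a] X(2) F(2)[OF a]
        g_J_self[OF ea] g_J_left[OF ea v] g_sym[OF ea J_hdist[OF v]] by simp
    also have "g x (nab' x v (F a) - nab x v (F a)) (J x (e a)) =
        - g x (V x) v - 2 * (g x (V x) (e a) * g x v (e a) + g x (V x) (J x (e a)) * g x v (J x (e a)))"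
    proof -
      have "e a f = - g x (V x) (J x (e a))" using df_V[OF ea] g_J_left[OF V_hdist ea] by simp
      moreover have "J x (e a) f = g x (V x) (e a)"
        using df_V[OF J_hdist[OF ea]] g_JJ[OF V_hdist ea] by simp
      moreover have "g x (J x v) (e a) = - g x v (J x (e a))" by (rule g_J_left[OF v ea])
      moreover have "g x (J x (e a)) (J x (e a)) = 1" using g_JJ[OF ea ea] unitaryD(2)[OF e a a] by simp
      moreover have "g x (J x (J x (e a))) v = - g x v (e a)"
        using g_minus(1)[OF ea v] g_sym[OF v ea] by (simp add: J_J ea)
      moreover have "g x (e a) (J x (e a)) = 0" by (rule g_J_self[OF ea])
      ultimately show ?thesis
        using connection_difference[OF X(1) F(1)[OF a] JF(1)] X(2) F(2)[OF a] JF(2) by (simp add: algebra_simps)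
    qed
    finally show "coord x e (Suc a) (nab' x v (Y (Suc a))) - coord x e (Suc a) (nab x v (Y (Suc a))) =
      Complex (v f) (- g x (V x) v - 2 * (g x (V x) (e a) * g x v (e a) + g x (V x) (J x (e a)) * g x v (J x (e a))))" .
  qed
  also have "\<dots> = of_real (real m + 2) * Complex (v f) (- g x (V x) v)"
  proof -
    define t where "t a = g x (V x) (e a) * g x v (e a) + g x (V x) (J x (e a)) * g x v (J x (e a))" for a
    have "g x (V x) v = (\<Sum>a<m. t a)" using unitary_parseval[OF e V_hdist v] by (simp add: t_def)
    then show ?thesis
      unfolding t_def[symmetric]
      by (simp add: complex_eq_iff Re_sum Im_sum sum_subtractf sum_distrib_left[symmetric] sum_distrib_right[symmetric] sum_negf
        algebra_simps)
  qed
  finally show ?thesis by (simp only: mult_minus_left)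
qed

end


section \<open>The Kohn--Dirac operator\<close>

lemma bounded_bilinear_matrix_mult:
  "bounded_bilinear ((**) :: complex^'s^'s \<Rightarrow> complex^'s^'s \<Rightarrow> complex^'s^'s)"
  unfolding bilinear_conv_bounded_bilinear[symmetric] bilinear_def
  by (auto intro!: linearI simp: matrix_mult_linear)

lemma matrix_vector_linear:
  fixes A B :: "complex^'s^'s" and x y :: "complex^'s"
  shows "(A + B) *v x = A *v x + B *v x" "(A - B) *v x = A *v x - B *v x"
    "A *v (x + y) = A *v x + A *v y" "A *v (x - y) = A *v x - A *v y"
    "(r *\<^sub>R A) *v x = r *\<^sub>R (A *v x)" "A *v (r *\<^sub>R x) = r *\<^sub>R (A *v x)"
    "A *v (c *s x) = c *s (A *v x)" "mat c *v x = c *s x"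
proof -
  show "mat c *v x = c *s x"
    by (simp add: vec_eq_iff matrix_vector_mult_def mat_def if_distrib[of "\<lambda>a. a * _"] cong: if_cong)
qed (simp_all add: vec_eq_iff matrix_vector_mult_def sum.distrib sum_subtractf algebra_simps scaleR_sum_right
      sum_distrib_left)

lemma sum_matrix_vector: "(\<Sum>i\<in>I. A i) *v x = (\<Sum>i\<in>I. A i *v x)"
  for A :: "'i \<Rightarrow> complex^'s^'s"
  by (induction I rule: infinite_finite_induct) (simp_all add: matrix_vector_linear(1))

lemma sum_square_split:
  fixes F :: "nat \<Rightarrow> nat \<Rightarrow> 'b::comm_monoid_add"
  assumes "\<And>k. k < n \<Longrightarrow> F k k = 0"
  shows "(\<Sum>j<n. \<Sum>k<n. F j k) = (\<Sum>k<n. \<Sum>j<k. F j k + F k j)"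
  using assms by (induction n) (simp_all add: sum.distrib ac_simps)

context clifford_rep
begin

text \<open>Connects the action of a 2-form in \<open>Theta\<close>, summed over j < k, with the sum
  over all pairs of indices in \<open>quad\<close>.\<close>

lemma quad_half:
  assumes skew: "\<And>i k. i < 2*m \<Longrightarrow> k < 2*m \<Longrightarrow> I i k = - I k i"
  shows "(\<Sum>k<2*m. \<Sum>j<k. (2 * I j k) *\<^sub>R (\<gamma> j ** \<gamma> k)) = quad I"
proof -
  have "quad I = (\<Sum>k<2*m. \<Sum>j<k. I j k *\<^sub>R (\<gamma> j ** \<gamma> k) + I k j *\<^sub>R (\<gamma> k ** \<gamma> j))"
    unfolding quad_def
  proof (rule sum_square_split)
    show "I k k *\<^sub>R (\<gamma> k ** \<gamma> k) = 0" if "k < 2*m" for k using skew[OF that that] by simp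
  qed
  also have "\<dots> = (\<Sum>k<2*m. \<Sum>j<k. (2 * I j k) *\<^sub>R (\<gamma> j ** \<gamma> k))"
  proof (intro sum.cong refl)
    fix k j assume "k \<in> {..<2*m}" "j \<in> {..<k}"
    then have jk: "j < 2*m" "k < 2*m" "j \<noteq> k" by auto
    show "I j k *\<^sub>R (\<gamma> j ** \<gamma> k) + I k j *\<^sub>R (\<gamma> k ** \<gamma> j) = (2 * I j k) *\<^sub>R (\<gamma> j ** \<gamma> k)"
      using skew[OF jk(2,1)] gamma_anticomm[OF jk(2,1)] jk(3) by (simp add: scaleR_add_left[symmetric])
  qed
  finally show ?thesis ..
qed

end

locale conformal_spin = conformal_wt M m \<theta> f nab nab' + clifford_rep m \<gamma>
  for M :: "('p::{t2_space, second_countable_topology}, 'n::finite) cr_struct" and m :: nat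
    and \<theta> :: "'p \<Rightarrow> 'p tvec \<Rightarrow> real" and f :: "'p \<Rightarrow> real"
    and nab nab' :: "'p \<Rightarrow> 'p tvec \<Rightarrow> ('p \<Rightarrow> 'p tvec) \<Rightarrow> 'p tvec"
    and \<gamma> :: "nat \<Rightarrow> complex^'s^'s" +
  fixes E :: "('e, 'p, complex) fbundle" and \<kappa> :: "'e \<Rightarrow> (nat \<Rightarrow> 'p tvec) \<Rightarrow> complex" and wt :: int
    and P :: "('q, 'p, complex^'s^'s) fbundle"
    and fr fr' :: "'q \<Rightarrow> nat \<Rightarrow> 'p tvec" and dt dt' :: "'q \<Rightarrow> 'e \<Rightarrow> complex"
  assumes E: "line_bundle M E" and \<kappa>: "canonical_root m M E \<kappa>"
    and spinc: "spinc_structure m M \<theta> E \<kappa> wt \<gamma> P fr dt"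
    and spinc': "conformal_spinc m M \<theta> f E \<kappa> wt \<gamma> P fr dt fr' dt'"
begin

text \<open>\<open>sec\<close> and \<open>esec\<close> are the very choice terms inside
  \<open>spinor_deriv\<close> and \<open>power_form\<close>. Since \<open>P\<close> and
  \<open>E\<close> are shared by the two structures, both operators are computed along the same
  sections.\<close>

definition sec :: "'q \<Rightarrow> 'p \<Rightarrow> 'q" where
  "sec q = (SOME s. local_section M P (proj P q) s \<and> s (proj P q) = q)"

definition esec :: "'p \<Rightarrow> 'p \<Rightarrow> 'e" where
  "esec x = (SOME e. local_section M E x e \<and> nonzero E (e x))"

lemma sec: "local_section M P (proj P q) (sec q)" "sec q (proj P q) = q"
proof -
  have "fibre_bundle M P (spinc_group m \<gamma>) (spinc_group m \<gamma>) (**)"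
    using spinc by (simp add: spinc_structure_def)
  from someI_ex[OF ex_local_section[OF this bounded_bilinear_matrix_mult]]
  show "local_section M P (proj P q) (sec q)" "sec q (proj P q) = q" unfolding sec_def by blast+
qed

lemma esec: "local_section M E x (esec x)" "nonzero E (esec x x)"
  using someI_ex[OF ex_nonzero_section[OF E, of x]] unfolding esec_def by blast+

lemma esec_eventually: "\<forall>\<^sub>F y in nhds x. nonzero E (esec x y) \<and> proj E (esec x y) = y"
  using nonzero_section_eventually[OF E esec] local_section_proj[OF esec(1)] by eventually_elim simp

lemma sec_proj: "\<forall>\<^sub>F y in nhds (proj P q). proj P (sec q y) = y"
  by (rule local_section_proj[OF sec(1)])

lemma spinc_orthonormal:
  "orthonormal (2*m) M \<theta> (proj P q) (fr q)" "orthonormal (2*m) M \<theta>' (proj P q) (fr' q)"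
  using spinc spinc' by (auto simp: spinc_structure_def conformal_spinc_def so_frame_def)

lemma fr'_eq: "i < 2*m \<Longrightarrow> fr' q i = tscale (exp (- f (proj P q))) (fr q i)"
  using spinc' by (auto simp: conformal_spinc_def)

lemma hor_germ_fr:
  assumes "j < 2*m"
  shows "hor_germ M (proj P q) (\<lambda>y. fr (sec q y) j)"
  unfolding hor_germ_iff
proof
  have "\<forall>x s. local_section M P x s \<longrightarrow> (\<forall>j<2*m. vec_germ M x (\<lambda>y. fr (s y) j))"
    using spinc by (simp add: spinc_structure_def)
  then show "vec_germ M (proj P q) (\<lambda>y. fr (sec q y) j)" using sec(1) assms by blast
  show "\<forall>\<^sub>F y in nhds (proj P q). fr (sec q y) j \<in> hdist M y"
    using sec_proj by eventually_elim (metis orthonormalD(1)[OF spinc_orthonormal(1) assms])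
qed

lemma clifford_mult_fr:
  assumes "i < 2*m"
  shows "clifford_mult m M \<theta> \<gamma> P fr q (fr q i) = \<gamma> i" "clifford_mult m M \<theta>' \<gamma> P fr' q (fr' q i) = \<gamma> i"
proof -
  have *: "(\<Sum>j<2*m. b j *\<^sub>R \<gamma> j) = \<gamma> i" if "\<And>j. j < 2*m \<Longrightarrow> b j = (if i = j then 1 else 0)" for b
  proof -
    have "(\<Sum>j<2*m. b j *\<^sub>R \<gamma> j) = (\<Sum>j<2*m. if i = j then \<gamma> j else 0)"
      by (rule sum.cong) (auto simp: that)
    then show ?thesis using assms by simp
  qed
  show "clifford_mult m M \<theta> \<gamma> P fr q (fr q i) = \<gamma> i"
    unfolding clifford_mult_def clifford_def by (rule *) (rule orthonormalD(2)[OF spinc_orthonormal(1) assms])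
  show "clifford_mult m M \<theta>' \<gamma> P fr' q (fr' q i) = \<gamma> i"
    unfolding clifford_mult_def clifford_def by (rule *) (rule c.orthonormalD(2)[OF spinc_orthonormal(2) assms])
qed

section \<open>Connection forms in spinor frames before and after rescaling\<close>

definition conn :: "'q \<Rightarrow> nat \<Rightarrow> nat \<Rightarrow> nat \<Rightarrow> real" where
  "conn q i k j = g (proj P q) (nab (proj P q) (fr q i) (\<lambda>y. fr (sec q y) j)) (fr q k)"

text \<open>\<open>connection_difference\<close> on frame vectors without its trace term, which the
  derivative of exp (- f) in the rescaled frame cancels. The last two indices stand in the opposite
  order to those of \<open>conn\<close>.\<close>

definition cdiff :: "'q \<Rightarrow> nat \<Rightarrow> nat \<Rightarrow> nat \<Rightarrow> real" where
  "cdiff q i j k = g (proj P q) (J (proj P q) (fr q i)) (fr q j) * g (proj P q) (V (proj P q)) (fr q k)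
    - g (proj P q) (J (proj P q) (fr q j)) (fr q k) * g (proj P q) (V (proj P q)) (fr q i)
    + g (proj P q) (J (proj P q) (fr q k)) (fr q i) * g (proj P q) (V (proj P q)) (fr q j)
    + (if i = k then fr q j f else 0) - (if i = j then fr q k f else 0)"

lemma fr_hdist: "i < 2*m \<Longrightarrow> fr q i \<in> hdist M (proj P q)"
  by (rule orthonormalD(1)[OF spinc_orthonormal(1)])

lemma I_skew:
  assumes "i < 2*m" "k < 2*m"
  shows "g (proj P q) (J (proj P q) (fr q i)) (fr q k) = - g (proj P q) (J (proj P q) (fr q k)) (fr q i)"
  using g_J_left[OF fr_hdist[OF assms(1)] fr_hdist[OF assms(2)]]
    g_sym[OF fr_hdist[OF assms(1)] J_hdist[OF fr_hdist[OF assms(2)]]] by simp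

lemma cdiff_skew:
  assumes "i < 2*m" "j < 2*m" "k < 2*m"
  shows "cdiff q i j k = - cdiff q i k j"
  unfolding cdiff_def using I_skew[OF assms(1,2), of q] I_skew[OF assms(3,1), of q] I_skew[OF assms(2,3), of q]
  by (simp add: algebra_simps)

lemma conn_skew:
  assumes "i < 2*m" "j < 2*m" "k < 2*m"
  shows "conn q i j k = - conn q i k j"
proof -
  let ?x = "proj P q" and ?S = "\<lambda>j y. fr (sec q y) j"
  have v: "fr q i \<in> tangent M ?x" by (rule hdist_tangent[OF fr_hdist[OF assms(1)]])
  have S: "?S j ?x = fr q j" for j by (simp add: sec(2))
  have "\<forall>\<^sub>F y in nhds ?x. g y (?S j y) (?S k y) = (if j = k then 1 else 0)"
    using sec_proj
    by eventually_elim (metis orthonormalD(2)[OF spinc_orthonormal(1) assms(2,3)])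
  from tangent_cong[OF v this] have "fr q i (\<lambda>y. g y (?S j y) (?S k y)) = 0"
    using tangent_const[OF v] by simp
  then have "g ?x (nab ?x (fr q i) (?S j)) (fr q k) + g ?x (fr q j) (nab ?x (fr q i) (?S k)) = 0"
    using n.nab_metric[OF v hor_germ_fr[OF assms(2)] hor_germ_fr[OF assms(3)]] by (simp add: S)
  then show ?thesis
    using g_sym[OF fr_hdist[OF assms(2)] n.nab_hor[OF v hor_germ_fr[OF assms(3)]]] by (simp add: conn_def)
qed

text \<open>Three frame vectors bring exp (- f) each and the metric brings exp (2 f), so one factor
  exp (- f) is left. The Leibniz rule for the rescaled field supplies the missing - s_i f on the
  diagonal.\<close>

lemma conn_conformal:
  assumes i: "i < 2*m" and j: "j < 2*m" and k: "k < 2*m"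
  shows "metric M \<theta>' (proj P q) (nab' (proj P q) (fr' q i) (\<lambda>y. fr' (sec q y) j)) (fr' q k) =
    exp (- f (proj P q)) * (conn q i k j + cdiff q i j k)"
proof -
  let ?x = "proj P q" and ?S = "\<lambda>j y. fr (sec q y) j" and ?l = "exp (- f (proj P q))"
  note h = fr_hdist[OF i, of q] fr_hdist[OF j, of q] fr_hdist[OF k, of q]
  have v: "fr q i \<in> tangent M ?x" by (rule hdist_tangent[OF h(1)])
  have v': "tscale ?l (fr q i) \<in> tangent M ?x" using v by (rule tangent_closed)
  have S: "?S j ?x = fr q j" for j by (simp add: sec(2))
  note Sj = hor_germ_fr[OF j, of q]
  have sm: "smooth_germ M ?x (\<lambda>y. exp (- f y))" using smooth_exp[of ?x "-1"] by simp
  have "\<forall>\<^sub>F y in nhds ?x. tscale (exp (- f y)) (?S j y) = fr' (sec q y) j"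
    using sec_proj by eventually_elim (simp add: fr'_eq[OF j])
  from n'.nab_cong[OF v' vec_germ_scale[OF sm hor_germ_vec[OF Sj]] this]
  have "nab' ?x (fr' q i) (\<lambda>y. fr' (sec q y) j) = nab' ?x (tscale ?l (fr q i)) (\<lambda>y. tscale (exp (- f y)) (?S j y))"
    by (simp add: fr'_eq[OF i])
  also have "\<dots> = tscale (tscale ?l (fr q i) (\<lambda>y. exp (- f y))) (fr q j) + tscale ?l (nab' ?x (tscale ?l (fr q i)) (?S j))"
    using n'.nabD(4)[OF v' hor_germ_vec[OF Sj] sm] by (simp add: S)
  also have "nab' ?x (tscale ?l (fr q i)) (?S j) = tscale ?l (nab' ?x (fr q i) (?S j))"
    by (rule n'.nabD(2)[OF v hor_germ_vec[OF Sj]])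
  also have "tscale ?l (fr q i) (\<lambda>y. exp (- f y)) = - (?l * (?l * fr q i f))"
    using tangent_exp_f[OF v, of "-1"] by (simp add: tscale_simps(5))
  finally have N: "nab' ?x (fr' q i) (\<lambda>y. fr' (sec q y) j) =
      tscale (- (?l * (?l * fr q i f))) (fr q j) + tscale ?l (tscale ?l (nab' ?x (fr q i) (?S j)))" .
  have n': "nab' ?x (fr q i) (?S j) \<in> hdist M ?x" by (rule n'.nab_hor[OF v Sj])
  have n: "nab ?x (fr q i) (?S j) \<in> hdist M ?x" by (rule n.nab_hor[OF v Sj])
  let ?A = "nab' ?x (fr q i) (?S j)" and ?a = "- (?l * (?l * fr q i f))"
  note hs = hdist_closed(4)[OF h(2), of ?a] hdist_closed(4)[OF hdist_closed(4)[OF n'], of ?l ?l]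
    hdist_closed(4)[OF h(3), of ?l]
  have "metric M \<theta>' ?x (nab' ?x (fr' q i) (\<lambda>y. fr' (sec q y) j)) (fr' q k) =
      exp (2 * f ?x) * g ?x (tscale ?a (fr q j) + tscale ?l (tscale ?l ?A)) (tscale ?l (fr q k))"
    unfolding N fr'_eq[OF k] by (rule metric_conformal[OF hdist_closed(2)[OF hs(1,2)] hs(3)])
  also have "g ?x (tscale ?a (fr q j) + tscale ?l (tscale ?l ?A)) (tscale ?l (fr q k)) =
      ?l * (?a * g ?x (fr q j) (fr q k) + ?l * (?l * g ?x ?A (fr q k)))"
    by (simp only: g_add(1)[OF hs(1,2,3)] g_scale hs h n' hdist_closed(4)) (simp add: algebra_simps del: mult_exp_exp)
  also have "\<dots> = ?l * (?l * (?l * (g ?x ?A (fr q k) - fr q i f * g ?x (fr q j) (fr q k))))"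
    by (simp add: algebra_simps del: mult_exp_exp)
  also have "exp (2 * f ?x) * (?l * (?l * (?l * (g ?x ?A (fr q k) - fr q i f * g ?x (fr q j) (fr q k))))) =
      ?l * (g ?x ?A (fr q k) - fr q i f * g ?x (fr q j) (fr q k))"
    by (rule exp_double)
  also have "g ?x (nab' ?x (fr q i) (?S j)) (fr q k) - fr q i f * g ?x (fr q j) (fr q k) = conn q i k j + cdiff q i j k"
  proof -
    have "g ?x (nab' ?x (fr q i) (?S j)) (fr q k) = conn q i k j + g ?x (nab' ?x (fr q i) (?S j) - nab ?x (fr q i) (?S j)) (fr q k)"
      using h n n' by (simp add: conn_def g_diff)
    then show ?thesis
      using connection_difference[OF hor_germ_fr[OF i, of q] Sj hor_germ_fr[OF k, of q]]
        orthonormalD(2)[OF spinc_orthonormal(1) i k, of q] orthonormalD(2)[OF spinc_orthonormal(1) i j, of q]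
      by (simp add: S cdiff_def)
  qed
  finally show ?thesis .
qed

lemma form_field_esec: "n.form_field x (\<lambda>y. \<kappa> (esec x y))" "\<kappa> (esec x x) \<noteq> 0"
proof -
  have *: "\<kappa> \<xi> \<in> canonical_fibre m M (proj E \<xi>)" "\<kappa> \<xi> \<noteq> 0" if "nonzero E \<xi>" for \<xi>
    using \<kappa> that by (auto simp: canonical_root_def)
  then show "\<kappa> (esec x x) \<noteq> 0" using esec(2) by blast
  have "\<forall>\<^sub>F y in nhds x. \<kappa> (esec x y) \<in> canonical_fibre m M y"
    using esec_eventually by eventually_elim (metis *(1))
  moreover have "\<forall>x e Y. local_section M E x e \<and> nonzero E (e x) \<and> (\<forall>i\<le>m. vec_germ M x (Y i)) \<longrightarrow>
        smooth_germ M x (\<lambda>y. \<kappa> (e y) (\<lambda>i. Y i y))"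
    using \<kappa> by (simp add: canonical_root_def)
  ultimately show "n.form_field x (\<lambda>y. \<kappa> (esec x y))" using esec unfolding n.form_field_def by blast
qed

definition detconn :: "'q \<Rightarrow> nat \<Rightarrow> complex" where
  "detconn q i = power_form m M nab E \<kappa> wt (proj P q) (fr q i) (\<lambda>y. dt (sec q y))"

text \<open>The unit section changes by exp (- wt f), which subtracts wt times v f, while the
  connection form of E(1) gains v f - i g(V,v). The real parts cancel and the imaginary one is
  multiplied by the weight.\<close>

lemma detconn_conformal:
  assumes i: "i < 2*m"
  shows "power_form m M nab' E \<kappa> wt (proj P q) (fr' q i) (\<lambda>y. dt' (sec q y)) =
    of_real (exp (- f (proj P q))) * (detconn q i - \<i> * of_int wt * of_real (g (proj P q) (V (proj P q)) (fr q i)))"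
proof -
  let ?x = "proj P q" and ?l = "exp (- f (proj P q))"
  let ?v = "fr q i" and ?e = "esec ?x"
  let ?K = "\<lambda>y. \<kappa> (?e y)"
  define u where "u y = dt (sec q y) (?e y)" for y
  define a where "a y = exp (- of_int wt * f y)" for y
  have vh: "?v \<in> hdist M ?x" by (rule fr_hdist[OF i])
  note v = hdist_tangent[OF vh]
  have v': "tscale ?l ?v \<in> tangent M ?x" using v by (rule tangent_closed)
  note K = form_field_esec[of ?x]
  have K': "n'.form_field ?x ?K" using K(1) by (simp add: n.form_field_def n'.form_field_def)
  have key: "dt' (sec q y) (?e y) = of_real (a y) * u y \<and> u y \<noteq> 0"
    if y: "nonzero E (?e y)" "proj E (?e y) = y" "proj P (sec q y) = y" for y
  proof -
    obtain c where c: "c > 0" "\<And>\<xi>. dt' (sec q y) \<xi> = of_real c * dt (sec q y) \<xi>"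
      using spinc' unfolding conformal_spinc_def by blast
    have k: "\<kappa> (?e y) \<in> canonical_fibre m M (proj E (?e y))" using \<kappa> y(1) by (simp add: canonical_root_def)
    have "\<forall>q. unit_power m M \<theta> E \<kappa> wt (proj P q) (dt q)" "\<forall>q. unit_power m M \<theta>' E \<kappa> wt (proj P q) (dt' q)"
      using spinc spinc' unfolding spinc_structure_def conformal_spinc_def by simp_all
    from this[rule_format, of "sec q y"]
    have up: "unit_power m M \<theta> E \<kappa> wt (proj E (?e y)) (dt (sec q y))"
      "unit_power m M \<theta>' E \<kappa> wt (proj E (?e y)) (dt' (sec q y))"
      using y(2,3) by simp_all
    show ?thesis
      using unit_power_conformal[where \<kappa> = \<kappa> and E = E, OF k y(1) up c] y(2) by (simp add: u_def a_def)
  qed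
  have ev: "\<forall>\<^sub>F y in nhds ?x. dt' (sec q y) (?e y) = of_real (a y) * u y"
    using esec_eventually sec_proj by eventually_elim (use key in blast)
  have at: "dt' (sec q ?x) (?e ?x) = of_real (a ?x) * u ?x" "u ?x \<noteq> 0"
  proof -
    note nx = eventually_nhds_x_imp_x[OF esec_eventually[of ?x]]
    from key[OF nx[THEN conjunct1] nx[THEN conjunct2] eventually_nhds_x_imp_x[OF sec_proj[of q]]]
    show "dt' (sec q ?x) (?e ?x) = of_real (a ?x) * u ?x" "u ?x \<noteq> 0" by simp_all
  qed
  have su: "smooth_germ M ?x u"
    using spinc sec(1)[of q] esec[of ?x] unfolding spinc_structure_def u_def[abs_def] by blast
  have sa: "smooth_germ M ?x a" unfolding a_def[abs_def] by (rule smooth_exp)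
  have ax: "a ?x > 0" by (simp add: a_def)
  have "dir_deriv (tscale ?l ?v) (\<lambda>y. dt' (sec q y) (?e y)) = of_real ?l * dir_deriv ?v (\<lambda>y. of_real (a y) * u y)"
    unfolding dir_deriv_cong[OF v' ev] by (rule dir_deriv_tscale)
  also have "\<dots> = of_real ?l * (of_real (?v a) * u ?x + of_real (a ?x) * dir_deriv ?v u)"
    using dir_deriv_rmult[OF v sa su] by simp
  also have "?v a = - of_int wt * ?v f * a ?x"
    unfolding a_def[abs_def] by (rule tangent_exp_f[OF v])
  finally have 1: "dir_deriv (tscale ?l ?v) (\<lambda>y. dt' (sec q y) (?e y)) / dt' (sec q ?x) (?e ?x) =
      of_real ?l * (dir_deriv ?v u / u ?x - of_int wt * of_real (?v f))"
    unfolding at(1) using at(2) ax by (simp add: field_simps)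
  have 2: "root_form m M nab' \<kappa> ?x (tscale ?l ?v) ?e =
      of_real ?l * (root_form m M nab \<kappa> ?x ?v ?e + Complex (?v f) (- g ?x (V ?x) ?v))"
  proof -
    have m: "of_real (real m + 2) = (of_nat m + 2 :: complex)" "(of_nat m + 2 :: complex) \<noteq> 0"
      by (simp, metis of_nat_0_neq of_nat_add of_nat_numeral add_2_eq_Suc')
    have gen: "- (l * (c - n * C)) / n = l * (- c / n + C)" if "n \<noteq> 0" for l c n C :: complex
      using that by (simp add: field_simps)
    have eq: "canonical_form m M nab' ?x ?v ?K = canonical_form m M nab ?x ?v ?K - (of_nat m + 2) * Complex (?v f) (- g ?x (V ?x) ?v)"
      using canonical_form_conformal[OF vh K] unfolding m(1) by (simp add: algebra_simps)
    show ?thesis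
      unfolding root_form_def n'.canonical_form_tscale[OF v K' K(2)] eq by (rule gen[OF m(2)])
  qed
  have C: "Complex (?v f) (- g ?x (V ?x) ?v) = of_real (?v f) - \<i> * of_real (g ?x (V ?x) ?v)"
    by (simp add: complex_eq_iff)
  have "power_form m M nab' E \<kappa> wt ?x (fr' q i) (\<lambda>y. dt' (sec q y)) =
      dir_deriv (tscale ?l ?v) (\<lambda>y. dt' (sec q y) (?e y)) / dt' (sec q ?x) (?e ?x) +
      of_int wt * root_form m M nab' \<kappa> ?x (tscale ?l ?v) ?e"
    by (simp add: power_form_def Let_def esec_def fr'_eq[OF i])
  moreover have "detconn q i = dir_deriv ?v u / u ?x + of_int wt * root_form m M nab \<kappa> ?x ?v ?e"
    by (simp add: detconn_def power_form_def Let_def esec_def u_def[abs_def])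
  ultimately show ?thesis unfolding 1 2 C by (simp add: algebra_simps)
qed

definition slift :: "'q \<Rightarrow> nat \<Rightarrow> complex^'s^'s" where
  "slift q i = spinc_lift m \<gamma> (conn q i) (detconn q i)"

text \<open>The lift uses -1/4 of the connection matrix; passing to the index order of
  \<open>cdiff\<close> transposes a skew matrix, whence +1/4.\<close>

lemma slift_conformal:
  assumes i: "i < 2*m"
  shows "spinc_lift m \<gamma> (\<lambda>k j. metric M \<theta>' (proj P q) (nab' (proj P q) (fr' q i) (\<lambda>y. fr' (sec q y) j)) (fr' q k))
      (power_form m M nab' E \<kappa> wt (proj P q) (fr' q i) (\<lambda>y. dt' (sec q y))) =
    exp (- f (proj P q)) *\<^sub>R (slift q i + (1/4) *\<^sub>R quad (cdiff q i)
      + mat (- \<i> * of_int wt * of_real (g (proj P q) (V (proj P q)) (fr q i)) / 2))"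
    (is "spinc_lift m \<gamma> ?om ?a = ?l *\<^sub>R (_ + _ + mat (?b / 2))")
proof -
  have om: "?om k j = ?l * (conn q i k j + cdiff q i j k)" if "k < 2*m" "j < 2*m" for k j
    by (rule conn_conformal[OF i that(2,1)])
  have "spinc_lift m \<gamma> ?om ?a = quad (\<lambda>k j. - (1/4) * ?om k j) + mat (?a / 2)"
  proof (rule spinc_lift_eq)
    show "?om k j = - ?om j k" if "k < 2*m" "j < 2*m" for k j
      unfolding om[OF that] om[OF that(2,1)] conn_skew[OF i that] cdiff_skew[OF i that(2,1)]
      by (simp add: algebra_simps)
  qed
  also have "quad (\<lambda>k j. - (1/4) * ?om k j) = quad (\<lambda>k j. ?l * (- (1/4) * conn q i k j + (1/4) * cdiff q i k j))"
  proof (rule quad_cong)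
    show "- (1/4) * ?om k j = ?l * (- (1/4) * conn q i k j + (1/4) * cdiff q i k j)" if "k < 2*m" "j < 2*m" for k j
      unfolding om[OF that] cdiff_skew[OF i that(2,1)] by (simp add: field_simps)
  qed
  also have "\<dots> = ?l *\<^sub>R (quad (\<lambda>k j. - (1/4) * conn q i k j) + (1/4) *\<^sub>R quad (cdiff q i))"
    by (simp only: quad_scale quad_add)
  also have "mat (?a / 2) = ?l *\<^sub>R (mat (detconn q i / 2) + mat (?b / 2) :: complex^'s^'s)"
    unfolding detconn_conformal[OF i] by (simp add: vec_eq_iff mat_def scaleR_conv_of_real[where 'a = complex] field_simps)
  finally have "spinc_lift m \<gamma> ?om ?a = ?l *\<^sub>R (quad (\<lambda>k j. - (1/4) * conn q i k j) + (1/4) *\<^sub>R quad (cdiff q i))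
      + ?l *\<^sub>R (mat (detconn q i / 2) + mat (?b / 2))" .
  moreover have "slift q i = quad (\<lambda>k j. - (1/4) * conn q i k j) + mat (detconn q i / 2)"
    unfolding slift_def by (rule spinc_lift_eq) (rule conn_skew[OF i])
  ultimately show ?thesis
    by (simp only: scaleR_add_right add.assoc add.commute add.left_commute)
qed

lemma spinor_deriv_eq:
  "spinor_deriv m M \<theta> nab E \<kappa> wt \<gamma> P fr dt q (fr q i) \<phi> =
    dir_deriv_vec (fr q i) (\<lambda>y. \<phi> (sec q y)) + slift q i *v \<phi> q"
  by (simp add: spinor_deriv_def Let_def sec_def slift_def conn_def[abs_def] detconn_def)

text \<open>The weight \<open>r\<close> is left free here. Differentiation in the rescaled direction
  lowers the exponent by one, and differentiating the weight itself produces the gradient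
  term.\<close>

lemma spinor_deriv_conformal:
  assumes i: "i < 2*m" and \<phi>: "spinor_field m M \<gamma> P \<phi>"
  shows "spinor_deriv m M \<theta>' nab' E \<kappa> wt \<gamma> P fr' dt' q (fr' q i) (\<lambda>q. exp (r * f (proj P q)) *\<^sub>R \<phi> q) =
    exp ((r - 1) * f (proj P q)) *\<^sub>R (spinor_deriv m M \<theta> nab E \<kappa> wt \<gamma> P fr dt q (fr q i) \<phi>
      + (r * fr q i f) *\<^sub>R \<phi> q + (1/4) *\<^sub>R (quad (cdiff q i) *v \<phi> q)
      - (\<i> * of_int wt * of_real (g (proj P q) (V (proj P q)) (fr q i)) / 2) *s \<phi> q)"
proof -
  let ?x = "proj P q" and ?l = "exp (- f (proj P q))" and ?v = "fr q i"
  have v: "?v \<in> tangent M ?x" by (rule hdist_tangent[OF fr_hdist[OF i]])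
  have v': "tscale ?l ?v \<in> tangent M ?x" using v by (rule tangent_closed)
  have s\<phi>: "smooth_germ M ?x (\<lambda>y. \<phi> (sec q y))"
    using \<phi> sec(1) by (auto simp: spinor_field_def)
  have "\<forall>\<^sub>F y in nhds ?x. exp (r * f (proj P (sec q y))) *\<^sub>R \<phi> (sec q y) = exp (r * f y) *\<^sub>R \<phi> (sec q y)"
    using sec_proj by eventually_elim simp
  from dir_deriv_vec_cong[OF v' this]
  have D: "dir_deriv_vec (fr' q i) (\<lambda>y. exp (r * f (proj P (sec q y))) *\<^sub>R \<phi> (sec q y)) =
      ?l *\<^sub>R ((r * ?v f * exp (r * f ?x)) *\<^sub>R \<phi> q + exp (r * f ?x) *\<^sub>R dir_deriv_vec ?v (\<lambda>y. \<phi> (sec q y)))"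
    using dir_deriv_vec_mult[OF v smooth_exp s\<phi>, of r] tangent_exp_f[OF v, of r]
    by (simp add: fr'_eq[OF i] dir_deriv_vec_tscale sec(2))
  have e: "exp ((r - 1) * f ?x) = ?l * exp (r * f ?x)"
    by (simp add: exp_add[symmetric] algebra_simps del: exp_minus)
  have "spinor_deriv m M \<theta>' nab' E \<kappa> wt \<gamma> P fr' dt' q (fr' q i) (\<lambda>q. exp (r * f (proj P q)) *\<^sub>R \<phi> q) =
    dir_deriv_vec (fr' q i) (\<lambda>y. exp (r * f (proj P (sec q y))) *\<^sub>R \<phi> (sec q y)) +
    spinc_lift m \<gamma> (\<lambda>k j. metric M \<theta>' ?x (nab' ?x (fr' q i) (\<lambda>y. fr' (sec q y) j)) (fr' q k))
      (power_form m M nab' E \<kappa> wt ?x (fr' q i) (\<lambda>y. dt' (sec q y))) *v (exp (r * f ?x) *\<^sub>R \<phi> q)"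
    by (simp add: spinor_deriv_def Let_def sec_def)
  also have "\<dots> = exp ((r - 1) * f ?x) *\<^sub>R (dir_deriv_vec ?v (\<lambda>y. \<phi> (sec q y)) + slift q i *v \<phi> q
      + (r * ?v f) *\<^sub>R \<phi> q + (1/4) *\<^sub>R (quad (cdiff q i) *v \<phi> q)
      + (- \<i> * of_int wt * of_real (g ?x (V ?x) ?v) / 2) *s \<phi> q)"
    unfolding D slift_conformal[OF i] e
    by (simp only: matrix_vector_linear scaleR_add_right scaleR_scaleR) (simp add: ac_simps)
  finally show ?thesis
    by (simp add: spinor_deriv_eq vec_eq_iff)
qed

text \<open>On H(M) the form d\<theta> is twice g(J _, _), and \<open>quad_half\<close> absorbs the
  2.\<close>

lemma Theta_quad:
  "Theta m M \<theta> \<gamma> P fr q = mat (\<i> / 2) ** quad (\<lambda>j k. g (proj P q) (J (proj P q) (fr q j)) (fr q k))"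
proof -
  let ?x = "proj P q"
  have "(\<Sum>k<2*m. \<Sum>j<k. d ?x (fr q j) (fr q k) *\<^sub>R
        (clifford_mult m M \<theta> \<gamma> P fr q (fr q j) ** clifford_mult m M \<theta> \<gamma> P fr q (fr q k))) =
      (\<Sum>k<2*m. \<Sum>j<k. (2 * g ?x (J ?x (fr q j)) (fr q k)) *\<^sub>R (\<gamma> j ** \<gamma> k))"
    by (intro sum.cong refl) (simp add: clifford_mult_fr d_g fr_hdist)
  then show ?thesis
    unfolding Theta_def using quad_half[of "\<lambda>j k. g ?x (J ?x (fr q j)) (fr q k)", OF I_skew] by simp
qed

lemma kohn_dirac_conformal:
  assumes \<phi>: "spinor_field m M \<gamma> P \<phi>" and Th: "Theta m M \<theta> \<gamma> P fr q *v \<phi> q = of_int (- wt) *s \<phi> q"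
  shows "kohn_dirac m M \<theta>' nab' E \<kappa> wt \<gamma> P fr' dt' (\<lambda>q. exp (- (real m + 1) * f (proj P q)) *\<^sub>R \<phi> q) q =
    exp (- (real m + 2) * f (proj P q)) *\<^sub>R kohn_dirac m M \<theta> nab E \<kappa> wt \<gamma> P fr dt \<phi> q"
proof -
  let ?x = "proj P q" and ?r = "- (real m + 1)" and ?l = "exp (- (real m + 2) * f (proj P q))"
  define I where "I j k = g ?x (J ?x (fr q j)) (fr q k)" for j k
  define w where "w k = g ?x (V ?x) (fr q k)" for k
  define F where "F k = fr q k f" for k
  let ?c = "\<i> * of_int wt / 2 :: complex"
  have Isk: "I i k = - I k i" if "i < 2*m" "k < 2*m" for i k unfolding I_def by (rule I_skew[OF that])
  \<comment> \<open>\<open>dirac_identity\<close> wants the differential of f as a contraction of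
    the matrix of J with V; expanding g(V, J s_i) in the orthonormal frame provides it.\<close>
  have FI: "F i = (\<Sum>k<2*m. I k i * w k)" if i: "i < 2*m" for i
  proof -
    have "F i = g ?x (J ?x (V ?x)) (fr q i)" unfolding F_def by (rule df_V[OF fr_hdist[OF i]])
    also have "\<dots> = - g ?x (V ?x) (J ?x (fr q i))" by (rule g_J_left[OF V_hdist fr_hdist[OF i]])
    also have "\<dots> = - (\<Sum>k<2*m. w k * I i k)"
      using orthonormal_parseval[OF spinc_orthonormal(1) V_hdist J_hdist[OF fr_hdist[OF i]]] by (simp add: w_def I_def)
    also have "\<dots> = (\<Sum>k<2*m. I k i * w k)"
      unfolding sum_negf[symmetric] using Isk[OF i] by (intro sum.cong) auto
    finally show ?thesis .
  qed
  have cd: "cdiff q i = (\<lambda>j k. I i j * w k - I j k * w i + I k i * w j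
      + (if i = k then F j else 0) - (if i = j then F k else 0))" for i
    by (simp add: fun_eq_iff cdiff_def I_def w_def F_def)
  have dirac: "(\<Sum>i<2*m. \<gamma> i ** quad (cdiff q i)) = (4 * (real m + 1)) *\<^sub>R cl F + cl w ** quad I"
    unfolding cd by (rule dirac_identity[OF Isk FI])
  \<comment> \<open>Since \<Theta> is i/2 times \<open>quad I\<close>, its eigenvalue - wt means 2 i
    wt for \<open>quad I\<close>: four times \<open>?c\<close>, the coefficient of V that comes from
    the determinant bundle.\<close>
  have QI: "quad I *v \<phi> q = (4 * ?c) *s \<phi> q"
  proof -
    have "mat (\<i> / 2) ** quad I *v \<phi> q = of_int (- wt) *s \<phi> q"
      using Th unfolding Theta_quad I_def[abs_def] .
    then have "(\<i> / 2) *s (quad I *v \<phi> q) = of_int (- wt) *s \<phi> q"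
      by (simp only: matrix_vector_mul_assoc[symmetric] matrix_vector_linear(8))
    then have "(- 2 * \<i>) *s ((\<i> / 2) *s (quad I *v \<phi> q)) = (- 2 * \<i>) *s (of_int (- wt) *s \<phi> q)" by simp
    then show ?thesis by (simp add: vector_smult_assoc mult.commute)
  qed
  have clF: "(\<Sum>i<2*m. F i *\<^sub>R (\<gamma> i *v \<phi> q)) = cl F *v \<phi> q" for F
    by (simp add: cl_def sum_matrix_vector matrix_vector_linear)
  have "kohn_dirac m M \<theta>' nab' E \<kappa> wt \<gamma> P fr' dt' (\<lambda>q. exp (?r * f (proj P q)) *\<^sub>R \<phi> q) q =
      (\<Sum>i<2*m. \<gamma> i *v (?l *\<^sub>R (spinor_deriv m M \<theta> nab E \<kappa> wt \<gamma> P fr dt q (fr q i) \<phi>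
      + (?r * F i) *\<^sub>R \<phi> q + (1/4) *\<^sub>R (quad (cdiff q i) *v \<phi> q) - (?c * of_real (w i)) *s \<phi> q)))"
    unfolding kohn_dirac_def
  proof (rule sum.cong[OF refl])
    fix i assume "i \<in> {..<2*m}"
    then have i: "i < 2*m" by simp
    have l: "exp ((?r - 1) * f ?x) = ?l" by (simp add: algebra_simps)
    show "clifford_mult m M \<theta>' \<gamma> P fr' q (fr' q i) *v
        spinor_deriv m M \<theta>' nab' E \<kappa> wt \<gamma> P fr' dt' q (fr' q i) (\<lambda>q. exp (?r * f (proj P q)) *\<^sub>R \<phi> q) =
      \<gamma> i *v (?l *\<^sub>R (spinor_deriv m M \<theta> nab E \<kappa> wt \<gamma> P fr dt q (fr q i) \<phi>
      + (?r * F i) *\<^sub>R \<phi> q + (1/4) *\<^sub>R (quad (cdiff q i) *v \<phi> q) - (?c * of_real (w i)) *s \<phi> q))"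
      unfolding clifford_mult_fr(2)[OF i] spinor_deriv_conformal[OF i \<phi>] l F_def w_def by simp
  qed
  also have "\<dots> = ?l *\<^sub>R ((\<Sum>i<2*m. \<gamma> i *v spinor_deriv m M \<theta> nab E \<kappa> wt \<gamma> P fr dt q (fr q i) \<phi>)
      + ?r *\<^sub>R (cl F *v \<phi> q) + (1/4) *\<^sub>R ((\<Sum>i<2*m. \<gamma> i ** quad (cdiff q i)) *v \<phi> q)
      - ?c *s (cl w *v \<phi> q))"
  proof -
    have s: "c *s (\<Sum>i<2*m. w i *\<^sub>R u i) = (\<Sum>i<2*m. (c * of_real (w i)) *s u i)" for c and u :: "nat \<Rightarrow> complex^'s"
      by (simp add: vec_eq_iff sum_distrib_left scaleR_conv_of_real[where 'a = complex] ac_simps)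
    show ?thesis
      unfolding clF[symmetric] s sum_matrix_vector
      by (simp add: matrix_vector_linear scaleR_sum_right sum.distrib sum_subtractf matrix_vector_mul_assoc
          scaleR_add_right scaleR_diff_right)
  qed
  also have "(\<Sum>i<2*m. \<gamma> i ** quad (cdiff q i)) *v \<phi> q =
      (4 * (real m + 1)) *\<^sub>R (cl F *v \<phi> q) + (4 * ?c) *s (cl w *v \<phi> q)"
    unfolding dirac by (simp only: matrix_vector_linear matrix_vector_mul_assoc[symmetric] QI)
  also have "(\<Sum>i<2*m. \<gamma> i *v spinor_deriv m M \<theta> nab E \<kappa> wt \<gamma> P fr dt q (fr q i) \<phi>)
      + ?r *\<^sub>R (cl F *v \<phi> q) + (1/4) *\<^sub>R ((4 * (real m + 1)) *\<^sub>R (cl F *v \<phi> q) + (4 * ?c) *s (cl w *v \<phi> q))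
      - ?c *s (cl w *v \<phi> q) = kohn_dirac m M \<theta> nab E \<kappa> wt \<gamma> P fr dt \<phi> q"
  proof -
    have "(\<Sum>i<2*m. \<gamma> i *v spinor_deriv m M \<theta> nab E \<kappa> wt \<gamma> P fr dt q (fr q i) \<phi>) = kohn_dirac m M \<theta> nab E \<kappa> wt \<gamma> P fr dt \<phi> q"
      unfolding kohn_dirac_def by (intro sum.cong refl) (simp add: clifford_mult_fr)
    \<comment> \<open>Here B is the gradient and D the vector V acting on the spinor; the 1/4 of the
      lift cancels the 4 in both coefficients.\<close>
    moreover have "A + ?r *\<^sub>R B + (1/4) *\<^sub>R ((4 * (real m + 1)) *\<^sub>R B + (4 * ?c) *s D) - ?c *s D = A"
      for A B D :: "complex^'s"
      by (simp add: vec_eq_iff scaleR_conv_of_real[where 'a = complex] field_simps)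
    ultimately show ?thesis by simp
  qed
  finally show ?thesis .
qed

end

theorem mainTheorem1:
  fixes M :: "('p::{t2_space, second_countable_topology}, 'n::finite) cr_struct"
    and m :: nat and wt :: int
    and E :: "('e, 'p, complex) fbundle" and \<kappa> :: "'e \<Rightarrow> (nat \<Rightarrow> 'p tvec) \<Rightarrow> complex"
    and \<gamma> :: "nat \<Rightarrow> complex^'s^'s"
    and \<theta> \<theta>' :: "'p \<Rightarrow> 'p tvec \<Rightarrow> real" and f :: "'p \<Rightarrow> real"
    and nab nab' :: "'p \<Rightarrow> 'p tvec \<Rightarrow> ('p \<Rightarrow> 'p tvec) \<Rightarrow> 'p tvec"
    and P :: "('q, 'p, complex^'s^'s) fbundle"
    and fr fr' :: "'q \<Rightarrow> nat \<Rightarrow> 'p tvec" and dt dt' :: "'q \<Rightarrow> 'e \<Rightarrow> complex"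
    and \<phi> :: "'q \<Rightarrow> complex^'s"
  assumes "m \<ge> 1"
    and "cr_manifold m M"
    and "line_bundle M E" and "canonical_root m M E \<kappa>"
    and "clifford_module m \<gamma>"
    and "\<bar>wt\<bar> \<le> int m" and "even (int m + wt)"
    and "pseudo_hermitian M \<theta>"
    and "spinc_structure m M \<theta> E \<kappa> wt \<gamma> P fr dt"
    and "smooth_fun M UNIV f"
    and "\<theta>' = (\<lambda>x v. exp (2 * f x) * \<theta> x v)"
    and "conformal_spinc m M \<theta> f E \<kappa> wt \<gamma> P fr dt fr' dt'"
    and "webster_tanaka M \<theta> nab" and "webster_tanaka M \<theta>' nab'"
    and "spinor_field m M \<gamma> P \<phi>"
    and "\<forall>q. Theta m M \<theta> \<gamma> P fr q *v \<phi> q = of_int (- wt) *s \<phi> q"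
  shows "kohn_dirac m M \<theta>' nab' E \<kappa> wt \<gamma> P fr' dt'
           (\<lambda>q. exp (- (real m + 1) * f (proj P q)) *\<^sub>R \<phi> q) =
         (\<lambda>q. exp (- (real m + 2) * f (proj P q)) *\<^sub>R
           kohn_dirac m M \<theta> nab E \<kappa> wt \<gamma> P fr dt \<phi> q)"
proof -
  interpret cr_mfd M m by unfold_locales (fact assms(2))
  \<comment> \<open>The smooth orthonormal frames are the images under \<open>fr\<close> of local
    sections of \<open>P\<close>.\<close>
  interpret ph_mfd M m \<theta>
  proof
    show "pseudo_hermitian M \<theta>" by (fact assms(8))
    fix x
    have fb: "fibre_bundle M P (spinc_group m \<gamma>) (spinc_group m \<gamma>) (**)"
      and so: "\<And>q. so_frame m M \<theta> (proj P q) (fr q)"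
      and vg: "\<And>x s j. local_section M P x s \<Longrightarrow> j < 2*m \<Longrightarrow> vec_germ M x (\<lambda>y. fr (s y) j)"
      using assms(9) unfolding spinc_structure_def by blast+
    \<comment> \<open>The structure group contains the identity, so every fibre of \<open>P\<close>
      has a point through which a section can be drawn.\<close>
    have "mat 1 ** mat 1 \<in> spinc_group m \<gamma>"
      unfolding spinc_group_def using spin_group.one by (force intro!: exI[of _ 1] exI[of _ "mat 1"])
    moreover obtain U \<tau> where "(U, \<tau>) \<in> triv P" "x \<in> U"
    proof -
      have "x \<in> (\<Union>(U, \<tau>)\<in>triv P. U)" using fb unfolding fibre_bundle_def by (metis UNIV_I)
      then show thesis using that by auto
    qed
    moreover have "\<forall>(U, \<tau>)\<in>triv P. open U \<and> (\<forall>x\<in>U. bij_betw \<tau> {\<xi>. proj P \<xi> = x} (spinc_group m \<gamma>))"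
      using fb unfolding fibre_bundle_def by (elim conjE)
    ultimately have "mat 1 ** mat 1 \<in> \<tau> ` {\<xi>. proj P \<xi> = x}" by (auto simp: bij_betw_def)
    then obtain q where q: "proj P q = x" by auto
    obtain s where s: "local_section M P x s"
      using ex_local_section[OF fb bounded_bilinear_matrix_mult, of q] q by blast
    have on: "\<forall>\<^sub>F y in nhds x. orthonormal (2*m) M \<theta> y (fr (s y))"
      using local_section_proj[OF s] by eventually_elim (use so in \<open>metis so_frame_def\<close>)
    have "hor_germ M x (\<lambda>y. fr (s y) k)" if "k < 2*m" for k
      unfolding hor_germ_iff using vg[OF s that] on that by (auto simp: orthonormal_def elim: eventually_mono)
    with on show "\<exists>s. (\<forall>k<2*m. hor_germ M x (\<lambda>y. s y k)) \<and> (\<forall>\<^sub>F y in nhds x. orthonormal (2*m) M \<theta> y (s y))"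
      by (intro exI[of _ "\<lambda>y. fr (s y)"]) simp
  qed
  interpret conformal_spin M m \<theta> f nab nab' \<gamma> E \<kappa> wt P fr fr' dt dt'
    using assms by unfold_locales simp_all
  show ?thesis
    unfolding assms(11) by (rule ext) (rule kohn_dirac_conformal[OF assms(15) assms(16)[rule_format]])
qed

end
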